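(* Let $\mathcal{Y}\subset\mathbb{R}^m$ be closed and let $\nu$ be a Borel measure on $\mathbb{R}^m$ with $\mathrm{supp}(\nu)=\mathcal{Y}$, $\int_{\mathcal{Y}}|h|\,\mathrm{d}\nu<\infty$ for all $h\in\mathbb{R}[\boldsymbol{y}]$, and $\sum_{d=1}^{\infty}\left(\int_{\mathcal{Y}}y_j^{2d}\,\mathrm{d}\nu(\boldsymbol{y})\right)^{-\frac{1}{2d}}=\infty$ for every $j\in\{1,\ldots,m\}$. Let $G\in\mathbb{S}[\boldsymbol{x},\boldsymbol{y}]^q$, $$\mathcal{X}=\{\boldsymbol{x}\in\mathbb{R}^n\mid G(\boldsymbol{x},\boldsymbol{y})\succeq 0,\ \forall\boldsymbol{y}\in\mathcal{Y}\},$$ and let $F\in\mathbb{S}[\boldsymbol{x}]^p$ be positive semidefinite at every point of $\mathcal{X}$. Then for any $\varepsilon>0$ there exist $N_\varepsilon\in\mathbb{N}$ and SOS matrices $S_0\in\mathbb{S}[\boldsymbol{x}]^p$, $S\in\mathbb{S}[\boldsymbol{x},\boldsymbol{y}]^{pq}$ with $\deg S_0\le 2(N_\varepsilon+d_F)$ and $\deg_{\boldsymbol{x}}S\le 2(N_\varepsilon+d_F-d_G)$ such that $$\theta^{N_\varepsilon}\left(F(\boldsymbol{x})+\varepsilon\theta^{d_F}I_p\right)=S_0(\boldsymbol{x})+\int_{\mathcal{Y}}\langle S(\boldsymbol{x},\boldsymbol{y}),G(\boldsymbol{x},\boldsymbol{y})\rangle_p\,\mathrm{d}\nu(\boldsymbol{y}),$$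 where $\theta=1+\Vert\boldsymbol{x}\Vert^2$.
   Context: $\boldsymbol{x}=(x_1,\ldots,x_n)$, $\boldsymbol{y}=(y_1,\ldots,y_m)$; $\mathbb{N}$ includes $0$. $\mathbb{S}[\cdot]^q$ denotes $q\times q$ symmetric matrices with real polynomial entries in the indicated variables. For a polynomial matrix $T$, $\deg T$ (resp. $\deg_{\boldsymbol{x}}T$) is the maximum over entries of the total degree (resp. total degree in $\boldsymbol{x}$). For $H=[H_{ij}]\in\mathbb{S}[\boldsymbol{x},\boldsymbol{y}]^r$ (in particular for $H\in\mathbb{S}[\boldsymbol{x}]^r$), $d_H:=\max\{\lfloor\deg_{\boldsymbol{x}}(H_{ij})/2\rfloor+1: i,j\in\{1,\ldots,r\}\}$. An $r\times r$ SOS matrix is one of the form $T^{\intercal}T$ with $T$ an $l\times r$ real polynomial matrix in the same variables, $l\in\mathbb{N}$. For $A\in\mathbb{R}^{pq\times pq}$, $B\in\mathbb{R}^{q\times q}$, $\langle A,B\rangle_p:=\mathrm{tr}_p(A^{\intercal}(I_p\otimes B))\in\mathbb{R}^{p\times p}$, where for $C=[C_{ij}]_{i,j=1}^p$ with blocks $C_{ij}\in\mathbb{R}^{q\times q}$, $\mathrm{tr}_p(C):=[\mathrm{tr}(C_{ij})]_{i,j=1}^p$; the same definition is used for polynomial matrices. For $H(\boldsymbol{x},\boldsymbol{y})=\sum_\beta H_\beta(\boldsymbol{x})\boldsymbol{y}^\beta$, $\int_{\mathcal{Y}}H\,\mathrm{d}\nu(\boldsymbol{y}):=\sum_\beta H_\beta(\boldsymbol{x})\int_{\mathcal{Y}}\boldsymbol{y}^\beta\,\mathrm{d}\nu(\boldsymbol{y})$.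 *)

theory Defs
  imports "HOL-Analysis.Analysis" "HOL-Library.Poly_Mapping"
begin

text \<open>
  Real polynomials in the (finitely many) variables \<open>'v\<close>, as the monoid algebra over the
  exponent vectors. The ring \<open>\<real>[x]\<close> is \<open>'n rpoly\<close> and \<open>\<real>[x, y]\<close> is \<open>('n + 'm) rpoly\<close>, with
  \<open>Inl i\<close> standing for the variable \<open>x\<^sub>i\<close> and \<open>Inr j\<close> for \<open>y\<^sub>j\<close>.
\<close>

type_synonym 'v rpoly = "('v \<Rightarrow>\<^sub>0 nat) \<Rightarrow>\<^sub>0 real"

definition Const :: "real \<Rightarrow> 'v rpoly" where
  "Const c = Poly_Mapping.single 0 c"

definition Var :: "'v \<Rightarrow> 'v rpoly" where
  "Var v = Poly_Mapping.single (Poly_Mapping.single v 1) 1"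

definition monom_eval :: "('v::finite \<Rightarrow>\<^sub>0 nat) \<Rightarrow> ('v \<Rightarrow> real) \<Rightarrow> real" where
  "monom_eval \<alpha> a = (\<Prod>v\<in>UNIV. a v ^ Poly_Mapping.lookup \<alpha> v)"

definition poly_eval :: "'v::finite rpoly \<Rightarrow> ('v \<Rightarrow> real) \<Rightarrow> real" where
  "poly_eval P a = (\<Sum>\<alpha>\<in>Poly_Mapping.keys P. Poly_Mapping.lookup P \<alpha> * monom_eval \<alpha> a)"

text \<open>
  The total degree in the variables belonging to \<open>V\<close>; the zero polynomial gets degree \<open>0\<close>.
\<close>

definition deg_in :: "'v::finite set \<Rightarrow> 'v rpoly \<Rightarrow> nat" where
  "deg_in V P = Max (insert 0 ((\<lambda>\<alpha>. \<Sum>v\<in>V. Poly_Mapping.lookup \<alpha> v) ` Poly_Mapping.keys P))"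

definition mat_deg_in :: "'v::finite set \<Rightarrow> 'v rpoly ^ 'r ^ 's \<Rightarrow> nat" where
  "mat_deg_in V T = Max {deg_in V (T $ i $ j) |i j. True}"

text \<open>
  The number \<open>d\<^sub>H\<close>; here \<open>V\<close> is the set of the \<open>x\<close>-variables among the variables of \<open>H\<close>,
  so \<open>UNIV\<close> for \<open>H\<close> over \<open>\<real>[x]\<close> and \<open>range Inl\<close> for \<open>H\<close> over \<open>\<real>[x, y]\<close>.
\<close>

definition half_deg :: "'v::finite set \<Rightarrow> 'v rpoly ^ 'r ^ 'r \<Rightarrow> nat" where
  "half_deg V H = Max {deg_in V (H $ i $ j) div 2 + 1 |i j. True}"

definition symmetric_mat :: "'a ^ 'r ^ 'r \<Rightarrow> bool" where
  "symmetric_mat A \<longleftrightarrow> transpose A = A"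

definition psd :: "real ^ 'r ^ 'r \<Rightarrow> bool" where
  "psd A \<longleftrightarrow> symmetric_mat A \<and> (\<forall>v. v \<bullet> (A *v v) \<ge> 0)"

definition mat_eval :: "'v::finite rpoly ^ 'r ^ 's \<Rightarrow> ('v \<Rightarrow> real) \<Rightarrow> real ^ 'r ^ 's" where
  "mat_eval M a = map_matrix (\<lambda>P. poly_eval P a) M"

abbreviation joint_point :: "real ^ 'n \<Rightarrow> real ^ 'm \<Rightarrow> 'n + 'm \<Rightarrow> real" where
  "joint_point x y \<equiv> case_sum (($) x) (($) y)"

text \<open>
  \<open>M = T\<^sup>T T\<close> for an \<open>l \<times> r\<close> polynomial matrix \<open>T\<close>. As \<open>l\<close> is existentially quantified, it
  cannot be an index type, and \<open>T\<close> is given by its rows \<open>T 0, \<dots>, T (l - 1)\<close>.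
\<close>

definition sos_mat :: "'v rpoly ^ 'r ^ 'r \<Rightarrow> bool" where
  "sos_mat M \<longleftrightarrow> (\<exists>(l::nat) (T :: nat \<Rightarrow> 'v rpoly ^ 'r).
     M = (\<chi> i j. \<Sum>k<l. T k $ i * T k $ j))"

text \<open>
  A \<open>pq \<times> pq\<close> matrix is indexed by \<open>'p \<times> 'q\<close>: the entry at \<open>(i, a), (j, b)\<close> is the
  \<open>(a, b)\<close> entry of the \<open>q \<times> q\<close> block with block position \<open>(i, j)\<close>.
\<close>

definition kronecker ::
  "'a::comm_semiring_1 ^ 'p ^ 'p \<Rightarrow> 'a ^ 'q ^ 'q \<Rightarrow> 'a ^ ('p::finite \<times> 'q::finite) ^ ('p \<times> 'q)" where
  "kronecker A B = (\<chi> r s. A $ fst r $ fst s * B $ snd r $ snd s)"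

definition partial_trace ::
  "'a::comm_semiring_1 ^ ('p::finite \<times> 'q::finite) ^ ('p \<times> 'q) \<Rightarrow> 'a ^ 'p ^ 'p" where
  "partial_trace C = (\<chi> i j. trace (\<chi> a b. C $ (i, a) $ (j, b)))"

definition block_inner ::
  "'a::comm_semiring_1 ^ ('p::finite \<times> 'q::finite) ^ ('p \<times> 'q) \<Rightarrow> 'a ^ 'q ^ 'q \<Rightarrow> 'a ^ 'p ^ 'p" where
  "block_inner A B = partial_trace (transpose A ** kronecker (mat 1) B)"

text \<open>
  The coefficient \<open>H\<^sub>\<beta>(x)\<close> in \<open>H(x, y) = \<Sum>\<^sub>\<beta> H\<^sub>\<beta>(x) y\<^sup>\<beta>\<close>. For an exponent vector \<open>\<gamma>\<close> of a
  monomial in \<open>(x, y)\<close>, \<open>map_key Inl \<gamma>\<close> and \<open>map_key Inr \<gamma>\<close> are its \<open>x\<close>- and \<open>y\<close>-part.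
\<close>

definition y_coeff :: "('n + 'm) rpoly \<Rightarrow> ('m \<Rightarrow>\<^sub>0 nat) \<Rightarrow> 'n rpoly" where
  "y_coeff P \<beta> = (\<Sum>\<gamma>\<in>{\<gamma> \<in> Poly_Mapping.keys P. Poly_Mapping.map_key Inr \<gamma> = \<beta>}.
     Poly_Mapping.single (Poly_Mapping.map_key Inl \<gamma>) (Poly_Mapping.lookup P \<gamma>))"

definition y_integral ::
  "(real ^ 'm) measure \<Rightarrow> (real ^ 'm) set \<Rightarrow> ('n + 'm::finite) rpoly \<Rightarrow> 'n rpoly" where
  "y_integral \<nu> Y P = (\<Sum>\<beta>\<in>Poly_Mapping.map_key Inr ` Poly_Mapping.keys P.
     y_coeff P \<beta> * Const (LINT y:Y|\<nu>. monom_eval \<beta> (($) y)))"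

definition mat_y_integral ::
  "(real ^ 'm) measure \<Rightarrow> (real ^ 'm) set \<Rightarrow> ('n + 'm::finite) rpoly ^ 'r ^ 's
     \<Rightarrow> 'n rpoly ^ 'r ^ 's" where
  "mat_y_integral \<nu> Y H = map_matrix (y_integral \<nu> Y) H"

definition measure_support :: "'a::topological_space measure \<Rightarrow> 'a set" where
  "measure_support \<mu> = {y. \<forall>U. open U \<and> y \<in> U \<longrightarrow> emeasure \<mu> U > 0}"

text \<open>
  The series is taken in the extended nonnegative reals, so that a vanishing moment
  contributes \<open>0\<^bsup>-1/(2d)\<^esup> = \<infinity>\<close> (on the reals, \<open>0 powr a = 0\<close>). The index \<open>d\<close> is shifted by one.
\<close>

definition carleman :: "(real ^ 'm) measure \<Rightarrow> (real ^ 'm) set \<Rightarrow> 'm \<Rightarrow> bool" where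
  "carleman \<nu> Y j \<longleftrightarrow>
     suminf (\<lambda>d. inverse (ennreal ((LINT y:Y|\<nu>. (y $ j) ^ (2 * Suc d)) powr (1 / real (2 * Suc d))))) = \<infinity>"

definition theta :: "'n::finite rpoly" where
  "theta = 1 + (\<Sum>i\<in>UNIV. Var i ^ 2)"

end

theory Submission
  imports Defs "HOL-Real_Asymp.Real_Asymp"
begin

text \<open>
  Write \<open>\<theta> = 1 + |x|\<^sup>2\<close>. A polynomial of degree at most \<open>2d\<close>, divided by \<open>\<theta>\<^sup>d\<close>, is a bounded
  function on \<open>\<real>\<^sup>n\<close> that extends continuously to projective space. This compactification is what
  makes a certificate with denominators \<open>\<theta>\<^sup>N\<close> possible without compactness of \<open>X\<close>: since
  \<open>deg F < 2 d\<^sub>F\<close>, the matrix \<open>F / \<theta>^d\<^sub>F\<close> tends to \<open>0\<close> at infinity, and the summand \<open>\<epsilon> I\<close> makes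
  \<open>F / \<theta>^d\<^sub>F + \<epsilon> I\<close> positive there as well as near \<open>X\<close>. The certificate is found in two steps.

  \<^bold>\<open>From \<open>X\<close> to the whole space.\<close> If \<open>x\<close> is not in \<open>X\<close>, then \<open>v\<^sup>T G(x, y\<^sub>0) v < 0\<close> for some
  vector \<open>v\<close> and some \<open>y\<^sub>0\<close> in the support of \<open>\<nu>\<close>. The Carleman condition makes polynomials dense
  in weighted square mean, so that there is a polynomial \<open>p\<close> for which
  \<open>g(x) = \<integral> p(y)\<^sup>2 v\<^sup>T G(x, y) v d\<nu>(y)\<close> is negative as well (\<open>carleman_negative_square\<close>). Each such
  \<open>g\<close>, multiplied by the square of a polynomial in \<open>x\<close> and by the identity matrix, has the form
  \<open>\<integral> \<langle>S, G\<rangle>\<^sub>p d\<nu>\<close>. The points where \<open>F / \<theta>^d\<^sub>F + \<epsilon> I\<close> is not clearly positive form a compact set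
  outside \<open>X\<close>, and finitely many \<open>g\<close> suffice for it (\<open>finite_test_family\<close>). With \<open>a\<close> a small
  multiple of \<open>g / \<theta>^d\<^sub>G\<close>, the values of \<open>a\<close> lie in \<open>[-1, 1]\<close>, and \<open>a (1 - a)^(2M)\<close> is at most
  \<open>1/(2M+1)\<close> everywhere and tends to minus infinity with \<open>M\<close> where \<open>a\<close> is negative. Hence
  subtracting the sum of these functions leaves a matrix \<open>P\<close> with \<open>P / \<theta>\<^sup>D\<close> uniformly positive definite
  on all of \<open>\<real>\<^sup>n\<close> (\<open>damped_perturbation\<close>).

  \<^bold>\<open>Uniformly positive matrices.\<close> For such a \<open>P\<close> the matrix \<open>\<theta>\<^sup>N P\<close> is a sum of squares for large
  \<open>N\<close>; this is Reznick's theorem for matrices (\<open>matrix_reznick\<close>). It is reduced to Polya's theorem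
  in the new variables \<open>t = (z\<^sub>i \<plusminus> z\<^sub>j)\<^sup>2\<close>, where \<open>z = (1, x)\<close>: every form of even degree in \<open>z\<close> is a form in
  \<open>t\<close>, monomials in \<open>t\<close> are squares in \<open>z\<close>, and the sum of all \<open>t\<close> is a multiple of \<open>|z|\<^sup>2\<close>. A penalty
  that vanishes for the \<open>t\<close> coming from some \<open>z\<close> makes the form positive on the whole simplex.
  Polya's theorem (\<open>matrix_polya\<close>) expresses that a form of degree \<open>d\<close>, multiplied by a high power
  of the sum of the variables, has as coefficients averages over samples of \<open>d\<close> letters without
  replacement from a long word, and that sampling with replacement, which yields values of the
  form, is almost the same.

  \<^bold>\<open>Density.\<close> The distance of \<open>w(y) y\<^sub>j\<^sup>k cos(t y\<^sub>j + s)\<close> to the polynomials, as a function of \<open>t\<close>,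
  obeys the Taylor estimates of the derivatives of a smooth function that is flat at \<open>0\<close>, with
  bounds given by moments. Bang's argument for the Denjoy--Carleman theorem uses nothing else and
  shows that the distance vanishes (\<open>bang_vanishing\<close>). Thus products of cosines, and as their
  limits Gaussian functions of arbitrarily small width, are approximated by polynomials, and a
  narrow Gaussian centred at \<open>y\<^sub>0\<close> detects the sign of \<open>v\<^sup>T G(x, y) v\<close> at \<open>y\<^sub>0\<close>.
\<close>

section \<open>Polynomials as functions, and their degrees\<close>

lemma poly_eval_superset:
  assumes "finite A" "Poly_Mapping.keys P \<subseteq> A"
  shows "poly_eval P a = (\<Sum>\<alpha>\<in>A. Poly_Mapping.lookup P \<alpha> * monom_eval \<alpha> a)"
  unfolding poly_eval_def using assms
  by (intro sum.mono_neutral_left) (auto simp: in_keys_iff)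

lemma poly_eval_add: "poly_eval (P + Q) a = poly_eval P a + poly_eval Q a"
proof -
  let ?A = "Poly_Mapping.keys P \<union> Poly_Mapping.keys Q"
  have "poly_eval (P + Q) a = (\<Sum>\<alpha>\<in>?A. Poly_Mapping.lookup (P + Q) \<alpha> * monom_eval \<alpha> a)"
    using Poly_Mapping.keys_add[of P Q] by (intro poly_eval_superset) auto
  also have "\<dots> = (\<Sum>\<alpha>\<in>?A. Poly_Mapping.lookup P \<alpha> * monom_eval \<alpha> a)
      + (\<Sum>\<alpha>\<in>?A. Poly_Mapping.lookup Q \<alpha> * monom_eval \<alpha> a)"
    by (simp add: lookup_add distrib_right sum.distrib)
  also have "\<dots> = poly_eval P a + poly_eval Q a"
    by (subst (1 2) poly_eval_superset[of ?A]) auto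
  finally show ?thesis .
qed

lemma poly_eval_zero [simp]: "poly_eval 0 a = 0"
  by (simp add: poly_eval_def)

lemma poly_eval_sum: "poly_eval (\<Sum>i\<in>I. P i) a = (\<Sum>i\<in>I. poly_eval (P i) a)"
  by (induction I rule: infinite_finite_induct) (auto simp: poly_eval_add)

lemma poly_eval_single: "poly_eval (Poly_Mapping.single \<alpha> c) a = c * monom_eval \<alpha> a"
  by (cases "c = 0") (auto simp: poly_eval_def)

lemma monom_eval_add: "monom_eval (\<alpha> + \<beta>) a = monom_eval \<alpha> a * monom_eval \<beta> a"
  by (simp add: monom_eval_def lookup_add power_add prod.distrib)

lemma rpoly_eq_sum_single:
  "P = (\<Sum>\<alpha>\<in>Poly_Mapping.keys P. Poly_Mapping.single \<alpha> (Poly_Mapping.lookup P \<alpha>))"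
  by (intro poly_mapping_eqI)
     (auto simp: lookup_sum lookup_single when_def not_in_keys_iff_lookup_eq_zero)

lemma poly_eval_mult: "poly_eval (P * Q) a = poly_eval P a * poly_eval Q a"
proof -
  let ?s = "\<lambda>P \<alpha>. Poly_Mapping.single \<alpha> (Poly_Mapping.lookup P \<alpha>)"
  have "P * Q = (\<Sum>\<alpha>\<in>Poly_Mapping.keys P. ?s P \<alpha>) * (\<Sum>\<beta>\<in>Poly_Mapping.keys Q. ?s Q \<beta>)"
    by (simp flip: rpoly_eq_sum_single)
  also have "\<dots> = (\<Sum>\<alpha>\<in>Poly_Mapping.keys P. \<Sum>\<beta>\<in>Poly_Mapping.keys Q. ?s P \<alpha> * ?s Q \<beta>)"
    by (rule sum_product)
  also have "poly_eval \<dots> a = poly_eval P a * poly_eval Q a"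
    by (simp add: poly_eval_sum mult_single poly_eval_single monom_eval_add
        poly_eval_def[of P] poly_eval_def[of Q] sum_product mult_ac)
  finally show ?thesis .
qed

lemma monom_eval_zero [simp]: "monom_eval 0 a = 1"
  by (simp add: monom_eval_def)

lemma poly_eval_Const [simp]: "poly_eval (Const c) a = c"
  by (simp add: Const_def poly_eval_single)

lemma poly_eval_one [simp]: "poly_eval 1 a = 1"
  using poly_eval_Const[of 1 a] by (simp add: Const_def)

lemma monom_eval_single: "monom_eval (Poly_Mapping.single v n) a = a v ^ n"
proof -
  have "monom_eval (Poly_Mapping.single v n) a = (\<Prod>u\<in>UNIV. if u = v then a v ^ n else 1)"
    unfolding monom_eval_def by (intro prod.cong) (auto simp: lookup_single when_def)
  thus ?thesis by simp
qed

lemma poly_eval_Var [simp]: "poly_eval (Var v) a = a v"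
  by (simp add: Var_def poly_eval_single monom_eval_single)

lemma poly_eval_power: "poly_eval (P ^ k) a = poly_eval P a ^ k"
  by (induction k) (auto simp: poly_eval_mult)

lemma poly_eval_prod: "poly_eval (\<Prod>i\<in>I. P i) a = (\<Prod>i\<in>I. poly_eval (P i) a)"
  by (induction I rule: infinite_finite_induct) (auto simp: poly_eval_mult)

lemma poly_eval_uminus: "poly_eval (- P) a = - poly_eval P a"
  using poly_eval_add[of P "-P" a] by simp

lemma poly_eval_diff: "poly_eval (P - Q) a = poly_eval P a - poly_eval Q a"
  using poly_eval_add[of P "-Q" a] by (simp add: poly_eval_uminus)

lemmas poly_eval_hom = poly_eval_add poly_eval_mult poly_eval_sum poly_eval_power poly_eval_prod
  poly_eval_uminus poly_eval_diff

lemma poly_eval_theta: "poly_eval theta a = 1 + (\<Sum>i\<in>UNIV. (a i)\<^sup>2)"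
  by (simp add: theta_def poly_eval_hom)

text \<open>
  By induction on the set of variables. Varying only the variable \<open>u\<close> gives a univariate polynomial
  that vanishes identically; its coefficient of degree \<open>k\<close> is the sum over the exponent vectors
  with entry \<open>k\<close> at \<open>u\<close>, to which the induction hypothesis applies.
\<close>

lemma monomials_independent:
  fixes c :: "('v::finite \<Rightarrow>\<^sub>0 nat) \<Rightarrow> real"
  assumes "finite V" "finite A"
    and "\<And>\<alpha> \<beta>. \<alpha> \<in> A \<Longrightarrow> \<beta> \<in> A \<Longrightarrow> (\<And>v. v \<in> V \<Longrightarrow> Poly_Mapping.lookup \<alpha> v = Poly_Mapping.lookup \<beta> v)
          \<Longrightarrow> \<alpha> = \<beta>"
    and "\<And>a. (\<Sum>\<alpha>\<in>A. c \<alpha> * (\<Prod>v\<in>V. a v ^ Poly_Mapping.lookup \<alpha> v)) = 0"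
  shows "\<forall>\<alpha>\<in>A. c \<alpha> = 0"
  using assms
proof (induction V arbitrary: A rule: finite_induct)
  case empty
  show ?case
  proof
    fix \<alpha> assume "\<alpha> \<in> A"
    with empty.prems(2) have "A = {\<alpha>}" by blast
    with empty.prems(3) show "c \<alpha> = 0" by simp
  qed
next
  case (insert u V)
  show ?case
  proof
    fix \<alpha> assume \<alpha>: "\<alpha> \<in> A"
    define k where "k = Poly_Mapping.lookup \<alpha> u"
    define slice where "slice j = {\<beta>\<in>A. Poly_Mapping.lookup \<beta> u = j}" for j
    define N where "N = Max ((\<lambda>\<beta>. Poly_Mapping.lookup \<beta> u) ` A)"
    have N: "Poly_Mapping.lookup \<beta> u \<le> N" if "\<beta> \<in> A" for \<beta>
      unfolding N_def using insert.prems(1) that by (intro Max_ge) auto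
    have "\<forall>\<beta>\<in>slice k. c \<beta> = 0"
    proof (rule insert.IH)
      show "finite (slice k)" using insert.prems(1) by (simp add: slice_def)
      show "\<beta> = \<gamma>" if "\<beta> \<in> slice k" "\<gamma> \<in> slice k"
        "\<And>v. v \<in> V \<Longrightarrow> Poly_Mapping.lookup \<beta> v = Poly_Mapping.lookup \<gamma> v" for \<beta> \<gamma>
        using that by (intro insert.prems(2)) (auto simp: slice_def)
      fix a :: "'v \<Rightarrow> real"
      define d where "d j = (\<Sum>\<beta>\<in>slice j. c \<beta> * (\<Prod>v\<in>V. a v ^ Poly_Mapping.lookup \<beta> v))" for j
      have "(\<Sum>j\<le>N. d j * s ^ j) = 0" for s
      proof -
        have *: "(\<Prod>v\<in>insert u V. (a(u := s)) v ^ Poly_Mapping.lookup \<beta> v)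
            = s ^ Poly_Mapping.lookup \<beta> u * (\<Prod>v\<in>V. a v ^ Poly_Mapping.lookup \<beta> v)" for \<beta>
        proof -
          have "(\<Prod>v\<in>V. (a(u := s)) v ^ Poly_Mapping.lookup \<beta> v) = (\<Prod>v\<in>V. a v ^ Poly_Mapping.lookup \<beta> v)"
            using insert.hyps by (intro prod.cong) auto
          thus ?thesis using insert.hyps by simp
        qed
        have "(\<Sum>j\<le>N. d j * s ^ j) =
            (\<Sum>j\<le>N. \<Sum>\<beta>\<in>slice j. c \<beta> * (\<Prod>v\<in>insert u V. (a(u := s)) v ^ Poly_Mapping.lookup \<beta> v))"
          unfolding d_def sum_distrib_right *
          by (intro sum.cong refl) (auto simp: slice_def)
        also have "\<dots> = (\<Sum>\<beta>\<in>A. c \<beta> * (\<Prod>v\<in>insert u V. (a(u := s)) v ^ Poly_Mapping.lookup \<beta> v))"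
          unfolding slice_def using insert.prems(1) N by (intro sum.group) auto
        also have "\<dots> = 0" by (rule insert.prems(3))
        finally show ?thesis .
      qed
      hence "\<forall>j\<le>N. d j = 0" using polyfun_eq_0[of d N] by simp
      with N[OF \<alpha>] show "(\<Sum>\<beta>\<in>slice k. c \<beta> * (\<Prod>v\<in>V. a v ^ Poly_Mapping.lookup \<beta> v)) = 0"
        by (simp add: k_def d_def)
    qed
    with \<alpha> show "c \<alpha> = 0" by (simp add: slice_def k_def)
  qed
qed

text \<open>
  Because of this, all identities between polynomials can be verified pointwise.
\<close>

lemma rpoly_eqI:
  assumes "\<And>a. poly_eval P a = poly_eval Q a"
  shows "P = Q"
proof -
  have "\<forall>\<alpha>\<in>Poly_Mapping.keys (P - Q). Poly_Mapping.lookup (P - Q) \<alpha> = 0"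
  proof (rule monomials_independent[of UNIV])
    show "\<alpha> = \<beta>" if "\<And>v. v \<in> UNIV \<Longrightarrow> Poly_Mapping.lookup \<alpha> v = Poly_Mapping.lookup \<beta> v"
      for \<alpha> \<beta> :: "'a \<Rightarrow>\<^sub>0 nat" using that by (intro poly_mapping_eqI) auto
    fix a :: "'a \<Rightarrow> real"
    have "poly_eval (P - Q) a = 0" using assms by (simp add: poly_eval_diff)
    thus "(\<Sum>\<alpha>\<in>Poly_Mapping.keys (P - Q). Poly_Mapping.lookup (P - Q) \<alpha> *
        (\<Prod>v\<in>UNIV. a v ^ Poly_Mapping.lookup \<alpha> v)) = 0"
      by (simp add: poly_eval_def monom_eval_def)
  qed auto
  hence "P - Q = 0" by (intro poly_mapping_eqI) (metis in_keys_iff lookup_zero)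
  thus ?thesis by simp
qed

lemma deg_in_le_iff:
  "deg_in V P \<le> d \<longleftrightarrow> (\<forall>\<alpha>\<in>Poly_Mapping.keys P. (\<Sum>v\<in>V. Poly_Mapping.lookup \<alpha> v) \<le> d)"
  unfolding deg_in_def by (subst Max_le_iff) auto

lemma deg_in_add: "deg_in V P \<le> d \<Longrightarrow> deg_in V Q \<le> d \<Longrightarrow> deg_in V (P + Q) \<le> d"
  unfolding deg_in_le_iff using Poly_Mapping.keys_add[of P Q] by blast

lemma deg_in_zero [simp]: "deg_in V 0 = 0"
  by (simp add: deg_in_def)

lemma deg_in_sum: "(\<And>i. i \<in> I \<Longrightarrow> deg_in V (P i) \<le> d) \<Longrightarrow> deg_in V (\<Sum>i\<in>I. P i) \<le> d"
  by (induction I rule: infinite_finite_induct) (auto intro: deg_in_add)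

lemma deg_in_mult:
  assumes "deg_in V P \<le> d" "deg_in V Q \<le> e"
  shows "deg_in V (P * Q) \<le> d + e"
  unfolding deg_in_le_iff
proof
  fix \<gamma> assume "\<gamma> \<in> Poly_Mapping.keys (P * Q)"
  then obtain \<alpha> \<beta> where "\<gamma> = \<alpha> + \<beta>" "\<alpha> \<in> Poly_Mapping.keys P" "\<beta> \<in> Poly_Mapping.keys Q"
    using keys_mult[of P Q] by blast
  thus "(\<Sum>v\<in>V. Poly_Mapping.lookup \<gamma> v) \<le> d + e"
    using assms by (auto simp: lookup_add sum.distrib deg_in_le_iff intro: add_mono)
qed

lemma deg_in_uminus: "deg_in V (- P) = deg_in V P"
  by (simp add: deg_in_def)

lemma deg_in_diff: "deg_in V P \<le> d \<Longrightarrow> deg_in V Q \<le> d \<Longrightarrow> deg_in V (P - Q) \<le> d"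
  using deg_in_add[of V P d "- Q"] by (simp add: deg_in_uminus)

lemma deg_in_Const [simp]: "deg_in V (Const c) = 0"
  by (cases "c = 0") (simp_all add: deg_in_def Const_def)

lemma deg_in_one [simp]: "deg_in V 1 = 0"
  using deg_in_Const[of V 1] by (simp add: Const_def del: deg_in_Const)

lemma deg_in_Var: "deg_in V (Var v) \<le> (if v \<in> V then 1 else 0)"
  unfolding deg_in_le_iff by (simp add: Var_def lookup_single when_def)

lemma deg_in_power: "deg_in V P \<le> d \<Longrightarrow> deg_in V (P ^ k) \<le> d * k"
  by (induction k) (auto dest: deg_in_mult)

lemma deg_in_prod:
  "(\<And>i. i \<in> I \<Longrightarrow> deg_in V (P i) \<le> d i) \<Longrightarrow> deg_in V (\<Prod>i\<in>I. P i) \<le> (\<Sum>i\<in>I. d i)"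
  by (induction I rule: infinite_finite_induct) (auto intro: deg_in_mult)

lemma deg_in_theta: "deg_in UNIV theta \<le> 2"
  unfolding theta_def
  by (intro deg_in_add deg_in_sum) (use deg_in_power[OF deg_in_Var, of UNIV _ 2] in auto)

lemma mat_deg_in_le_iff: "mat_deg_in V T \<le> d \<longleftrightarrow> (\<forall>i j. deg_in V (T $ i $ j) \<le> d)"
proof -
  have "{deg_in V (T $ i $ j) |i j. True} = (\<lambda>(i, j). deg_in V (T $ i $ j)) ` UNIV" by auto
  thus ?thesis unfolding mat_deg_in_def by (subst Max_le_iff) auto
qed

text \<open>
  The strictness of the inequality is the reason why \<open>F / \<theta>^d\<^sub>F\<close> vanishes at infinity.
\<close>

lemma deg_in_half_deg: "deg_in V (H $ i $ j) < 2 * half_deg V H"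
proof -
  have "{deg_in V (H $ i $ j) div 2 + 1 |i j. True} = (\<lambda>(i, j). deg_in V (H $ i $ j) div 2 + 1) ` UNIV"
    by auto
  hence "deg_in V (H $ i $ j) div 2 + 1 \<le> half_deg V H"
    unfolding half_deg_def by (intro Max_ge) auto
  thus ?thesis by linarith
qed

definition poly_subst :: "('v::finite \<Rightarrow> 'w rpoly) \<Rightarrow> 'v rpoly \<Rightarrow> 'w rpoly" where
  "poly_subst \<phi> P = (\<Sum>\<alpha>\<in>Poly_Mapping.keys P.
     Const (Poly_Mapping.lookup P \<alpha>) * (\<Prod>v\<in>UNIV. \<phi> v ^ Poly_Mapping.lookup \<alpha> v))"

lemma poly_eval_subst: "poly_eval (poly_subst \<phi> P) a = poly_eval P (\<lambda>v. poly_eval (\<phi> v) a)"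
  by (simp add: poly_subst_def poly_eval_hom poly_eval_def[of P] monom_eval_def)

lemma deg_in_subst:
  assumes "\<And>v. deg_in V (\<phi> v) \<le> e"
  shows "deg_in V (poly_subst \<phi> P) \<le> e * deg_in UNIV P"
  unfolding poly_subst_def
proof (rule deg_in_sum)
  fix \<alpha> assume \<alpha>: "\<alpha> \<in> Poly_Mapping.keys P"
  have "deg_in V (Const (Poly_Mapping.lookup P \<alpha>) * (\<Prod>v\<in>UNIV. \<phi> v ^ Poly_Mapping.lookup \<alpha> v))
      \<le> 0 + (\<Sum>v\<in>UNIV. e * Poly_Mapping.lookup \<alpha> v)"
    by (intro deg_in_mult deg_in_prod deg_in_power assms) simp
  also have "\<dots> = e * (\<Sum>v\<in>UNIV. Poly_Mapping.lookup \<alpha> v)" by (simp add: sum_distrib_left)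
  also have "\<dots> \<le> e * deg_in UNIV P"
    using \<alpha> deg_in_le_iff[of UNIV P "deg_in UNIV P"] by (intro mult_left_mono) auto
  finally show "deg_in V (Const (Poly_Mapping.lookup P \<alpha>) * (\<Prod>v\<in>UNIV. \<phi> v ^ Poly_Mapping.lookup \<alpha> v))
      \<le> e * deg_in UNIV P" .
qed

text \<open>
  Each coordinate satisfies \<open>|a\<^sub>i| \<le> \<theta>(a)\<^bsup>1/2\<^esup>\<close> and \<open>\<theta>(a) \<ge> 1\<close>.
\<close>

lemma poly_growth:
  fixes P :: "'n::finite rpoly"
  shows "\<exists>C\<ge>0. \<forall>a. \<bar>poly_eval P a\<bar> \<le> C * sqrt (poly_eval theta a) ^ deg_in UNIV P"
proof (intro exI conjI allI)
  show "0 \<le> (\<Sum>\<alpha>\<in>Poly_Mapping.keys P. \<bar>Poly_Mapping.lookup P \<alpha>\<bar>)" by (simp add: sum_nonneg)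
  fix a :: "'n \<Rightarrow> real"
  let ?s = "sqrt (poly_eval theta a)"
  have s1: "?s \<ge> 1" by (simp add: poly_eval_theta sum_nonneg)
  have as: "\<bar>a v\<bar> \<le> ?s" for v
  proof -
    have "(a v)\<^sup>2 \<le> poly_eval theta a"
      unfolding poly_eval_theta using member_le_sum[of v UNIV "\<lambda>i. (a i)\<^sup>2"] by (simp add: add_increasing)
    thus ?thesis using real_sqrt_le_mono by fastforce
  qed
  have m: "\<bar>monom_eval \<alpha> a\<bar> \<le> ?s ^ deg_in UNIV P" if "\<alpha> \<in> Poly_Mapping.keys P" for \<alpha>
  proof -
    have "\<bar>monom_eval \<alpha> a\<bar> = (\<Prod>v\<in>UNIV. \<bar>a v\<bar> ^ Poly_Mapping.lookup \<alpha> v)"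
      by (simp add: monom_eval_def abs_prod power_abs)
    also have "\<dots> \<le> (\<Prod>v\<in>UNIV. ?s ^ Poly_Mapping.lookup \<alpha> v)"
      by (intro prod_mono conjI power_mono as) auto
    also have "\<dots> = ?s ^ (\<Sum>v\<in>UNIV. Poly_Mapping.lookup \<alpha> v)" by (simp add: power_sum)
    also have "\<dots> \<le> ?s ^ deg_in UNIV P"
      using that deg_in_le_iff[of UNIV P "deg_in UNIV P"] s1 by (intro power_increasing) auto
    finally show ?thesis .
  qed
  have "\<bar>poly_eval P a\<bar> \<le> (\<Sum>\<alpha>\<in>Poly_Mapping.keys P. \<bar>Poly_Mapping.lookup P \<alpha> * monom_eval \<alpha> a\<bar>)"
    unfolding poly_eval_def by (rule sum_abs)
  also have "\<dots> \<le> (\<Sum>\<alpha>\<in>Poly_Mapping.keys P. \<bar>Poly_Mapping.lookup P \<alpha>\<bar> * ?s ^ deg_in UNIV P)"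
    by (intro sum_mono) (auto simp: abs_mult intro!: mult_left_mono m)
  finally show "\<bar>poly_eval P a\<bar>
      \<le> (\<Sum>\<alpha>\<in>Poly_Mapping.keys P. \<bar>Poly_Mapping.lookup P \<alpha>\<bar>) * ?s ^ deg_in UNIV P"
    by (simp add: sum_distrib_right)
qed

lemma continuous_on_poly_eval:
  assumes "\<And>v. continuous_on S (\<lambda>x. f x v)"
  shows "continuous_on S (\<lambda>x. poly_eval P (f x))"
  unfolding poly_eval_def monom_eval_def by (intro continuous_intros assms)

section \<open>Integration over the second group of variables\<close>

lemma monom_eval_case_sum:
  fixes \<gamma> :: "('n::finite + 'm::finite) \<Rightarrow>\<^sub>0 nat"
  shows "monom_eval \<gamma> (case_sum x y)
    = monom_eval (Poly_Mapping.map_key Inl \<gamma>) x * monom_eval (Poly_Mapping.map_key Inr \<gamma>) y"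
proof -
  have "(UNIV :: ('n + 'm) set) = range Inl \<union> range Inr" by (metis UNIV_sum)
  hence "(\<Prod>v\<in>UNIV. f v) = (\<Prod>v\<in>range Inl \<union> range Inr. f v)" for f :: "'n + 'm \<Rightarrow> real" by simp
  moreover have "range Inl \<inter> range Inr = ({} :: ('n + 'm) set)" by auto
  ultimately show ?thesis
    unfolding monom_eval_def
    by (simp add: prod.union_disjoint prod.reindex map_key.rep_eq)
qed

lemma poly_eval_y_integral:
  fixes P :: "('n::finite + 'm::finite) rpoly"
  assumes "\<And>h :: 'm rpoly. set_integrable \<nu> Y (\<lambda>y. poly_eval h (($) y))"
  shows "poly_eval (y_integral \<nu> Y P) x = (LINT y:Y|\<nu>. poly_eval P (case_sum x (($) y)))"
proof -
  let ?L = "Poly_Mapping.map_key Inl" and ?R = "Poly_Mapping.map_key Inr"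
  let ?K = "Poly_Mapping.keys P"
  define I where "I \<beta> = (LINT y:Y|\<nu>. monom_eval \<beta> (($) y))" for \<beta>
  have int: "set_integrable \<nu> Y (\<lambda>y. monom_eval \<beta> (($) y))" for \<beta> :: "'m \<Rightarrow>\<^sub>0 nat"
    using assms[of "Poly_Mapping.single \<beta> 1"] by (simp add: poly_eval_single)
  have "poly_eval (y_integral \<nu> Y P) x = (\<Sum>\<beta>\<in>?R ` ?K. \<Sum>\<gamma>\<in>{\<gamma>\<in>?K. ?R \<gamma> = \<beta>}.
      Poly_Mapping.lookup P \<gamma> * monom_eval (?L \<gamma>) x * I (?R \<gamma>))"
    by (simp add: y_integral_def y_coeff_def poly_eval_hom poly_eval_single sum_distrib_right I_def)
  also have "\<dots> = (\<Sum>\<gamma>\<in>?K. Poly_Mapping.lookup P \<gamma> * monom_eval (?L \<gamma>) x * I (?R \<gamma>))"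
    by (rule sum.group) auto
  also have "\<dots> = (\<Sum>\<gamma>\<in>?K. LINT y:Y|\<nu>. Poly_Mapping.lookup P \<gamma> * monom_eval (?L \<gamma>) x * monom_eval (?R \<gamma>) (($) y))"
    by (simp add: I_def)
  also have "\<dots> = integral\<^sup>L \<nu> (\<lambda>y. \<Sum>\<gamma>\<in>?K. indicat_real Y y *\<^sub>R
      (Poly_Mapping.lookup P \<gamma> * monom_eval (?L \<gamma>) x * monom_eval (?R \<gamma>) (($) y)))"
    unfolding set_lebesgue_integral_def
    by (rule Bochner_Integration.integral_sum[symmetric])
       (use set_integrable_mult_right[OF int] in \<open>simp add: set_integrable_def\<close>)
  also have "\<dots> = (LINT y:Y|\<nu>. \<Sum>\<gamma>\<in>?K. Poly_Mapping.lookup P \<gamma> * monom_eval (?L \<gamma>) x * monom_eval (?R \<gamma>) (($) y))"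
    unfolding set_lebesgue_integral_def by (simp add: sum_distrib_left)
  finally show ?thesis
    by (simp add: poly_eval_def monom_eval_case_sum mult_ac)
qed

lemma deg_in_y_integral:
  fixes P :: "('n::finite + 'm::finite) rpoly"
  shows "deg_in UNIV (y_integral \<nu> Y P) \<le> deg_in (range Inl) P"
  unfolding y_integral_def
proof (rule deg_in_sum)
  fix \<beta> :: "'m \<Rightarrow>\<^sub>0 nat"
  have "deg_in UNIV (y_coeff P \<beta>) \<le> deg_in (range Inl) P"
    unfolding y_coeff_def
  proof (rule deg_in_sum)
    fix \<gamma> assume "\<gamma> \<in> {\<gamma> \<in> Poly_Mapping.keys P. Poly_Mapping.map_key Inr \<gamma> = \<beta>}"
    hence "(\<Sum>v\<in>range Inl. Poly_Mapping.lookup \<gamma> v) \<le> deg_in (range Inl) P"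
      using deg_in_le_iff[of "range Inl" P "deg_in (range Inl) P"] by auto
    thus "deg_in UNIV (Poly_Mapping.single (Poly_Mapping.map_key Inl \<gamma>) (Poly_Mapping.lookup P \<gamma>))
        \<le> deg_in (range Inl) P"
      by (auto simp: deg_in_le_iff sum.reindex map_key.rep_eq)
  qed
  from deg_in_mult[OF this, of "Const c" 0 for c]
  show "deg_in UNIV (y_coeff P \<beta> * Const (LINT y:Y|\<nu>. monom_eval \<beta> (($) y))) \<le> deg_in (range Inl) P"
    by simp
qed

section \<open>Sums of squares and positive semidefinite matrices\<close>

lemma sos_mat_zero: "sos_mat 0"
  unfolding sos_mat_def by (rule exI[of _ 0]) (simp add: zero_vec_def)

lemma sos_mat_add:
  assumes "sos_mat A" "sos_mat B"
  shows "sos_mat (A + B)"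
proof -
  obtain l T where A: "A = (\<chi> i j. \<Sum>k<(l::nat). T k $ i * T k $ j)"
    using assms(1) unfolding sos_mat_def by blast
  obtain m U where B: "B = (\<chi> i j. \<Sum>k<(m::nat). U k $ i * U k $ j)"
    using assms(2) unfolding sos_mat_def by blast
  have *: "(\<Sum>k<l + m. W k) = (\<Sum>k<l. W k) + (\<Sum>k<m. W (k + l))" for W :: "nat \<Rightarrow> 'a rpoly"
    by (induction m) (simp_all add: add_ac)
  show ?thesis
    unfolding sos_mat_def
    by (rule exI[of _ "l + m"], rule exI[of _ "\<lambda>k. if k < l then T k else U (k - l)"])
       (simp add: A B vec_eq_iff *)
qed

lemma sos_mat_sum: "(\<And>i. i \<in> I \<Longrightarrow> sos_mat (A i)) \<Longrightarrow> sos_mat (\<Sum>i\<in>I. A i)"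
  by (induction I rule: infinite_finite_induct) (auto intro: sos_mat_zero sos_mat_add)

lemma sos_mat_rank_one: "sos_mat (\<chi> i j. u $ i * u $ j)"
  unfolding sos_mat_def by (rule exI[of _ 1], rule exI[of _ "\<lambda>_. u"]) simp

text \<open>
  Symmetric Gaussian elimination. With \<open>w\<close> the \<open>k\<close>-th column divided by the square root of a nonzero
  diagonal entry, the Schur complement \<open>A - w w\<^sup>T\<close> is still positive semidefinite, because its value
  at \<open>v\<close> is the minimum of the quadratic form of \<open>A\<close> on the line through \<open>v\<close> in direction \<open>k\<close>; it has
  fewer nonzero diagonal entries. A positive semidefinite matrix with zero diagonal is zero.
\<close>

lemma psd_gram:
  fixes A :: "real ^ 'r::finite ^ 'r"
  assumes "psd A"
  shows "\<exists>(l::nat) (u :: nat \<Rightarrow> real ^ 'r). A = (\<chi> i j. \<Sum>k<l. u k $ i * u k $ j)"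
  using assms
proof (induction "card {i. A $ i $ i \<noteq> 0}" arbitrary: A rule: less_induct)
  case less
  have sym: "A $ i $ j = A $ j $ i" for i j
    using less.prems unfolding psd_def symmetric_mat_def by (metis transpose_def vec_lambda_beta)
  have quad: "v \<bullet> (A *v v) \<ge> 0" for v using less.prems unfolding psd_def by blast
  have bil: "x \<bullet> (A *v y) = y \<bullet> (A *v x)" for x y
    using less.prems unfolding psd_def symmetric_mat_def by (metis dot_lmul_matrix inner_commute transpose_matrix_vector)
  have ent: "axis i 1 \<bullet> (A *v axis j 1) = A $ i $ j" for i j
    by (simp add: inner_axis' matrix_vector_mult_basis column_def)
  show ?case
  proof (cases "\<exists>k. A $ k $ k \<noteq> 0")
    case False
    have "A $ i $ j = 0" for i j
    proof -
      have "(axis i 1 + c *\<^sub>R axis j 1) \<bullet> (A *v (axis i 1 + c *\<^sub>R axis j 1)) = 2 * c * A $ i $ j" for c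
        using False by (simp add: matrix_vector_right_distrib matrix_vector_mult_scaleR inner_add_left
            inner_add_right ent sym[of j i])
      from this[of 1] this[of "-1"] quad[of "axis i 1 + 1 *\<^sub>R axis j 1"] quad[of "axis i 1 + (-1) *\<^sub>R axis j 1"]
      show ?thesis by linarith
    qed
    thus ?thesis by (intro exI[of _ 0]) (simp add: vec_eq_iff)
  next
    case True
    then obtain k where k0: "A $ k $ k \<noteq> 0" by blast
    with quad[of "axis k 1"] have k: "A $ k $ k > 0" by (simp add: ent)
    define w :: "real ^ 'r" where "w = (\<chi> i. A $ i $ k / sqrt (A $ k $ k))"
    define B :: "real ^ 'r ^ 'r" where "B = (\<chi> i j. A $ i $ j - w $ i * w $ j)"
    have ww: "w $ i * w $ j = A $ i $ k * A $ j $ k / A $ k $ k" for i j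
      using k by (simp add: w_def)
    have "psd B"
      unfolding psd_def
    proof
      show "symmetric_mat B" unfolding symmetric_mat_def B_def
        by (simp add: vec_eq_iff transpose_def sym mult_ac)
      show "\<forall>v. 0 \<le> v \<bullet> (B *v v)"
      proof
        fix v :: "real ^ 'r"
        define c where "c = - (v \<bullet> w) / sqrt (A $ k $ k)"
        have vw: "axis k 1 \<bullet> (A *v v) = sqrt (A $ k $ k) * (v \<bullet> w)"
        proof -
          have "axis k 1 \<bullet> (A *v v) = (\<Sum>i\<in>UNIV. v $ i * A $ i $ k)"
            unfolding bil[of "axis k 1"] by (simp add: inner_vec_def matrix_vector_mult_basis column_def)
          thus ?thesis using k by (simp add: w_def inner_vec_def sum_distrib_left)
        qed
        have Bv: "v \<bullet> (B *v v) = v \<bullet> (A *v v) - (v \<bullet> w)\<^sup>2"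
          by (simp add: B_def inner_vec_def matrix_vector_mult_def sum_distrib_left power2_eq_square
              sum_product left_diff_distrib right_diff_distrib sum_subtractf mult_ac)
        have "0 \<le> (v + c *\<^sub>R axis k 1) \<bullet> (A *v (v + c *\<^sub>R axis k 1))" by (rule quad)
        also have "\<dots> = v \<bullet> (A *v v) + 2 * c * (axis k 1 \<bullet> (A *v v)) + c\<^sup>2 * A $ k $ k"
          by (simp add: matrix_vector_mult_scaleR ent bil[of v "axis k 1"] power2_eq_square algebra_simps)
        also have "\<dots> = v \<bullet> (A *v v) - (v \<bullet> w)\<^sup>2"
          using k by (simp add: vw c_def power_divide power2_eq_square)
        finally show "0 \<le> v \<bullet> (B *v v)" by (simp add: Bv)
      qed
    qed
    moreover have "card {i. B $ i $ i \<noteq> 0} < card {i. A $ i $ i \<noteq> 0}"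
    proof (rule psubset_card_mono)
      have "B $ k $ k = 0" using k by (simp add: B_def ww)
      moreover have "B $ i $ i = 0" if "A $ i $ i = 0" for i
      proof -
        have "B $ i $ i \<ge> 0"
          using \<open>psd B\<close> unfolding psd_def
          by (metis inner_axis' matrix_vector_mult_basis column_def vec_lambda_beta inner_real_def mult_1)
        moreover have "B $ i $ i = - (w $ i * w $ i)" using that by (simp add: B_def)
        ultimately show ?thesis using zero_le_square[of "w $ i"] by linarith
      qed
      ultimately show "{i. B $ i $ i \<noteq> 0} \<subset> {i. A $ i $ i \<noteq> 0}" using k0 by blast
    qed simp
    ultimately obtain l u where B: "B = (\<chi> i j. \<Sum>k<(l::nat). u k $ i * u k $ j)"
      using less.hyps[of B] by blast
    have "A $ i $ j = B $ i $ j + w $ i * w $ j" for i j by (simp add: B_def)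
    hence "A = (\<chi> i j. \<Sum>k<Suc l. (u(l := w)) k $ i * (u(l := w)) k $ j)"
      by (simp add: vec_eq_iff B)
    thus ?thesis by blast
  qed
qed

text \<open>
  This is how sums of squares arise from Polya's theorem, whose conclusion is a combination of
  monomials with positive semidefinite matrix coefficients.
\<close>

lemma sos_mat_square_psd:
  fixes A :: "real ^ 'r::finite ^ 'r"
  assumes "psd A"
  shows "sos_mat (\<chi> i j. f\<^sup>2 * Const (A $ i $ j))"
proof -
  obtain l u where A: "A = (\<chi> i j. \<Sum>k<(l::nat). u k $ i * u k $ j)"
    using psd_gram[OF assms] by blast
  have hom: "Const (\<Sum>k\<in>I. c k * d k) = (\<Sum>k\<in>I. Const (c k) * Const (d k))" for c d :: "nat \<Rightarrow> real" and I
    by (induction I rule: infinite_finite_induct) (simp_all add: Const_def single_add mult_single)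
  show ?thesis
    unfolding sos_mat_def
    by (rule exI[of _ l], rule exI[of _ "\<lambda>k. \<chi> i. f * Const (u k $ i)"])
       (simp add: A hom vec_eq_iff sum_distrib_left power2_eq_square mult_ac)
qed

section \<open>A matrix version of Polya's theorem\<close>

text \<open>
  On the compact set where \<open>f \<le> 0\<close> the penalty \<open>q\<close> is bounded below by a positive number, so a large
  multiple of it outweighs the negative values of \<open>f\<close>.
\<close>

lemma penalty_positive:
  fixes f q :: "'a::topological_space \<Rightarrow> real"
  assumes K: "compact K" and cont: "continuous_on K f" "continuous_on K q"
    and nonneg: "\<And>x. x \<in> K \<Longrightarrow> q x \<ge> 0"
    and pos: "\<And>x. x \<in> K \<Longrightarrow> q x = 0 \<Longrightarrow> f x > 0"
  shows "\<exists>C\<ge>0. \<exists>\<eta>>0. \<forall>x\<in>K. f x + C * q x \<ge> \<eta>"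
proof (cases "K = {}")
  case True
  thus ?thesis by (auto intro: exI[of _ 0] exI[of _ 1])
next
  case False
  define K0 where "K0 = {x\<in>K. f x \<le> 0}"
  have cK0: "compact K0"
  proof -
    obtain A where "closed A" "A \<inter> K = f -` {..0} \<inter> K"
      using continuous_on_closed_invariant[THEN iffD1, rule_format, OF cont(1) closed_atMost[of 0]]
      by blast
    moreover have "f -` {..0} \<inter> K = K0" by (auto simp: K0_def)
    ultimately show ?thesis using compact_Int_closed[OF K, of A] by (simp add: Int_commute)
  qed
  obtain c where c: "c > 0" "\<And>x. x \<in> K0 \<Longrightarrow> q x \<ge> c"
  proof (cases "K0 = {}")
    case False
    have "continuous_on K0 q" by (rule continuous_on_subset[OF cont(2)]) (auto simp: K0_def)
    from continuous_attains_inf[OF cK0 False this]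
    obtain x where x: "x \<in> K0" "\<forall>y\<in>K0. q x \<le> q y" by blast
    moreover have "q x > 0" using x(1) nonneg[of x] pos[of x] by (force simp: K0_def)
    ultimately show thesis using that by blast
  qed (use that[of 1] in auto)
  obtain x0 where x0: "x0 \<in> K" "\<forall>y\<in>K. f x0 \<le> f y"
    using continuous_attains_inf[OF K False cont(1)] by blast
  \<comment> \<open>chosen so that \<open>C q\<close> exceeds \<open>|min f|\<close> wherever \<open>f \<le> 0\<close>\<close>
  define C where "C = (\<bar>f x0\<bar> + 1) / c"
  have C: "C \<ge> 0" using c by (simp add: C_def)
  have "f x + C * q x > 0" if "x \<in> K" for x
  proof (cases "x \<in> K0")
    case True
    have "\<bar>f x0\<bar> + 1 = C * c" using c by (simp add: C_def)
    also have "\<dots> \<le> C * q x" using c(2)[OF True] C by (intro mult_left_mono)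
    finally show ?thesis using x0 that by force
  next
    case False
    hence "f x > 0" using that by (auto simp: K0_def)
    thus ?thesis using C nonneg[OF that] by (simp add: add_pos_nonneg)
  qed
  moreover have "continuous_on K (\<lambda>x. f x + C * q x)" by (intro continuous_intros cont)
  then obtain x1 where "x1 \<in> K" "\<forall>y\<in>K. f x1 + C * q x1 \<le> f y + C * q y"
    using continuous_attains_inf[OF K False] by blast
  ultimately show ?thesis using C by blast
qed

text \<open>
  Words are extensional functions rather than lists, so that products of sums expand into sums
  over words, and reordering or sampling letters is composition of functions.
\<close>

definition words :: "nat \<Rightarrow> (nat \<Rightarrow> 'k::finite) set" where
  "words d = {..<d} \<rightarrow>\<^sub>E UNIV"

lemma finite_words [simp]: "finite (words d)"
  by (simp add: words_def finite_PiE)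

lemma words_0 [simp]: "words 0 = {\<lambda>_. undefined}"
  by (simp add: words_def)

lemma sum_words_Suc:
  fixes F :: "(nat \<Rightarrow> 'k::finite) \<Rightarrow> 'b::comm_monoid_add"
  shows "(\<Sum>w\<in>words (Suc d). F w) = (\<Sum>k\<in>UNIV. \<Sum>w\<in>words d. F (w(d := k)))"
proof -
  have "words (Suc d) = (\<lambda>(k, w). w(d := k)) ` (UNIV \<times> (words d :: (nat \<Rightarrow> 'k) set))"
    unfolding words_def lessThan_Suc by (rule PiE_insert_eq)
  moreover have "inj_on (\<lambda>(k, w). w(d := k)) (UNIV \<times> (words d :: (nat \<Rightarrow> 'k) set))"
    unfolding words_def by (rule inj_combinator) simp
  ultimately have "(\<Sum>w\<in>words (Suc d). F w) = (\<Sum>p\<in>UNIV \<times> words d. F ((snd p)(d := fst p)))"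
    by (simp only: sum.reindex o_def case_prod_beta)
  thus ?thesis by (simp add: sum.cartesian_product case_prod_beta)
qed

text \<open>
  Multiplication by a power of the sum of the variables appends letters that the coefficient
  does not read.
\<close>

lemma sum_words_prefix:
  fixes a :: "(nat \<Rightarrow> 'k::finite) \<Rightarrow> 'b::real_vector" and t :: "'k \<Rightarrow> real"
  shows "(\<Sum>w\<in>words (d + N). (\<Prod>l<d + N. t (w l)) *\<^sub>R a (restrict w {..<d}))
    = (\<Sum>k\<in>UNIV. t k) ^ N *\<^sub>R (\<Sum>\<kappa>\<in>words d. (\<Prod>l<d. t (\<kappa> l)) *\<^sub>R a \<kappa>)"
proof (induction N)
  case 0
  have "restrict w {..<d} = w" if "w \<in> words d" for w :: "nat \<Rightarrow> 'k"
    using that by (simp add: words_def)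
  thus ?case by simp
next
  case (Suc N)
  let ?m = "d + N"
  have "(\<Prod>l<?m. t ((w(?m := k)) l)) = (\<Prod>l<?m. t (w l))" for w k
    by (intro prod.cong) auto
  hence 1: "(\<Prod>l<Suc ?m. t ((w(?m := k)) l)) = t k * (\<Prod>l<?m. t (w l))" for w k
    by simp
  have 2: "restrict (w(?m := k)) {..<d} = restrict w {..<d}" for w and k :: 'k by auto
  show ?case
    unfolding add_Suc_right sum_words_Suc 1 2
    by (simp flip: scaleR_scaleR scaleR_sum_right add: Suc scaleR_sum_left[symmetric])
qed

lemma extend_injection:
  fixes \<iota> :: "nat \<Rightarrow> nat"
  assumes "\<iota> ` {..<d} \<subseteq> {..<M}" "inj_on \<iota> {..<d}"
  shows "\<exists>\<pi>. bij_betw \<pi> {..<M} {..<M} \<and> (\<forall>l<d. \<pi> l = \<iota> l)"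
proof -
  have "d \<le> M" using card_inj_on_le[OF assms(2,1)] by simp
  have "card ({..<M} - \<iota> ` {..<d}) = M - d"
    using assms by (simp add: card_Diff_subset card_image)
  hence "card {d..<M} = card ({..<M} - \<iota> ` {..<d})" by simp
  then obtain \<rho> where \<rho>: "bij_betw \<rho> {d..<M} ({..<M} - \<iota> ` {..<d})"
    using finite_same_card_bij[of "{d..<M}"] by blast
  define \<pi> where "\<pi> l = (if l < d then \<iota> l else \<rho> l)" for l
  have "bij_betw \<pi> {..<d} (\<iota> ` {..<d})"
    using assms(2) by (subst bij_betw_cong[of _ _ \<iota>]) (auto simp: \<pi>_def bij_betw_def)
  moreover have "bij_betw \<pi> {d..<M} ({..<M} - \<iota> ` {..<d})"
    using \<rho> by (subst bij_betw_cong[of _ _ \<rho>]) (auto simp: \<pi>_def)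
  ultimately have "bij_betw \<pi> ({..<d} \<union> {d..<M}) (\<iota> ` {..<d} \<union> ({..<M} - \<iota> ` {..<d}))"
    by (rule bij_betw_combine) auto
  moreover have "{..<d} \<union> {d..<M} = {..<M}" using \<open>d \<le> M\<close> by auto
  moreover have "\<iota> ` {..<d} \<union> ({..<M} - \<iota> ` {..<d}) = {..<M}" using assms(1) by blast
  ultimately show ?thesis by (intro exI[of _ \<pi>]) (simp add: \<pi>_def)
qed

text \<open>
  The monomial of a word is invariant under permutations of the positions, so for the sum over all
  words it does not matter at which \<open>d\<close> distinct positions the coefficient reads the word.
\<close>

lemma sum_words_sample:
  fixes a :: "(nat \<Rightarrow> 'k::finite) \<Rightarrow> 'b::real_vector" and t :: "'k \<Rightarrow> real"
  assumes "\<iota> ` {..<d} \<subseteq> {..<M}" "inj_on \<iota> {..<d}"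
  shows "(\<Sum>w\<in>words M. (\<Prod>l<M. t (w l)) *\<^sub>R a (restrict (w \<circ> \<iota>) {..<d}))
    = (\<Sum>w\<in>words M. (\<Prod>l<M. t (w l)) *\<^sub>R a (restrict w {..<d}))"
proof -
  obtain \<pi> where \<pi>: "bij_betw \<pi> {..<M} {..<M}" "\<And>l. l < d \<Longrightarrow> \<pi> l = \<iota> l"
    using extend_injection[OF assms] by blast
  define \<sigma> where "\<sigma> = inv_into {..<M} \<pi>"
  have \<sigma>: "\<And>l. l < M \<Longrightarrow> \<sigma> (\<pi> l) = l" "\<And>l. l < M \<Longrightarrow> \<pi> (\<sigma> l) = l" "\<And>l. l < M \<Longrightarrow> \<sigma> l < M" "\<And>l. l < M \<Longrightarrow> \<pi> l < M"
    using bij_betw_inv_into_left[OF \<pi>(1)] bij_betw_inv_into_right[OF \<pi>(1)]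
      bij_betwE[OF bij_betw_inv_into[OF \<pi>(1)]] bij_betwE[OF \<pi>(1)]
    unfolding \<sigma>_def by auto
  have "d \<le> M" using card_inj_on_le[OF assms(2,1)] by simp
  show ?thesis
  proof (rule sum.reindex_bij_witness[of _ "\<lambda>w. restrict (w \<circ> \<sigma>) {..<M}" "\<lambda>w. restrict (w \<circ> \<pi>) {..<M}"])
    fix w :: "nat \<Rightarrow> 'k" assume w: "w \<in> words M"
    have ex: "w l = undefined" if "\<not> l < M" for l using w that by (auto simp: words_def PiE_def extensional_def)
    show "restrict (restrict (w \<circ> \<pi>) {..<M} \<circ> \<sigma>) {..<M} = w"
      using \<sigma> ex by (auto simp: restrict_def)
    show "restrict (restrict (w \<circ> \<sigma>) {..<M} \<circ> \<pi>) {..<M} = w"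
      using \<sigma> ex by (auto simp: restrict_def)
    show "restrict (w \<circ> \<pi>) {..<M} \<in> words M" "restrict (w \<circ> \<sigma>) {..<M} \<in> words M"
      by (simp_all add: words_def)
    have "(\<Prod>l<M. t (restrict (w \<circ> \<pi>) {..<M} l)) = (\<Prod>l<M. t (w (\<pi> l)))"
      by (intro prod.cong) auto
    also have "\<dots> = (\<Prod>l<M. t (w l))" by (rule prod.reindex_bij_betw[OF \<pi>(1)])
    finally have 1: "(\<Prod>l<M. t (restrict (w \<circ> \<pi>) {..<M} l)) = (\<Prod>l<M. t (w l))" .
    have 2: "restrict (restrict (w \<circ> \<pi>) {..<M}) {..<d} = restrict (w \<circ> \<iota>) {..<d}"
      using \<open>d \<le> M\<close> \<pi>(2) by (auto simp: restrict_def)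
    show "(\<Prod>l<M. t (restrict (w \<circ> \<pi>) {..<M} l)) *\<^sub>R a (restrict (restrict (w \<circ> \<pi>) {..<M}) {..<d})
        = (\<Prod>l<M. t (w l)) *\<^sub>R a (restrict (w \<circ> \<iota>) {..<d})"
      by (simp only: 1 2)
  qed
qed

text \<open>
  The left-hand side is, up to the factor \<open>M\<^sup>d\<close>, the value of the form at the vector of the relative
  letter frequencies of \<open>w\<close>; expanding the counts shows that it averages the coefficients over
  all choices of \<open>d\<close> positions, repetitions allowed.
\<close>

lemma sample_with_replacement:
  fixes a :: "(nat \<Rightarrow> 'k::finite) \<Rightarrow> 'b::real_vector" and w :: "nat \<Rightarrow> 'k"
  shows "(\<Sum>\<kappa>\<in>words d. (\<Prod>l<d. real (card {m. m < M \<and> w m = \<kappa> l})) *\<^sub>R a \<kappa>)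
    = (\<Sum>\<iota>\<in>{..<d} \<rightarrow>\<^sub>E {..<M}. a (restrict (w \<circ> \<iota>) {..<d}))"
proof -
  have 1: "(\<Prod>l<d. real (card {m. m < M \<and> w m = \<kappa> l}))
      = (\<Sum>\<iota>\<in>{..<d} \<rightarrow>\<^sub>E {..<M}. \<Prod>l<d. if w (\<iota> l) = \<kappa> l then 1 else 0)" for \<kappa>
  proof -
    have "real (card {m. m < M \<and> w m = k}) = (\<Sum>m<M. if w m = k then 1 else 0)" for k
      using sum.inter_filter[of "{..<M}" "\<lambda>_. 1::real" "\<lambda>m. w m = k"] by simp
    thus ?thesis by (simp add: prod_sum_PiE)
  qed
  have 2: "(\<Prod>l<d. if w (\<iota> l) = \<kappa> l then 1 else 0) = (if \<kappa> = restrict (w \<circ> \<iota>) {..<d} then 1 else (0::real))"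
    if "\<kappa> \<in> words d" for \<kappa> \<iota>
  proof (cases "\<forall>l<d. w (\<iota> l) = \<kappa> l")
    case True
    hence "\<kappa> = restrict (w \<circ> \<iota>) {..<d}"
      using that by (auto simp: words_def PiE_def extensional_def restrict_def)
    with True show ?thesis by simp
  next
    case False
    then obtain l where "l < d" "w (\<iota> l) \<noteq> \<kappa> l" by blast
    hence "(\<Prod>l<d. if w (\<iota> l) = \<kappa> l then 1 else (0::real)) = 0" by (intro prod_zero) auto
    with False show ?thesis by auto
  qed
  have "(\<Sum>\<kappa>\<in>words d. (\<Prod>l<d. real (card {m. m < M \<and> w m = \<kappa> l})) *\<^sub>R a \<kappa>)
      = (\<Sum>\<iota>\<in>{..<d} \<rightarrow>\<^sub>E {..<M}. \<Sum>\<kappa>\<in>words d. (\<Prod>l<d. if w (\<iota> l) = \<kappa> l then 1 else 0) *\<^sub>R a \<kappa>)"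
    unfolding 1 scaleR_sum_left by (rule sum.swap)
  also have "\<dots> = (\<Sum>\<iota>\<in>{..<d} \<rightarrow>\<^sub>E {..<M}. \<Sum>\<kappa>\<in>words d. if \<kappa> = restrict (w \<circ> \<iota>) {..<d} then a \<kappa> else 0)"
  proof (intro sum.cong refl)
    fix \<iota> \<kappa> assume "\<kappa> \<in> (words d :: (nat \<Rightarrow> 'k) set)"
    from 2[OF this, of \<iota>] show "(\<Prod>l<d. if w (\<iota> l) = \<kappa> l then 1 else 0) *\<^sub>R a \<kappa>
        = (if \<kappa> = restrict (w \<circ> \<iota>) {..<d} then a \<kappa> else 0)"
      by (cases "\<kappa> = restrict (w \<circ> \<iota>) {..<d}") simp_all
  qed
  also have "\<dots> = (\<Sum>\<iota>\<in>{..<d} \<rightarrow>\<^sub>E {..<M}. a (restrict (w \<circ> \<iota>) {..<d}))"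
  proof (intro sum.cong refl)
    fix \<iota> :: "nat \<Rightarrow> nat"
    have "restrict (w \<circ> \<iota>) {..<d} \<in> words d" by (simp add: words_def)
    thus "(\<Sum>\<kappa>\<in>words d. if \<kappa> = restrict (w \<circ> \<iota>) {..<d} then a \<kappa> else 0)
        = a (restrict (w \<circ> \<iota>) {..<d})"
      by (subst sum.delta) simp_all
  qed
  finally show ?thesis .
qed

text \<open>
  For a long word, a sample of \<open>d\<close> positions hardly ever contains a repetition.
\<close>

lemma card_injections_tendsto:
  "(\<lambda>M. real (card {\<iota> \<in> {..<d} \<rightarrow>\<^sub>E {..<M}. inj_on \<iota> {..<d}}) / real M ^ d) \<longlonglongrightarrow> 1"
proof -
  have "(\<lambda>M. \<Prod>i<d. 1 - real i / real M) \<longlonglongrightarrow> (\<Prod>i<d. 1 - 0)"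
    by (intro tendsto_intros lim_const_over_n)
  moreover have "eventually (\<lambda>M. (\<Prod>i<d. 1 - real i / real M)
      = real (card {\<iota> \<in> {..<d} \<rightarrow>\<^sub>E {..<M}. inj_on \<iota> {..<d}}) / real M ^ d) sequentially"
    using eventually_gt_at_top[of d]
  proof eventually_elim
    case (elim M)
    have "real (card {\<iota> \<in> {..<d} \<rightarrow>\<^sub>E {..<M}. inj_on \<iota> {..<d}}) = (\<Prod>i<d. real M - real i)"
      using card_inj_on_subset_funcset[of "{..<d}" "{..<M}" "{..<d}"] elim
      by (simp add: atLeast0LessThan)
    also have "\<dots> = (\<Prod>i<d. real M * (1 - real i / real M))"
      using elim by (intro prod.cong) (auto simp: field_simps)
    also have "\<dots> = real M ^ d * (\<Prod>i<d. 1 - real i / real M)"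
      by (simp add: prod.distrib)
    finally show ?case using elim by simp
  qed
  ultimately show ?thesis by (simp add: tendsto_cong)
qed

definition std_simplex :: "(real ^ 'k::finite) set" where
  "std_simplex = {t. (\<forall>k. 0 \<le> t $ k) \<and> (\<Sum>k\<in>UNIV. t $ k) = 1}"

lemma compact_std_simplex: "compact (std_simplex :: (real ^ 'k::finite) set)"
proof -
  have "norm t \<le> 1" if "t \<in> std_simplex" for t :: "real ^ 'k"
    using that norm_le_l1_cart[of t] by (simp add: std_simplex_def)
  hence "bounded (std_simplex :: (real ^ 'k) set)" unfolding bounded_iff by blast
  moreover have "closed (std_simplex :: (real ^ 'k) set)"
    unfolding std_simplex_def
    by (intro closed_Collect_conj closed_Collect_all closed_Collect_le closed_Collect_eq continuous_intros)
  ultimately show ?thesis by (simp add: compact_eq_bounded_closed)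
qed

definition quad_form :: "real ^ 'p ^ 'p \<Rightarrow> real ^ 'p::finite \<Rightarrow> real" where
  "quad_form A v = v \<bullet> (A *v v)"

lemma quad_form_linear:
  "quad_form (A + B) v = quad_form A v + quad_form B v"
  "quad_form (c *\<^sub>R A) v = c * quad_form A v"
  "quad_form 0 v = 0"
  "quad_form (\<Sum>i\<in>I. f i) v = (\<Sum>i\<in>I. quad_form (f i) v)"
proof -
  show add: "quad_form (A + B) v = quad_form A v + quad_form B v" for A B
    by (simp add: quad_form_def matrix_vector_mult_add_rdistrib inner_add_right)
  show "quad_form (c *\<^sub>R A) v = c * quad_form A v"
    by (simp add: quad_form_def scaleR_matrix_vector_assoc[symmetric])
  show z: "quad_form 0 v = 0" by (simp add: quad_form_def)
  show "quad_form (\<Sum>i\<in>I. f i) v = (\<Sum>i\<in>I. quad_form (f i) v)"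
    by (induction I rule: infinite_finite_induct) (auto simp: add z)
qed

lemma quad_form_bound: "\<exists>A\<ge>0. \<forall>v. \<bar>quad_form B v\<bar> \<le> A * (v \<bullet> v)"
proof (intro exI conjI allI)
  show "0 \<le> onorm ((*v) B)" by (simp add: onorm_pos_le)
  fix v :: "real ^ 'a"
  have "\<bar>quad_form B v\<bar> \<le> norm v * norm (B *v v)"
    unfolding quad_form_def by (rule Cauchy_Schwarz_ineq2)
  also have "\<dots> \<le> norm v * (onorm ((*v) B) * norm v)"
    by (intro mult_left_mono onorm) auto
  finally show "\<bar>quad_form B v\<bar> \<le> onorm ((*v) B) * (v \<bullet> v)"
    by (simp add: power2_norm_eq_inner[symmetric] power2_eq_square mult_ac)
qed

lemma symmetric_mat_iff: "symmetric_mat A \<longleftrightarrow> (\<forall>i j. A $ i $ j = A $ j $ i)"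
  unfolding symmetric_mat_def transpose_def vec_eq_iff by auto

lemma symmetric_mat_sum:
  fixes f :: "'i \<Rightarrow> real ^ 'p ^ 'p"
  shows "(\<And>i. i \<in> I \<Longrightarrow> symmetric_mat (f i)) \<Longrightarrow> symmetric_mat (\<Sum>i\<in>I. f i)"
  unfolding symmetric_mat_iff sum_component by (intro allI sum.cong refl) blast

text \<open>
  By \<open>sum_words_prefix\<close> and \<open>sum_words_sample\<close>, the product of the form with the power of the sum
  has the coefficients \<open>B w\<close>, the average of \<open>a\<close> over samples from \<open>w\<close> without replacement. With
  replacement the average would be a value of the form on the simplex and hence at least \<open>\<eta>\<close>. The two
  averages differ by at most a constant times the proportion of samples with a repetition,
  which is smaller than \<open>\<eta>\<close> if the word is long. A matrix coefficient is handled through its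
  quadratic form at each vector \<open>v\<close>, with bounds that are uniform in \<open>v\<close>.
\<close>

lemma matrix_polya:
  fixes a :: "(nat \<Rightarrow> 'k::finite) \<Rightarrow> real ^ 'p::finite ^ 'p" and f :: "real ^ 'k \<Rightarrow> real ^ 'p ^ 'p"
  assumes f: "\<And>t. f t = (\<Sum>\<kappa>\<in>words d. (\<Prod>l<d. t $ \<kappa> l) *\<^sub>R a \<kappa>)"
    and sym: "\<And>\<kappa>. symmetric_mat (a \<kappa>)"
    and "\<eta> > 0" and pos: "\<And>t v. t \<in> std_simplex \<Longrightarrow> quad_form (f t) v \<ge> \<eta> * (v \<bullet> v)"
  shows "eventually (\<lambda>N. \<exists>B. (\<forall>w. psd (B w)) \<and>
    (\<forall>t. (\<Sum>k\<in>UNIV. t $ k) ^ N *\<^sub>R f t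
      = (\<Sum>w\<in>words (d + N). (\<Prod>l<d + N. t $ w l) *\<^sub>R B w))) sequentially"
proof -
  have "\<forall>\<kappa>. \<exists>A\<ge>0. \<forall>v. \<bar>quad_form (a \<kappa>) v\<bar> \<le> A * (v \<bullet> v)"
    using quad_form_bound by blast
  then obtain A' where A': "\<And>\<kappa>. A' \<kappa> \<ge> 0" "\<And>\<kappa> v. \<bar>quad_form (a \<kappa>) v\<bar> \<le> A' \<kappa> * (v \<bullet> v)"
    by metis
  define A where "A = (\<Sum>\<kappa>\<in>words d. A' \<kappa>)"
  have A0: "A \<ge> 0" unfolding A_def by (intro sum_nonneg A')
  have A: "\<bar>quad_form (a \<kappa>) v\<bar> \<le> A * (v \<bullet> v)" if "\<kappa> \<in> words d" for \<kappa> v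
  proof -
    have "A' \<kappa> \<le> A" unfolding A_def using that by (intro member_le_sum A') auto
    thus ?thesis using A'(2)[of \<kappa> v] by (meson inner_ge_zero mult_right_mono order_trans)
  qed
  define All :: "nat \<Rightarrow> (nat \<Rightarrow> nat) set" where "All M = ({..<d} \<rightarrow>\<^sub>E {..<M})" for M
  define Inj where "Inj M = {\<iota> \<in> All M. inj_on \<iota> {..<d}}" for M
  have finA [simp]: "finite (All M)" for M by (simp add: All_def finite_PiE)
  have cardA: "card (All M) = M ^ d" for M by (simp add: All_def card_funcsetE)
  define r where "r M = real (card (Inj M)) / real M ^ d" for M
  have "r \<longlonglongrightarrow> 1"
    using card_injections_tendsto[of d] by (simp add: r_def[abs_def] Inj_def All_def)
  hence "(\<lambda>M. A * (1 - r M)) \<longlonglongrightarrow> A * (1 - 1)" by (intro tendsto_intros)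
  hence "(\<lambda>M. A * (1 - r M)) \<longlonglongrightarrow> 0" by simp
  hence "eventually (\<lambda>M. A * (1 - r M) < \<eta>) sequentially"
    using \<open>\<eta> > 0\<close> by (rule order_tendstoD)
  moreover have "eventually (\<lambda>M. r M > 0) sequentially"
    using \<open>r \<longlonglongrightarrow> 1\<close> by (rule order_tendstoD) simp
  ultimately have ev: "eventually (\<lambda>M. A * (1 - r M) < \<eta> \<and> r M > 0 \<and> M > 0) sequentially"
    using eventually_gt_at_top[of 0] by eventually_elim auto
  have "eventually (\<lambda>N. A * (1 - r (d + N)) < \<eta> \<and> r (d + N) > 0 \<and> d + N > 0) sequentially"
    using eventually_sequentially_seg[of "\<lambda>M. A * (1 - r M) < \<eta> \<and> r M > 0 \<and> M > 0" d] ev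
    by (simp add: add.commute)
  thus ?thesis
  proof eventually_elim
    case (elim N)
    define M where "M = d + N"
    have M: "A * (1 - r M) < \<eta>" "r M > 0" "M > 0" using elim by (simp_all add: M_def)
    define samp where "samp w \<iota> = a (restrict (w \<circ> \<iota>) {..<d})" for w and \<iota> :: "nat \<Rightarrow> nat"
    define B where "B w = (1 / real (card (Inj M))) *\<^sub>R (\<Sum>\<iota>\<in>Inj M. samp w \<iota>)" for w
    have finI: "finite (Inj M)" by (simp add: Inj_def)
    have cI: "real (card (Inj M)) > 0" using M by (simp add: r_def zero_less_divide_iff)
    have "psd (B w)" for w
    proof -
      have "symmetric_mat (\<Sum>\<iota>\<in>Inj M. samp w \<iota>)"
        unfolding samp_def by (intro symmetric_mat_sum sym)
      hence "symmetric_mat (B w)"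
        unfolding B_def by (simp add: symmetric_mat_def transpose_def vec_eq_iff)
      moreover have "quad_form (B w) v \<ge> 0" for v
      proof -
        \<comment> \<open>the letter frequencies of the word, where the form is evaluated by sampling with replacement\<close>
        define t :: "real ^ 'k" where "t = (\<chi> k. real (card {m. m < M \<and> w m = k}) / real M)"
        have "(\<Sum>k\<in>UNIV. real (card {m. m < M \<and> w m = k})) = real M"
        proof -
          have "(\<Sum>k\<in>UNIV. \<Sum>m\<in>{m\<in>{..<M}. w m = k}. 1::real) = (\<Sum>m<M. 1)"
            by (rule sum.group) auto
          thus ?thesis by simp
        qed
        hence "t \<in> std_simplex" using M by (simp add: t_def std_simplex_def sum_divide_distrib[symmetric])
        from pos[OF this] have "real M ^ d * (\<eta> * (v \<bullet> v)) \<le> real M ^ d * quad_form (f t) v"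
          by (intro mult_left_mono) auto
        also have "\<dots> = quad_form (\<Sum>\<kappa>\<in>words d. (\<Prod>l<d. real (card {m. m < M \<and> w m = \<kappa> l})) *\<^sub>R a \<kappa>) v"
          using M by (simp add: f t_def quad_form_linear prod_dividef sum_distrib_left)
        also have "\<dots> = (\<Sum>\<iota>\<in>All M. quad_form (samp w \<iota>) v)"
          unfolding sample_with_replacement by (simp add: quad_form_linear samp_def All_def)
        also have "\<dots> = (\<Sum>\<iota>\<in>Inj M. quad_form (samp w \<iota>) v) + (\<Sum>\<iota>\<in>All M - Inj M. quad_form (samp w \<iota>) v)"
          by (subst sum.subset_diff[of "Inj M"]) (auto simp: Inj_def)
        also have "(\<Sum>\<iota>\<in>All M - Inj M. quad_form (samp w \<iota>) v) \<le> (\<Sum>\<iota>\<in>All M - Inj M. A * (v \<bullet> v))"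
        proof (rule sum_mono)
          fix \<iota>
          have "restrict (w \<circ> \<iota>) {..<d} \<in> words d" by (simp add: words_def)
          from A[OF this, of v] show "quad_form (samp w \<iota>) v \<le> A * (v \<bullet> v)"
            by (simp add: samp_def)
        qed
        also have "\<dots> = (real M ^ d - real (card (Inj M))) * (A * (v \<bullet> v))"
        proof -
          have "real (card (All M - Inj M)) = real M ^ d - real (card (Inj M))"
            using card_mono[of "All M" "Inj M"]
            by (subst card_Diff_subset) (auto simp: Inj_def cardA)
          thus ?thesis by simp
        qed
        also have "\<dots> = real M ^ d * (A * (1 - r M) * (v \<bullet> v))"
          using M by (simp add: r_def field_simps)
        also have "\<dots> \<le> real M ^ d * (\<eta> * (v \<bullet> v))"
          using M by (intro mult_left_mono mult_right_mono) auto
        finally have "(\<Sum>\<iota>\<in>Inj M. quad_form (samp w \<iota>) v) \<ge> 0" by simp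
        thus ?thesis by (simp add: B_def quad_form_linear)
      qed
      ultimately show ?thesis by (simp add: psd_def quad_form_def)
    qed
    moreover have "(\<Sum>k\<in>UNIV. t $ k) ^ N *\<^sub>R f t = (\<Sum>w\<in>words M. (\<Prod>l<M. t $ w l) *\<^sub>R B w)" for t
    proof -
      have "(\<Sum>w\<in>words M. (\<Prod>l<M. t $ w l) *\<^sub>R B w) = (1 / real (card (Inj M))) *\<^sub>R
          (\<Sum>\<iota>\<in>Inj M. \<Sum>w\<in>words M. (\<Prod>l<M. t $ w l) *\<^sub>R samp w \<iota>)"
        by (subst sum.swap) (simp add: B_def scaleR_sum_right mult_ac)
      also have "(\<Sum>\<iota>\<in>Inj M. \<Sum>w\<in>words M. (\<Prod>l<M. t $ w l) *\<^sub>R samp w \<iota>)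
          = (\<Sum>\<iota>\<in>Inj M. (\<Sum>k\<in>UNIV. t $ k) ^ N *\<^sub>R f t)"
      proof (rule sum.cong)
        fix \<iota> assume "\<iota> \<in> Inj M"
        hence "\<iota> ` {..<d} \<subseteq> {..<M}" "inj_on \<iota> {..<d}" by (auto simp: Inj_def All_def)
        thus "(\<Sum>w\<in>words M. (\<Prod>l<M. t $ w l) *\<^sub>R samp w \<iota>) = (\<Sum>k\<in>UNIV. t $ k) ^ N *\<^sub>R f t"
          unfolding samp_def f using sum_words_sample[of \<iota> d M "($) t" a]
            sum_words_prefix[where t = "($) t" and a = a and d = d and N = N]
          by (simp add: M_def)
      qed simp
      also have "(1 / real (card (Inj M))) *\<^sub>R \<dots> = (\<Sum>k\<in>UNIV. t $ k) ^ N *\<^sub>R f t"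
        using cI by (simp only: sum_constant_scaleR) simp
      finally show ?thesis by simp
    qed
    ultimately show ?case unfolding M_def by blast
  qed
qed

section \<open>Positive polynomial matrices with denominators (Reznick)\<close>

text \<open>
  Forms of degree \<open>d\<close> are given by a coefficient for each word, that is, by a tensor that need not
  be symmetric. Nothing requires the coefficients to be unique, and products are easy to form.
\<close>

definition hform :: "nat \<Rightarrow> (real ^ 'k::finite \<Rightarrow> real) \<Rightarrow> bool" where
  "hform d f \<longleftrightarrow> (\<exists>a. \<forall>t. f t = (\<Sum>\<kappa>\<in>words d. (\<Prod>l<d. t $ \<kappa> l) * a \<kappa>))"

lemma hform_const: "hform 0 (\<lambda>_. c)"
  unfolding hform_def by (rule exI[of _ "\<lambda>_. c"]) simp

lemma hform_add: "hform d f \<Longrightarrow> hform d g \<Longrightarrow> hform d (\<lambda>t. f t + g t)"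
  unfolding hform_def
proof (elim exE)
  fix a b
  assume "\<forall>t. f t = (\<Sum>\<kappa>\<in>words d. (\<Prod>l<d. t $ \<kappa> l) * a \<kappa>)"
    "\<forall>t. g t = (\<Sum>\<kappa>\<in>words d. (\<Prod>l<d. t $ \<kappa> l) * b \<kappa>)"
  thus "\<exists>c. \<forall>t. f t + g t = (\<Sum>\<kappa>\<in>words d. (\<Prod>l<d. t $ \<kappa> l) * c \<kappa>)"
    by (intro exI[of _ "\<lambda>\<kappa>. a \<kappa> + b \<kappa>"]) (simp add: distrib_left sum.distrib)
qed

lemma hform_cmult: "hform d f \<Longrightarrow> hform d (\<lambda>t. c * f t)"
  unfolding hform_def
proof (elim exE)
  fix a assume "\<forall>t. f t = (\<Sum>\<kappa>\<in>words d. (\<Prod>l<d. t $ \<kappa> l) * a \<kappa>)"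
  thus "\<exists>b. \<forall>t. c * f t = (\<Sum>\<kappa>\<in>words d. (\<Prod>l<d. t $ \<kappa> l) * b \<kappa>)"
    by (intro exI[of _ "\<lambda>\<kappa>. c * a \<kappa>"]) (simp add: sum_distrib_left mult_ac)
qed

lemma hform_zero: "hform d (\<lambda>_. 0)"
  unfolding hform_def by (rule exI[of _ "\<lambda>_. 0"]) simp

lemma hform_sum: "(\<And>i. i \<in> I \<Longrightarrow> hform d (f i)) \<Longrightarrow> hform d (\<lambda>t. \<Sum>i\<in>I. f i t)"
  by (induction I rule: infinite_finite_induct) (auto intro: hform_zero hform_add)

lemma hform_coord_mult:
  assumes "hform d f"
  shows "hform (Suc d) (\<lambda>t. t $ k * f t)"
proof -
  obtain a where a: "\<And>t. f t = (\<Sum>\<kappa>\<in>words d. (\<Prod>l<d. t $ \<kappa> l) * a \<kappa>)"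
    using assms unfolding hform_def by blast
  define b where "b \<kappa> = (if \<kappa> d = k then a (restrict \<kappa> {..<d}) else 0)" for \<kappa>
  have "t $ k * f t = (\<Sum>\<kappa>\<in>words (Suc d). (\<Prod>l<Suc d. t $ \<kappa> l) * b \<kappa>)" for t
  proof -
    have 1: "(\<Prod>l<d. t $ (\<kappa>(d := j)) l) = (\<Prod>l<d. t $ \<kappa> l)" for \<kappa> j
      by (intro prod.cong) auto
    have 2: "b (\<kappa>(d := j)) = (if j = k then a \<kappa> else 0)" if "\<kappa> \<in> words d" for \<kappa> j
    proof -
      have "restrict (\<kappa>(d := j)) {..<d} = \<kappa>"
        using that by (auto simp: words_def PiE_def extensional_def restrict_def)
      thus ?thesis unfolding b_def fun_upd_same by simp
    qed
    have "(\<Sum>\<kappa>\<in>words (Suc d). (\<Prod>l<Suc d. t $ \<kappa> l) * b \<kappa>)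
        = (\<Sum>j\<in>UNIV. \<Sum>\<kappa>\<in>words d. ((\<Prod>l<d. t $ \<kappa> l) * t $ j) * b (\<kappa>(d := j)))"
      by (simp add: sum_words_Suc 1)
    also have "\<dots> = (\<Sum>j\<in>UNIV. \<Sum>\<kappa>\<in>words d. ((\<Prod>l<d. t $ \<kappa> l) * t $ j) * (if j = k then a \<kappa> else 0))"
    proof (intro sum.cong refl)
      fix j \<kappa> assume "\<kappa> \<in> (words d :: (nat \<Rightarrow> 'a) set)"
      from 2[OF this, of j] show "((\<Prod>l<d. t $ \<kappa> l) * t $ j) * b (\<kappa>(d := j))
        = ((\<Prod>l<d. t $ \<kappa> l) * t $ j) * (if j = k then a \<kappa> else 0)" by (rule arg_cong)
    qed
    also have "\<dots> = (\<Sum>j\<in>UNIV. if j = k then \<Sum>\<kappa>\<in>words d. ((\<Prod>l<d. t $ \<kappa> l) * t $ k) * a \<kappa> else 0)"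
      by (intro sum.cong refl) auto
    also have "\<dots> = t $ k * f t"
      by (simp add: a sum_distrib_left mult_ac)
    finally show ?thesis by simp
  qed
  thus ?thesis unfolding hform_def by blast
qed

lemma hform_coord: "hform 1 (\<lambda>t. t $ k)"
  using hform_coord_mult[OF hform_const[of 1], of k] by simp

lemma hform_mult:
  assumes "hform d f" "hform e g"
  shows "hform (d + e) (\<lambda>t. f t * g t)"
proof -
  obtain a where a: "\<And>t. f t = (\<Sum>\<kappa>\<in>words d. (\<Prod>l<d. t $ \<kappa> l) * a \<kappa>)"
    using assms(1) unfolding hform_def by blast
  have "hform (d + e) (\<lambda>t. (\<Prod>l<d. t $ \<kappa> l) * g t)" for d and \<kappa> :: "nat \<Rightarrow> 'a"
  proof (induction d)
    case (Suc d)
    from hform_coord_mult[OF this, of "\<kappa> d"] show ?case by (simp add: mult_ac)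
  qed (simp add: assms(2))
  hence "hform (d + e) (\<lambda>t. \<Sum>\<kappa>\<in>words d. a \<kappa> * ((\<Prod>l<d. t $ \<kappa> l) * g t))"
    by (intro hform_sum hform_cmult)
  thus ?thesis by (simp add: a sum_distrib_left sum_distrib_right mult_ac)
qed

lemma hform_power: "hform d f \<Longrightarrow> hform (d * n) (\<lambda>t. f t ^ n)"
  by (induction n) (auto intro: hform_const hform_mult)

lemma hform_diff: "hform d f \<Longrightarrow> hform d g \<Longrightarrow> hform d (\<lambda>t. f t - g t)"
  using hform_add[of d f "\<lambda>t. -1 * g t"] hform_cmult[of d g "-1"] by simp

lemma hform_scale:
  assumes "hform d f" shows "f (c *\<^sub>R t) = c ^ d * f t"
proof -
  obtain a where "\<And>t. f t = (\<Sum>\<kappa>\<in>words d. (\<Prod>l<d. t $ \<kappa> l) * a \<kappa>)"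
    using assms unfolding hform_def by blast
  thus ?thesis by (simp add: prod.distrib sum_distrib_left mult_ac)
qed

lemma hform_continuous: assumes "hform d f" shows "continuous_on S f"
proof -
  obtain a where a: "\<And>t. f t = (\<Sum>\<kappa>\<in>words d. (\<Prod>l<d. t $ \<kappa> l) * a \<kappa>)"
    using assms unfolding hform_def by blast
  show ?thesis unfolding a by (intro continuous_intros)
qed

type_synonym 'n frame_index = "'n option \<times> 'n option \<times> bool"

definition bsgn :: "bool \<Rightarrow> real" where "bsgn s = (if s then 1 else - 1)"

text \<open>
  The new variables: squares of the linear forms \<open>z\<^sub>i \<plusminus> z\<^sub>j\<close>. The index \<open>None\<close> of \<open>z\<close> is that of the
  homogenizing variable.
\<close>

definition frame :: "('n::finite option \<Rightarrow> real) \<Rightarrow> real ^ 'n frame_index" where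
  "frame z = (\<chi> k. (z (fst k) + bsgn (snd (snd k)) * z (fst (snd k)))\<^sup>2)"

text \<open>
  Polarization: this linear map recovers the products \<open>z\<^sub>i z\<^sub>j\<close> from the squares.
\<close>

definition gram :: "real ^ 'n::finite frame_index \<Rightarrow> 'n option \<Rightarrow> 'n option \<Rightarrow> real" where
  "gram t i j = (t $ (i, j, True) - t $ (i, j, False)) / 4"

lemma frame_nth:
  "frame z $ k = z (fst k) * z (fst k) + 2 * bsgn (snd (snd k)) * (z (fst k) * z (fst (snd k)))
     + z (fst (snd k)) * z (fst (snd k))"
  by (cases "snd (snd k)") (simp_all add: frame_def bsgn_def power2_eq_square algebra_simps)

lemma gram_frame: "gram (frame z) i j = z i * z j"
  by (simp add: gram_def frame_def bsgn_def power2_eq_square algebra_simps)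

lemma hform_gram: "hform 1 (\<lambda>t. gram t i j)"
proof -
  have "hform 1 (\<lambda>t. (1/4) * (t $ (i, j, True) - t $ (i, j, False)))"
    by (intro hform_cmult hform_diff hform_coord)
  thus ?thesis by (simp add: gram_def)
qed

lemma sum_frame_index:
  fixes h :: "'n::finite frame_index \<Rightarrow> real"
  shows "(\<Sum>k\<in>UNIV. h k) = (\<Sum>i\<in>UNIV. \<Sum>j\<in>UNIV. h (i, j, True) + h (i, j, False))"
proof -
  have "(\<Sum>k\<in>UNIV. h k) = (\<Sum>i\<in>UNIV. \<Sum>p\<in>UNIV. h (i, p))"
    by (simp add: UNIV_Times_UNIV[symmetric] sum.cartesian_product del: UNIV_Times_UNIV)
  also have "\<dots> = (\<Sum>i\<in>UNIV. \<Sum>j\<in>UNIV. \<Sum>s\<in>UNIV. h (i, j, s))"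
    by (simp add: UNIV_Times_UNIV[symmetric] sum.cartesian_product del: UNIV_Times_UNIV)
  finally show ?thesis by (simp add: UNIV_bool add.commute)
qed

lemma sum_frame:
  fixes z :: "'n::finite option \<Rightarrow> real"
  shows "(\<Sum>k\<in>UNIV. frame z $ k) = 4 * real CARD('n option) * (\<Sum>i\<in>UNIV. (z i)\<^sup>2)"
proof -
  have "frame z $ (i, j, True) + frame z $ (i, j, False) = 2 * (z i)\<^sup>2 + 2 * (z j)\<^sup>2" for i j
    by (simp add: frame_def bsgn_def power2_eq_square algebra_simps)
  hence "(\<Sum>k\<in>UNIV. frame z $ k) = (\<Sum>i\<in>UNIV. \<Sum>j\<in>(UNIV :: 'n option set). 2 * (z i)\<^sup>2 + 2 * (z j)\<^sup>2)"
    by (simp add: sum_frame_index)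
  thus ?thesis by (simp add: sum.distrib flip: sum_distrib_left)
qed

abbreviation homog :: "('n \<Rightarrow> real) \<Rightarrow> 'n option \<Rightarrow> real" where
  "homog x \<equiv> case_option 1 x"

lemma sum_option:
  fixes f :: "'n::finite option \<Rightarrow> real"
  shows "(\<Sum>i\<in>UNIV. f i) = f None + (\<Sum>i\<in>UNIV. f (Some i))"
  by (simp add: UNIV_option_conv sum.reindex)

lemma sum_homog_sq: "(\<Sum>i\<in>UNIV. (homog x i)\<^sup>2) = poly_eval theta x"
  by (simp add: sum_option poly_eval_theta)

text \<open>
  A monomial is padded to the prescribed degree by copies of the homogenizing variable,
  whose value is \<open>1\<close>.
\<close>

lemma monomial_as_list:
  fixes \<alpha> :: "'n::finite \<Rightarrow>\<^sub>0 nat"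
  assumes "(\<Sum>v\<in>UNIV. Poly_Mapping.lookup \<alpha> v) \<le> m"
  shows "\<exists>zs. length zs = m \<and> (\<forall>x. prod_list (map (homog x) zs) = monom_eval \<alpha> x)"
  using assms
proof (induction m arbitrary: \<alpha>)
  case 0
  hence "\<alpha> = 0" by (intro poly_mapping_eqI) simp
  thus ?case by simp
next
  case (Suc m)
  show ?case
  proof (cases "\<alpha> = 0")
    case True
    with Suc.IH[of 0] obtain zs where "length zs = m" "\<forall>x. prod_list (map (homog x) zs) = monom_eval \<alpha> x"
      by auto
    thus ?thesis by (intro exI[of _ "None # zs"]) simp
  next
    case False
    then obtain v where v: "Poly_Mapping.lookup \<alpha> v \<noteq> 0" by (metis lookup_zero poly_mapping_eqI)
    define \<beta> where "\<beta> = \<alpha> - Poly_Mapping.single v 1"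
    have \<alpha>: "\<alpha> = \<beta> + Poly_Mapping.single v 1"
      using v by (intro poly_mapping_eqI) (auto simp: \<beta>_def lookup_add lookup_minus lookup_single when_def)
    have "(\<Sum>u\<in>UNIV. Poly_Mapping.lookup \<alpha> u) = (\<Sum>u\<in>UNIV. Poly_Mapping.lookup \<beta> u) + 1"
      unfolding \<alpha> by (simp add: lookup_add sum.distrib lookup_single when_def)
    with Suc.prems have "(\<Sum>u\<in>UNIV. Poly_Mapping.lookup \<beta> u) \<le> m" by simp
    from Suc.IH[OF this] obtain zs where "length zs = m" "\<forall>x. prod_list (map (homog x) zs) = monom_eval \<beta> x"
      by blast
    thus ?thesis
      by (intro exI[of _ "Some v # zs"]) (simp add: \<alpha> monom_eval_add monom_eval_single)
  qed
qed

text \<open>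
  Pair the factors and replace each product of two by an entry of \<open>gram\<close>.
\<close>

lemma hform_of_list:
  fixes zs :: "'n::finite option list"
  assumes "length zs = 2 * D"
  shows "\<exists>q. hform D q \<and> (\<forall>z. q (frame z) = prod_list (map z zs))"
  using assms
proof (induction D arbitrary: zs)
  case 0
  thus ?case using hform_const[of 1] by (intro exI[of _ "\<lambda>_. 1"]) simp
next
  case (Suc D)
  then obtain a b r where zs: "zs = a # b # r" "length r = 2 * D"
    by (auto simp: length_Suc_conv)
  from Suc.IH[OF zs(2)] obtain q where "hform D q" "\<forall>z. q (frame z) = prod_list (map z r)" by blast
  thus ?case
    using hform_mult[OF hform_gram, of D q a b]
    by (intro exI[of _ "\<lambda>t. gram t a b * q t"]) (simp add: zs gram_frame)
qed

lemma hform_of_poly: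
  fixes P :: "'n::finite rpoly"
  assumes "deg_in UNIV P \<le> 2 * D"
  shows "\<exists>q. hform D q \<and> (\<forall>x. q (frame (homog x)) = poly_eval P x)"
proof -
  have "\<exists>q. hform D q \<and> (\<forall>x. q (frame (homog x)) = monom_eval \<alpha> x)"
    if "\<alpha> \<in> Poly_Mapping.keys P" for \<alpha>
  proof -
    have "(\<Sum>v\<in>UNIV. Poly_Mapping.lookup \<alpha> v) \<le> 2 * D"
      using assms that by (simp add: deg_in_le_iff)
    from monomial_as_list[OF this] obtain zs :: "'n option list" where
      zs: "length zs = 2 * D" "\<forall>x. prod_list (map (homog x) zs) = monom_eval \<alpha> x" by blast
    from hform_of_list[OF zs(1)] zs(2) show ?thesis by metis
  qed
  then obtain q where q: "\<And>\<alpha>. \<alpha> \<in> Poly_Mapping.keys P \<Longrightarrow> hform D (q \<alpha>)"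
    "\<And>\<alpha> x. \<alpha> \<in> Poly_Mapping.keys P \<Longrightarrow> q \<alpha> (frame (homog x)) = monom_eval \<alpha> x" by metis
  show ?thesis
    by (rule exI[of _ "\<lambda>t. \<Sum>\<alpha>\<in>Poly_Mapping.keys P. Poly_Mapping.lookup P \<alpha> * q \<alpha> t"])
       (auto intro!: hform_sum hform_cmult simp: q poly_eval_def)
qed

text \<open>
  It vanishes iff \<open>t\<close> is obtained from the matrix \<open>Z = gram t\<close> as \<open>Z\<^sub>i\<^sub>i \<plusminus> 2 Z\<^sub>i\<^sub>j + Z\<^sub>j\<^sub>j\<close>. For \<open>Z = z z\<^sup>T\<close> this is
  \<open>(z\<^sub>i \<plusminus> z\<^sub>j)\<^sup>2\<close>, and \<open>rank_defect\<close> measures whether \<open>Z\<close> has this form.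
\<close>

definition lin_defect :: "real ^ 'n::finite frame_index \<Rightarrow> real" where
  "lin_defect t = (\<Sum>k\<in>UNIV. (t $ k - (gram t (fst k) (fst k) + 2 * bsgn (snd (snd k)) * gram t (fst k) (fst (snd k))
     + gram t (fst (snd k)) (fst (snd k))))\<^sup>2)"

definition rank_defect :: "real ^ 'n::finite frame_index \<Rightarrow> real" where
  "rank_defect t = (\<Sum>i\<in>UNIV. \<Sum>j\<in>UNIV. \<Sum>k\<in>UNIV.
     (gram t i j * gram t k k - gram t i k * gram t j k)\<^sup>2)"

text \<open>
  The powers of the sum of the variables only make the penalty homogeneous of degree \<open>D\<close>; on the
  simplex they are \<open>1\<close>.
\<close>

definition defect :: "nat \<Rightarrow> real ^ 'n::finite frame_index \<Rightarrow> real" where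
  "defect D t = (\<Sum>k\<in>UNIV. t $ k) ^ (D - 2) * lin_defect t + (\<Sum>k\<in>UNIV. t $ k) ^ (D - 4) * rank_defect t"

lemma hform_defect:
  assumes "4 \<le> D" shows "hform D (defect D :: real ^ 'n::finite frame_index \<Rightarrow> real)"
proof -
  have e: "hform 1 (\<lambda>t :: real ^ 'n frame_index. \<Sum>k\<in>UNIV. t $ k)"
    by (intro hform_sum hform_coord)
  have c: "hform 1 (\<lambda>t. c * gram t i j)" for c and i j :: "'n option"
    by (intro hform_cmult hform_gram)
  have "hform (1 * 2) (lin_defect :: real ^ 'n frame_index \<Rightarrow> real)"
    unfolding lin_defect_def[abs_def]
    by (intro hform_sum hform_power hform_diff hform_add hform_coord hform_gram c)
  from hform_mult[OF hform_power[OF e, of "D - 2"] this]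
  moreover have "1 * (D - 2) + 1 * 2 = D" using assms by simp
  ultimately have 1: "hform D (\<lambda>t :: real ^ 'n frame_index. (\<Sum>k\<in>UNIV. t $ k) ^ (D - 2) * lin_defect t)"
    by metis
  have "hform ((1 + 1) * 2) (rank_defect :: real ^ 'n frame_index \<Rightarrow> real)"
    unfolding rank_defect_def[abs_def]
    by (intro hform_sum hform_power hform_diff hform_mult hform_gram)
  from hform_mult[OF hform_power[OF e, of "D - 4"] this]
  moreover have "1 * (D - 4) + (1 + 1) * 2 = D" using assms by simp
  ultimately have 2: "hform D (\<lambda>t :: real ^ 'n frame_index. (\<Sum>k\<in>UNIV. t $ k) ^ (D - 4) * rank_defect t)"
    by metis
  show ?thesis unfolding defect_def[abs_def] by (intro hform_add 1 2)
qed

lemma defect_frame: "defect D (frame z) = 0"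
  by (simp add: defect_def lin_defect_def rank_defect_def gram_frame frame_nth mult_ac)

lemma defect_nonneg: "t \<in> std_simplex \<Longrightarrow> defect D t \<ge> 0"
  by (auto simp: defect_def std_simplex_def lin_defect_def rank_defect_def intro!: add_nonneg_nonneg sum_nonneg)

text \<open>
  If the penalty vanishes, the trace of \<open>Z = gram t\<close> is a positive multiple of the sum of \<open>t\<close>, so some
  \<open>Z\<^sub>k\<^sub>k\<close> is positive; then \<open>Z\<^sub>i\<^sub>j Z\<^sub>k\<^sub>k = Z\<^sub>i\<^sub>k Z\<^sub>j\<^sub>k\<close> says that \<open>Z = z z\<^sup>T\<close> with \<open>z\<^sub>i = Z\<^sub>i\<^sub>k / Z\<^sub>k\<^sub>k\<^bsup>1/2\<^esup>\<close>.
\<close>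

lemma defect_zero_imp_frame:
  fixes t :: "real ^ 'n::finite frame_index"
  assumes t: "t \<in> std_simplex" and zero: "defect D t = 0"
  shows "\<exists>z. t = frame z"
proof -
  have e: "(\<Sum>k\<in>UNIV. t $ k) = 1" using t by (simp add: std_simplex_def)
  have nn: "lin_defect t \<ge> 0" "rank_defect t \<ge> 0"
    by (auto simp: lin_defect_def rank_defect_def intro!: sum_nonneg)
  have "lin_defect t + rank_defect t = 0" using zero by (simp add: defect_def e)
  with nn have L: "lin_defect t = 0" and R: "rank_defect t = 0" by linarith+
  from L have lin: "t $ (i, j, s) = gram t i i + 2 * bsgn s * gram t i j + gram t j j" for i j s
    unfolding lin_defect_def by (subst (asm) sum_nonneg_eq_0_iff) (auto dest: spec[of _ "(i, j, s)"])
  have "\<forall>i j k. (gram t i j * gram t k k - gram t i k * gram t j k)\<^sup>2 = 0"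
    using R unfolding rank_defect_def by (simp add: sum_nonneg_eq_0_iff sum_nonneg)
  hence rank: "gram t i j * gram t k k = gram t i k * gram t j k" for i j k
    by (metis eq_iff_diff_eq_0 zero_eq_power2)
  have "(\<Sum>k\<in>UNIV. t $ k) = (\<Sum>i\<in>UNIV. \<Sum>j\<in>UNIV. 2 * gram t i i + 2 * gram t j j)"
    unfolding sum_frame_index by (intro sum.cong refl) (simp add: lin bsgn_def)
  also have "\<dots> = 4 * real CARD('n option) * (\<Sum>i\<in>UNIV. gram t i i)"
    by (simp add: sum.distrib flip: sum_distrib_left)
  finally have "4 * real CARD('n option) * (\<Sum>i\<in>UNIV. gram t i i) = 1" by (simp add: e)
  hence "\<not> (\<Sum>i\<in>UNIV. gram t i i) \<le> 0"
    by (metis mult_nonneg_nonpos not_one_le_zero of_nat_0_le_iff zero_le_mult_iff zero_le_numeral)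
  then obtain k where k: "gram t k k > 0"
    by (metis not_le sum_nonpos)
  define z where "z i = gram t i k / sqrt (gram t k k)" for i
  have zz: "z i * z j = gram t i j" for i j
    using k rank[of i j k] by (simp add: z_def field_simps)
  have "t $ (i, j, s) = frame z $ (i, j, s)" for i j s
    unfolding lin by (simp add: frame_nth zz)
  hence "t = frame z" by (simp add: vec_eq_iff)
  thus ?thesis by blast
qed

lemma quad_form_sum: "quad_form A v = (\<Sum>i\<in>UNIV. \<Sum>j\<in>UNIV. v $ i * v $ j * A $ i $ j)"
  by (simp add: quad_form_def inner_vec_def matrix_vector_mult_def sum_distrib_left mult_ac)

lemma quad_form_mat: "quad_form (mat 1) v = v \<bullet> v"
  by (simp add: quad_form_def)

lemma quad_form_scale_vec: "quad_form A (c *\<^sub>R v) = c\<^sup>2 * quad_form A v"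
  by (simp add: quad_form_def matrix_vector_mult_scaleR power2_eq_square)

text \<open>
  Quadratic forms are homogeneous of degree two, so lower bounds need to be shown on the
  unit sphere only.
\<close>

lemma quad_form_bound_from_unit:
  assumes "\<And>u. norm u = 1 \<Longrightarrow> c \<le> quad_form A u"
  shows "c * (v \<bullet> v) \<le> quad_form A v"
proof (cases "v = 0")
  case False
  hence "norm ((1 / norm v) *\<^sub>R v) = 1" by simp
  hence "(norm v)\<^sup>2 * c \<le> (norm v)\<^sup>2 * quad_form A ((1 / norm v) *\<^sub>R v)"
    by (intro mult_left_mono assms) auto
  also have "\<dots> = quad_form A v"
    using False by (simp flip: quad_form_scale_vec)
  finally show ?thesis by (simp add: power2_norm_eq_inner mult.commute)
qed (simp add: quad_form_def)

lemma frame_homog_scale: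
  assumes "z None \<noteq> 0"
  shows "frame z = (z None)\<^sup>2 *\<^sub>R frame (homog (\<lambda>i. z (Some i) / z None))"
proof -
  have h: "z i = z None * homog (\<lambda>i. z (Some i) / z None) i" for i
    using assms by (cases i) simp_all
  show ?thesis
    by (simp add: vec_eq_iff frame_def power_mult_distrib[symmetric] distrib_left mult.left_commute flip: h)
qed

text \<open>
  For \<open>z\<^sub>0 \<noteq> 0\<close> this is the hypothesis at \<open>x = z / z\<^sub>0\<close>, multiplied by \<open>z\<^sub>0\<^bsup>2D\<^esup>\<close>. The points with \<open>z\<^sub>0 = 0\<close>,
  which represent directions at infinity, are limits of such points.
\<close>

lemma form_positive_at_frames:
  fixes P :: "'n::finite rpoly ^ 'p::finite ^ 'p"
  assumes q: "\<And>i j. hform D (q i j)" "\<And>i j x. q i j (frame (homog x)) = poly_eval (P $ i $ j) x"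
    and pos: "\<And>x v. \<eta> * poly_eval theta x ^ D * (v \<bullet> v) \<le> quad_form (mat_eval P x) v"
  shows "\<eta> * (\<Sum>i\<in>UNIV. (z i)\<^sup>2) ^ D * (v \<bullet> v) \<le> quad_form (\<chi> i j. q i j (frame z)) v"
proof -
  have nz: "\<eta> * (\<Sum>i\<in>UNIV. (z i)\<^sup>2) ^ D * (v \<bullet> v) \<le> quad_form (\<chi> i j. q i j (frame z)) v"
    if "z None \<noteq> 0" for z
  proof -
    define x where "x i = z (Some i) / z None" for i
    have "(\<Sum>i\<in>UNIV. (z i)\<^sup>2) = (z None)\<^sup>2 * poly_eval theta x"
      using that by (simp add: sum_option poly_eval_theta x_def power_divide distrib_left sum_distrib_left)
    moreover have "quad_form (\<chi> i j. q i j (frame z)) v = ((z None)\<^sup>2) ^ D * quad_form (mat_eval P x) v"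
      unfolding frame_homog_scale[of z, OF that] x_def[symmetric] hform_scale[OF q(1)] q(2)
      by (simp add: quad_form_sum mat_eval_def map_matrix_def sum_distrib_left mult_ac)
    ultimately show ?thesis
      using mult_left_mono[OF pos[of x v], of "((z None)\<^sup>2) ^ D"]
      by (simp add: power_mult_distrib mult_ac)
  qed
  show ?thesis
  proof (cases "z None = 0")
    case False
    thus ?thesis by (rule nz)
  next
    case True
    \<comment> \<open>the difference of the two sides with \<open>s\<close> as the homogenizing coordinate\<close>
    define g where "g s = quad_form (\<chi> i j. q i j (frame (z(None := s)))) v
      - \<eta> * (\<Sum>i\<in>UNIV. ((z(None := s)) i)\<^sup>2) ^ D * (v \<bullet> v)" for s
    have upd: "continuous_on UNIV (\<lambda>s. (z(None := s)) i)" for i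
      by (cases i) simp_all
    have fr: "continuous_on UNIV (\<lambda>s. frame (z(None := s)))"
      unfolding frame_def by (intro continuous_intros upd)
    have "continuous_on UNIV (\<lambda>s. q i j (frame (z(None := s))))" for i j
      using continuous_on_compose[OF fr hform_continuous[OF q(1)]] by (simp add: o_def)
    hence "continuous_on UNIV g"
      unfolding g_def quad_form_sum vec_lambda_beta by (intro continuous_intros upd)
    hence "(g \<longlongrightarrow> g 0) (at 0)" by (simp add: continuous_on_def)
    moreover have "eventually (\<lambda>s. g s \<ge> 0) (at 0)"
      using nz[of "z(None := s)" for s] by (auto simp: eventually_at_filter g_def intro!: always_eventually)
    ultimately have "g 0 \<ge> 0" by (rule tendsto_lowerbound) simp
    moreover have "z(None := 0) = z" using True by auto
    ultimately show ?thesis by (simp add: g_def)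
  qed
qed

lemma psd_scaleR: "psd A \<Longrightarrow> c \<ge> 0 \<Longrightarrow> psd (c *\<^sub>R A)"
  unfolding psd_def symmetric_mat_iff by (simp add: scaleR_matrix_vector_assoc[symmetric])

definition frame_poly :: "'n::finite frame_index \<Rightarrow> 'n rpoly" where
  "frame_poly k = case_option 1 Var (fst k) + Const (bsgn (snd (snd k))) * case_option 1 Var (fst (snd k))"

lemma poly_eval_frame_poly: "(poly_eval (frame_poly k) x)\<^sup>2 = frame (homog x) $ k"
proof -
  have "poly_eval (case_option 1 Var i) x = homog x i" for i by (cases i) simp_all
  thus ?thesis by (simp add: frame_poly_def frame_def poly_eval_hom)
qed

text \<open>
  Homogenize \<open>P\<close> and write it as a form in the variables \<open>frame z\<close>. This form is positive at the
  points of the simplex that are of the form \<open>frame z\<close>, and adding a large multiple of \<open>defect\<close> makes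
  it positive on the whole simplex without changing its values at those points. After Polya's
  theorem, substitute \<open>z = (1, x)\<close> back: the sum of the variables becomes a multiple of \<open>\<theta>\<close>, and every
  monomial becomes the square of a product of linear polynomials. The bound \<open>4 \<le> D\<close> makes room
  for the penalty, which has degree four.
\<close>

theorem matrix_reznick:
  fixes P :: "'n::finite rpoly ^ 'p::finite ^ 'p"
  assumes sym: "symmetric_mat P" and deg: "\<And>i j. deg_in UNIV (P $ i $ j) \<le> 2 * D" and "4 \<le> D"
    and "\<eta> > 0" and pos: "\<And>x v. \<eta> * poly_eval theta x ^ D * (v \<bullet> v) \<le> quad_form (mat_eval P x) v"
  shows "eventually (\<lambda>N. sos_mat (map_matrix (\<lambda>Q. theta ^ N * Q) P)) sequentially"
proof -
  have "\<forall>i j. \<exists>q. hform D q \<and> (\<forall>x. q (frame (homog x)) = poly_eval (P $ i $ j) x)"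
    using hform_of_poly[OF deg] by blast
  then obtain q' where q': "\<And>i j. hform D (q' i j)" "\<And>i j x. q' i j (frame (homog x)) = poly_eval (P $ i $ j) x"
    by metis
  define q where "q i j t = (1/2) * (q' i j t + q' j i t)" for i j t
  have q: "hform D (q i j)" "q i j (frame (homog x)) = poly_eval (P $ i $ j) x" "q i j t = q j i t" for i j x t
  proof -
    show "hform D (q i j)" unfolding q_def[abs_def] by (intro hform_cmult hform_add q')
    show "q i j (frame (homog x)) = poly_eval (P $ i $ j) x"
      using sym by (simp add: q_def q' symmetric_mat_iff)
  qed (simp add: q_def add.commute)
  define f0 where "f0 t = (\<chi> i j. q i j t)" for t
  define \<phi> where "\<phi> p = quad_form (f0 (fst p)) (snd p)" for p :: "(real ^ 'n frame_index) \<times> (real ^ 'p)"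
  define K where "K = (std_simplex :: (real ^ 'n frame_index) set) \<times> sphere (0 :: real ^ 'p) 1"
  have "compact K" unfolding K_def by (intro compact_Times compact_std_simplex compact_sphere)
  moreover have "continuous_on K \<phi>"
  proof -
    have "continuous_on K (\<lambda>p. q i j (fst p))" for i j
      using continuous_on_compose[OF continuous_on_fst[OF continuous_on_id] hform_continuous[OF q(1)]]
      by (simp add: o_def)
    thus ?thesis unfolding \<phi>_def quad_form_sum f0_def vec_lambda_beta by (intro continuous_intros)
  qed
  moreover have "continuous_on K (\<lambda>p. defect D (fst p))"
    using continuous_on_compose[OF continuous_on_fst[OF continuous_on_id] hform_continuous[OF hform_defect[OF \<open>4 \<le> D\<close>]]]
    by (simp add: o_def)
  moreover have "defect D (fst p) \<ge> 0" if "p \<in> K" for p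
    using that by (intro defect_nonneg) (auto simp: K_def)
  moreover have "\<phi> p > 0" if p: "p \<in> K" "defect D (fst p) = 0" for p
  proof -
    have t: "fst p \<in> std_simplex" and v: "snd p \<bullet> snd p = 1"
      using p by (auto simp: K_def norm_eq_1)
    obtain z where z: "fst p = frame z" using defect_zero_imp_frame[OF t p(2)] by blast
    have "4 * real CARD('n option) * (\<Sum>i\<in>UNIV. (z i)\<^sup>2) = 1"
      using t unfolding z sum_frame[symmetric] by (simp add: std_simplex_def)
    moreover have "(\<Sum>i\<in>UNIV. (z i)\<^sup>2) \<ge> 0" by (simp add: sum_nonneg)
    ultimately have "(\<Sum>i\<in>UNIV. (z i)\<^sup>2) > 0" by (cases "(\<Sum>i\<in>UNIV. (z i)\<^sup>2) = 0") auto
    hence "0 < \<eta> * (\<Sum>i\<in>UNIV. (z i)\<^sup>2) ^ D * (snd p \<bullet> snd p)" using \<open>\<eta> > 0\<close> v by simp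
    also have "\<dots> \<le> \<phi> p"
      unfolding \<phi>_def f0_def z by (rule form_positive_at_frames[OF q(1,2) pos])
    finally show ?thesis .
  qed
  ultimately obtain C \<eta>' where C: "\<eta>' > 0" "\<And>p. p \<in> K \<Longrightarrow> \<phi> p + C * defect D (fst p) \<ge> \<eta>'"
    using penalty_positive[of K \<phi> "\<lambda>p. defect D (fst p)"] by blast
  define f where "f t = f0 t + (C * defect D t) *\<^sub>R mat 1" for t
  have fpos: "quad_form (f t) v \<ge> \<eta>' * (v \<bullet> v)" if t: "t \<in> std_simplex" for t v
  proof (rule quad_form_bound_from_unit)
    fix u :: "real ^ 'p" assume "norm u = 1"
    hence u: "u \<bullet> u = 1" "norm u = 1" by (simp_all add: norm_eq_1)
    show "\<eta>' \<le> quad_form (f t) u"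
      using C(2)[of "(t, u)"] t u by (simp add: K_def \<phi>_def f_def quad_form_linear quad_form_mat)
  qed
  have "\<forall>p. \<exists>a. \<forall>t. q (fst p) (snd p) t = (\<Sum>\<kappa>\<in>words D. (\<Prod>l<D. t $ \<kappa> l) * a \<kappa>)"
    using q(1) unfolding hform_def by blast
  from choice[OF this] obtain a'' where
    a'': "\<forall>p t. q (fst p) (snd p) t = (\<Sum>\<kappa>\<in>words D. (\<Prod>l<D. t $ \<kappa> l) * a'' p \<kappa>)" by blast
  define a' where "a' i j = a'' (i, j)" for i j
  have a': "q i j t = (\<Sum>\<kappa>\<in>words D. (\<Prod>l<D. t $ \<kappa> l) * a' i j \<kappa>)" for i j t
    using a''[rule_format, of "(i, j)" t] by (simp add: a'_def)
  obtain b where b: "\<And>t :: real ^ 'n frame_index. defect D t = (\<Sum>\<kappa>\<in>words D. (\<Prod>l<D. t $ \<kappa> l) * b \<kappa>)"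
    using hform_defect[OF \<open>4 \<le> D\<close>, where 'n = 'n] unfolding hform_def by blast
  \<comment> \<open>the entries of a coefficient are symmetrized, as they were chosen independently of each other\<close>
  define a :: "(nat \<Rightarrow> 'n frame_index) \<Rightarrow> real ^ 'p ^ 'p" where
    "a \<kappa> = (\<chi> i j. (a' i j \<kappa> + a' j i \<kappa>) / 2 + C * b \<kappa> * mat 1 $ i $ j)" for \<kappa>
  have "f t = (\<Sum>\<kappa>\<in>words D. (\<Prod>l<D. t $ \<kappa> l) *\<^sub>R a \<kappa>)" for t
  proof -
    have "f t $ i $ j = (q i j t + q j i t) / 2 + C * defect D t * mat 1 $ i $ j" for i j
      using q(3)[of i j t] by (simp add: f_def f0_def)
    thus ?thesis
      by (simp add: vec_eq_iff a_def a' b sum.distrib sum_distrib_left sum_distrib_right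
          sum_divide_distrib algebra_simps add_divide_distrib)
  qed
  moreover have "symmetric_mat (a \<kappa>)" for \<kappa>
    by (simp add: symmetric_mat_iff a_def mat_def add.commute)
  ultimately have "eventually (\<lambda>N. \<exists>B. (\<forall>w. psd (B w)) \<and>
    (\<forall>t. (\<Sum>k\<in>UNIV. t $ k) ^ N *\<^sub>R f t
      = (\<Sum>w\<in>words (D + N). (\<Prod>l<D + N. t $ w l) *\<^sub>R B w))) sequentially"
    using \<open>\<eta>' > 0\<close> fpos by (rule matrix_polya)
  thus ?thesis
  proof eventually_elim
    case (elim N)
    then obtain B where B: "\<And>w. psd (B w)" "\<And>t. (\<Sum>k\<in>UNIV. t $ k) ^ N *\<^sub>R f t
      = (\<Sum>w\<in>words (D + N). (\<Prod>l<D + N. t $ w l) *\<^sub>R B w)" by blast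
    define c where "c = (4 * real CARD('n option)) ^ N"
    have c: "c > 0" by (simp add: c_def)
    define S where "S = (\<Sum>w\<in>words (D + N). (\<chi> i j. (\<Prod>l<D + N. frame_poly (w l))\<^sup>2 * Const (((1 / c) *\<^sub>R B w) $ i $ j)))"
    have "sos_mat S"
      unfolding S_def using c by (intro sos_mat_sum sos_mat_square_psd psd_scaleR B) auto
    moreover have "S = map_matrix (\<lambda>Q. theta ^ N * Q) P"
    proof -
      have "poly_eval (S $ i $ j) x = poly_eval (theta ^ N * P $ i $ j) x" for i j x
      proof -
        define t where "t = frame (homog x)"
        have "poly_eval (S $ i $ j) x = (\<Sum>w\<in>words (D + N). (\<Prod>l<D + N. t $ w l) * (B w $ i $ j)) / c"
          by (simp add: S_def poly_eval_hom prod_power_distrib poly_eval_frame_poly t_def sum_divide_distrib)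
        also have "(\<Sum>w\<in>words (D + N). (\<Prod>l<D + N. t $ w l) * (B w $ i $ j))
            = ((\<Sum>k\<in>UNIV. t $ k) ^ N *\<^sub>R f t) $ i $ j"
          unfolding B(2) by simp
        also have "\<dots> = (c * poly_eval theta x ^ N) * f t $ i $ j"
          by (simp add: t_def sum_frame sum_homog_sq c_def power_mult_distrib)
        also have "f t $ i $ j = poly_eval (P $ i $ j) x"
          by (simp add: f_def f0_def q(2) t_def defect_frame)
        finally show ?thesis using c by (simp add: poly_eval_hom)
      qed
      hence "S $ i $ j = theta ^ N * P $ i $ j" for i j by (rule rpoly_eqI)
      thus ?thesis by (simp add: vec_eq_iff map_matrix_def)
    qed
    ultimately show ?case by simp
  qed
qed

section \<open>Quasi-analyticity: the theorems of Bang and Carleman\<close>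

text \<open>
  The inequality \<open>N k s t \<le> exp(k - n) M k\<close> for all \<open>k\<close> says that the first \<open>n\<close> derivatives are small
  relative to their bounds; it is trivial for \<open>k \<ge> n\<close>. Moving from \<open>t\<close> by at most
  \<open>M n / (e M (n + 1))\<close> costs one unit of \<open>n\<close>: by logarithmic convexity \<open>M (k + j) \<le> M k \<rho>\<^sup>j\<close> with
  \<open>\<rho> = M (n + 1) / M n\<close> for \<open>k + j \<le> n + 1\<close>, so Taylor's formula of order \<open>n + 1 - k\<close> is dominated by the
  exponential series at \<open>e |h| \<rho> \<le> 1\<close>.
\<close>

lemma bang_step:
  fixes N :: "nat \<Rightarrow> real \<Rightarrow> real \<Rightarrow> real" and M :: "nat \<Rightarrow> real"
  assumes Mpos: "\<And>n. M n > 0"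
    and ratio: "\<And>n. M (Suc n) / M n \<le> M (Suc (Suc n)) / M (Suc n)"
    and bound: "\<And>k s t. N k s t \<le> M k"
    and taylor: "\<And>k m s t h. N k s (t + h) \<le>
      (\<Sum>j<m. \<bar>h\<bar> ^ j / fact j * N (k + j) (s + real j * (pi / 2)) t) + \<bar>h\<bar> ^ m / fact m * M (k + m)"
    and small: "\<And>k s. N k s t \<le> exp (real k - real (Suc n)) * M k"
    and h: "\<bar>h\<bar> \<le> M n / (exp 1 * M (Suc n))"
  shows "N k s (t + h) \<le> exp (real k - real n) * M k"
proof (cases "k \<le> n")
  case False
  have "N k s (t + h) \<le> 1 * M k" using bound by simp
  also have "\<dots> \<le> exp (real k - real n) * M k"
    using False Mpos[of k] by (intro mult_right_mono) auto
  finally show ?thesis .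
next
  case True
  define m where "m = Suc n - k"
  have km: "k + m = Suc n" using True by (simp add: m_def)
  define \<rho> where "\<rho> = M (Suc n) / M n"
  have \<rho>: "\<rho> > 0" using Mpos by (simp add: \<rho>_def)
  have mono: "M (Suc i) / M i \<le> \<rho>" if "i \<le> n" for i
  proof -
    have "incseq (\<lambda>i. M (Suc i) / M i)" using ratio by (intro incseq_SucI)
    thus ?thesis using that unfolding \<rho>_def by (auto dest: incseqD)
  qed
  have growth: "M (k + j) \<le> M k * \<rho> ^ j" if "j \<le> m" for j
    using that
  proof (induction j)
    case (Suc j)
    have "M (k + Suc j) = M (k + j) * (M (Suc (k + j)) / M (k + j))" using Mpos[of "k + j"] by simp
    also have "\<dots> \<le> (M k * \<rho> ^ j) * \<rho>"
      using Suc km less_imp_le[OF Mpos] \<rho>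
      by (intro mult_mono mono mult_nonneg_nonneg zero_le_power) (auto simp: less_imp_le)
    finally show ?case by (simp add: mult_ac)
  qed simp
  define x where "x = exp 1 * \<bar>h\<bar> * \<rho>"
  have x: "0 \<le> x" "x \<le> 1"
    using h Mpos[of n] Mpos[of "Suc n"] \<rho> by (auto simp: x_def \<rho>_def field_simps)
  have summand: "\<bar>h\<bar> ^ j / fact j * (exp (real (k + j) - real (Suc n)) * M (k + j))
      \<le> exp (real k - real (Suc n)) * M k * (x ^ j / fact j)" if "j \<le> m" for j
  proof -
    have "exp (real (k + j) - real (Suc n)) = exp (real k - real (Suc n)) * exp 1 ^ j"
      by (simp add: exp_add[symmetric] exp_of_nat_mult[symmetric] algebra_simps)
    hence "\<bar>h\<bar> ^ j / fact j * (exp (real (k + j) - real (Suc n)) * M (k + j))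
       = (exp (real k - real (Suc n)) * (\<bar>h\<bar> * exp 1) ^ j / fact j) * M (k + j)"
      by (simp add: power_mult_distrib)
    also have "\<dots> \<le> (exp (real k - real (Suc n)) * (\<bar>h\<bar> * exp 1) ^ j / fact j) * (M k * \<rho> ^ j)"
      using growth[OF that] by (intro mult_left_mono) auto
    finally show ?thesis by (simp add: x_def power_mult_distrib mult_ac)
  qed
  have "N k s (t + h) \<le> (\<Sum>j<m. \<bar>h\<bar> ^ j / fact j * N (k + j) (s + real j * (pi / 2)) t)
      + \<bar>h\<bar> ^ m / fact m * M (k + m)" by (rule taylor)
  also have "\<dots> \<le> (\<Sum>j<m. \<bar>h\<bar> ^ j / fact j * (exp (real (k + j) - real (Suc n)) * M (k + j)))
      + \<bar>h\<bar> ^ m / fact m * (exp (real (k + m) - real (Suc n)) * M (k + m))"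
    by (intro add_mono sum_mono mult_left_mono small) (auto simp: km)
  also have "\<dots> = (\<Sum>j\<le>m. \<bar>h\<bar> ^ j / fact j * (exp (real (k + j) - real (Suc n)) * M (k + j)))"
    by (simp add: lessThan_Suc_atMost[symmetric])
  also have "\<dots> \<le> (\<Sum>j\<le>m. exp (real k - real (Suc n)) * M k * (x ^ j / fact j))"
    by (intro sum_mono summand) auto
  also have "\<dots> = exp (real k - real (Suc n)) * M k * (\<Sum>j\<le>m. x ^ j / fact j)"
    by (rule sum_distrib_left[symmetric])
  also have "\<dots> \<le> exp (real k - real (Suc n)) * M k * exp 1"
  proof (intro mult_left_mono)
    have "(\<lambda>j. x ^ j / fact j) sums exp x" using exp_converges[of x] by (simp add: divide_inverse mult.commute)
    hence "(\<Sum>j\<le>m. x ^ j / fact j) \<le> exp x"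
      using x sum_le_suminf[of "\<lambda>j. x ^ j / fact j" "{..m}"] by (simp add: sums_iff)
    also have "exp x \<le> exp 1" using x by simp
    finally show "(\<Sum>j\<le>m. x ^ j / fact j) \<le> exp 1" .
  qed (use Mpos[of k] in auto)
  also have "\<dots> = (exp (real k - real (Suc n)) * exp 1) * M k" by simp
  also have "exp (real k - real (Suc n)) * exp 1 = exp (real k - real n)"
    by (simp add: exp_add[symmetric])
  finally show ?thesis .
qed

text \<open>
  Bang's proof of the Denjoy--Carleman theorem, in a form that does not mention functions and their
  derivatives: \<open>N k s t\<close> stands for the size of the \<open>k\<close>-th derivative at \<open>t\<close>, of which only the
  Taylor estimate is used. The parameter \<open>s\<close> is the phase of a cosine, which differentiation
  shifts by a right angle. Flatness at \<open>0\<close> gives smallness of every order there. Starting with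
  order \<open>n + m\<close>, after \<open>m\<close> steps order \<open>n\<close> is left; as the admissible step lengths have a divergent
  sum, every \<open>t\<close> is reached with arbitrarily large \<open>n\<close> left.
\<close>

lemma bang_vanishing:
  fixes N :: "nat \<Rightarrow> real \<Rightarrow> real \<Rightarrow> real" and M :: "nat \<Rightarrow> real"
  assumes Mpos: "\<And>n. M n > 0"
    and ratio: "\<And>n. M (Suc n) / M n \<le> M (Suc (Suc n)) / M (Suc n)"
    and bound: "\<And>k s t. N k s t \<le> M k"
    and taylor: "\<And>k m s t h. N k s (t + h) \<le>
      (\<Sum>j<m. \<bar>h\<bar> ^ j / fact j * N (k + j) (s + real j * (pi / 2)) t) + \<bar>h\<bar> ^ m / fact m * M (k + m)"
    and zero: "\<And>k s. N k s 0 \<le> 0"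
    and div: "\<not> summable (\<lambda>n. M n / M (Suc n))"
  shows "N 0 s t \<le> 0"
proof -
  define a where "a n = M n / (exp 1 * M (Suc n))" for n
  have a: "a n > 0" for n using Mpos by (simp add: a_def)
  have reach: "N k s t \<le> exp (real k - real n) * M k" if "\<bar>t\<bar> \<le> (\<Sum>i<m. a (n + i))" for m n k s t
    using that
  proof (induction m arbitrary: n k s t)
    case 0
    have "N k s 0 \<le> 0" by (rule zero)
    also have "\<dots> \<le> exp (real k - real n) * M k" using Mpos[of k] by simp
    finally show ?case using 0 by simp
  next
    case (Suc m)
    define r where "r = (\<Sum>i<m. a (Suc n + i))"
    have r: "r \<ge> 0" unfolding r_def by (intro sum_nonneg less_imp_le a)
    have t: "\<bar>t\<bar> \<le> a n + r"
      using Suc.prems by (simp add: sum.lessThan_Suc_shift r_def del: sum.lessThan_Suc)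
    \<comment> \<open>the point reached with the steps belonging to larger orders; one more step leads to \<open>t\<close>\<close>
    define u where "u = (if \<bar>t\<bar> \<le> r then t else sgn t * r)"
    have u: "\<bar>u\<bar> \<le> r" using r by (auto simp: u_def abs_mult sgn_if)
    have tu: "\<bar>t - u\<bar> \<le> a n" using t r a[of n] by (auto simp: u_def sgn_if split: if_splits)
    have "N k s (u + (t - u)) \<le> exp (real k - real n) * M k"
    proof (rule bang_step[OF Mpos ratio bound taylor])
      show "N k s u \<le> exp (real k - real (Suc n)) * M k" for k s
        by (rule Suc.IH) (use u in \<open>simp add: r_def\<close>)
      show "\<bar>t - u\<bar> \<le> M n / (exp 1 * M (Suc n))" using tu by (simp add: a_def)
    qed
    thus ?case by simp
  qed
  have "N 0 s t \<le> exp (- real n) * M 0" for n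
  proof -
    have "\<exists>m. \<bar>t\<bar> \<le> (\<Sum>i<m. a (n + i))"
    proof (rule ccontr)
      assume "\<not> ?thesis"
      hence "(\<Sum>i<m. a (n + i)) \<le> \<bar>t\<bar>" for m by (meson le_cases)
      hence "summable (\<lambda>i. a (i + n))"
        using a by (intro summableI_nonneg_bounded[of _ "\<bar>t\<bar>"]) (auto simp: add.commute intro: less_imp_le)
      hence "summable (\<lambda>n. exp 1 * a n)" by (intro summable_mult) simp
      thus False using div by (simp add: a_def)
    qed
    then obtain m where "\<bar>t\<bar> \<le> (\<Sum>i<m. a (n + i))" by blast
    from reach[OF this, of 0 s] show ?thesis by simp
  qed
  moreover have "(\<lambda>n. exp (- real n) * M 0) \<longlonglongrightarrow> 0" by real_asymp
  ultimately show ?thesis by (intro LIMSEQ_le_const) auto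
qed

text \<open>
  The arithmetic-geometric mean inequality for the numbers \<open>(k + 1) a\<^sub>k\<close> and the estimate
  \<open>n! \<ge> (n/e)\<^sup>n\<close> bound the geometric mean of \<open>a\<^sub>0, \<dots>, a\<^sub>n\<close> by a constant times \<open>T n / ((n + 1)(n + 2))\<close>, and
  summation by parts bounds the sum of these by the sum of \<open>a\<close>.
\<close>

lemma carleman_inequality:
  fixes a :: "nat \<Rightarrow> real"
  assumes a: "\<And>n. a n \<ge> 0" and "summable a"
  shows "summable (\<lambda>n. (\<Prod>k\<le>n. a k) powr (1 / real (Suc n)))"
proof -
  define T where "T n = (\<Sum>k\<le>n. real (Suc k) * a k)" for n
  have T0: "T n \<ge> 0" for n unfolding T_def by (intro sum_nonneg mult_nonneg_nonneg a) auto
  have abel: "(\<Sum>n<m. T n / (real (Suc n) * real (Suc (Suc n)))) \<le> (\<Sum>n<m. a n)" for m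
  proof -
    have "(\<Sum>n<Suc m. T n / (real (Suc n) * real (Suc (Suc n)))) = (\<Sum>n<Suc m. a n) - T m / real (Suc (Suc m))" for m
    proof (induction m)
      case 0
      show ?case by (simp add: T_def)
    next
      case (Suc m)
      have 1: "T m = T (Suc m) - real (Suc (Suc m)) * a (Suc m)" by (simp add: T_def)
      have "(\<Sum>n<Suc (Suc m). T n / (real (Suc n) * real (Suc (Suc n))))
        = (\<Sum>n<Suc m. a n) - T m / real (Suc (Suc m)) + T (Suc m) / (real (Suc (Suc m)) * real (Suc (Suc (Suc m))))"
        by (subst sum.lessThan_Suc) (simp only: Suc.IH)
      also have "\<dots> = (\<Sum>n<Suc (Suc m). a n) - T (Suc m) / real (Suc (Suc (Suc m)))"
      proof -
        have "T m / real (Suc (Suc m)) = T (Suc m) / real (Suc (Suc m)) - a (Suc m)"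
          unfolding 1 by (simp add: field_simps del: of_nat_Suc)
        moreover have "T (Suc m) / (real (Suc (Suc m)) * real (Suc (Suc (Suc m))))
            = T (Suc m) / real (Suc (Suc m)) - T (Suc m) / real (Suc (Suc (Suc m)))"
          by (simp add: field_simps)
        ultimately show ?thesis by simp
      qed
      finally show ?case .
    qed
    from this[of "m - 1"] show ?thesis using T0[of "m - 1"] by (cases m) auto
  qed
  have G: "(\<Prod>k\<le>n. a k) powr (1 / real (Suc n)) \<le> 2 * exp 1 * (T n / (real (Suc n) * real (Suc (Suc n))))" for n
  proof -
    let ?m = "real (Suc n)"
    have "(\<Prod>k\<le>n. real (Suc k) * a k) powr (1 / real (card {..n})) \<le> (\<Sum>k\<le>n. real (Suc k) * a k / real (card {..n}))"
      by (rule arith_geom_mean) (auto intro: a mult_nonneg_nonneg)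
    hence "(\<Prod>k\<le>n. real (Suc k) * a k) powr (1 / ?m) \<le> T n / ?m"
      by (simp add: T_def sum_divide_distrib)
    moreover have "(\<Prod>k\<le>n. real (Suc k) * a k) = fact (Suc n) * (\<Prod>k\<le>n. a k)"
      by (simp add: prod.distrib fact_prod_Suc atLeast0LessThan lessThan_Suc_atMost del: fact_Suc of_nat_Suc)
    ultimately have 1: "fact (Suc n) powr (1 / ?m) * (\<Prod>k\<le>n. a k) powr (1 / ?m) \<le> T n / ?m"
      using a by (simp add: powr_mult prod_nonneg del: fact_Suc)
    have "?m ^ Suc n / fact (Suc n) \<le> exp ?m"
    proof -
      have s: "(\<lambda>j. ?m ^ j / fact j) sums exp ?m"
        using exp_converges[of ?m] by (simp add: divide_inverse mult.commute)
      have "(\<Sum>j\<in>{Suc n}. ?m ^ j / fact j) \<le> suminf (\<lambda>j. ?m ^ j / fact j)"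
        by (rule sum_le_suminf) (use s in \<open>auto simp: sums_iff\<close>)
      thus ?thesis using s by (simp add: sums_iff)
    qed
    hence "(?m / exp 1) ^ Suc n \<le> fact (Suc n)"
      by (simp add: power_divide exp_of_nat_mult[symmetric] field_simps del: fact_Suc power_Suc of_nat_Suc)
    hence "((?m / exp 1) ^ Suc n) powr (1 / ?m) \<le> fact (Suc n) powr (1 / ?m)"
      by (intro powr_mono2) auto
    moreover have "((?m / exp 1) ^ Suc n) powr (1 / ?m) = ?m / exp 1"
      by (subst powr_realpow[symmetric]) (simp_all add: powr_powr del: of_nat_Suc)
    ultimately have "?m / exp 1 \<le> fact (Suc n) powr (1 / ?m)" by (simp only:)
    from order_trans[OF mult_right_mono[OF this powr_ge_zero] 1]
    have "?m / exp 1 * (\<Prod>k\<le>n. a k) powr (1 / ?m) \<le> T n / ?m" .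
    hence "(\<Prod>k\<le>n. a k) powr (1 / ?m) \<le> exp 1 * (T n / (?m * ?m))"
      by (simp add: field_simps del: of_nat_Suc)
    also have "\<dots> \<le> exp 1 * (2 * (T n / (?m * real (Suc (Suc n)))))"
    proof (rule mult_left_mono)
      have "T n * real (Suc (Suc n)) \<le> T n * (?m * 2)"
        using T0[of n] by (intro mult_left_mono) auto
      thus "T n / (?m * ?m) \<le> 2 * (T n / (?m * real (Suc (Suc n))))"
        by (simp add: divide_simps mult_ac del: of_nat_Suc)
    qed simp
    finally show ?thesis by (simp add: mult_ac)
  qed
  show ?thesis
  proof (rule summableI_nonneg_bounded[of _ "2 * exp 1 * suminf a"])
    fix m
    have "(\<Sum>n<m. (\<Prod>k\<le>n. a k) powr (1 / real (Suc n)))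
        \<le> (\<Sum>n<m. 2 * exp 1 * (T n / (real (Suc n) * real (Suc (Suc n)))))"
      by (intro sum_mono G)
    also have "\<dots> \<le> 2 * exp 1 * (\<Sum>n<m. a n)"
      unfolding sum_distrib_left[symmetric] by (intro mult_left_mono abel) auto
    also have "\<dots> \<le> 2 * exp 1 * suminf a"
      using assms by (intro mult_left_mono sum_le_suminf) auto
    finally show "(\<Sum>n<m. (\<Prod>k\<le>n. a k) powr (1 / real (Suc n))) \<le> 2 * exp 1 * suminf a" .
  qed simp
qed

text \<open>
  Here \<open>c n\<close> stands for the moment of order \<open>2n\<close>. With \<open>a n = (c n / c (n + 1))\<^bsup>1/2\<^esup>\<close>, the geometric mean of
  \<open>a 0, \<dots>, a n\<close> is essentially the Carleman term \<open>c (n + 1)^(-1/(2n + 2))\<close>, so \<open>a\<close> is not summable by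
  Carleman's inequality. Since \<open>a\<close> is decreasing, it is not summable along the odd indices either,
  and \<open>(c (2n) / c (2n + 2))\<^bsup>1/4\<^esup>\<close>, the geometric mean of \<open>a (2n)\<close> and \<open>a (2n + 1)\<close>, is at least \<open>a (2n + 1)\<close>.
  Passing to every second moment is needed because a Cauchy--Schwarz estimate below doubles
  the order.
\<close>

lemma carleman_ratio_divergence:
  fixes c :: "nat \<Rightarrow> real"
  assumes c: "\<And>n. c n > 0" and logconv: "\<And>n. (c (Suc n))\<^sup>2 \<le> c n * c (Suc (Suc n))"
    and div: "\<not> summable (\<lambda>n. 1 / c (Suc n) powr (1 / real (2 * Suc n)))"
  shows "\<not> summable (\<lambda>n. (c (2 * n) / c (2 * n + 2)) powr (1 / 4))"
proof
  assume sm: "summable (\<lambda>n. (c (2 * n) / c (2 * n + 2)) powr (1 / 4))"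
  define a where "a n = sqrt (c n / c (Suc n))" for n
  have a: "a n > 0" for n using c by (simp add: a_def)
  have dec: "a (Suc n) \<le> a n" for n
    unfolding a_def using logconv[of n] c[of "Suc n"] c[of "Suc (Suc n)"]
    by (intro real_sqrt_le_mono) (simp add: field_simps power2_eq_square)
  have odd: "a (2 * n + 1) \<le> (c (2 * n) / c (2 * n + 2)) powr (1 / 4)" for n
  proof -
    have "(a (2 * n + 1)) ^ 4 \<le> (a (2 * n))\<^sup>2 * (a (2 * n + 1))\<^sup>2"
    proof -
      have "(a (2 * n + 1))\<^sup>2 \<le> (a (2 * n))\<^sup>2" using dec[of "2 * n"] a[of "2 * n + 1"] by (intro power_mono) auto
      hence "(a (2 * n + 1))\<^sup>2 * (a (2 * n + 1))\<^sup>2 \<le> (a (2 * n))\<^sup>2 * (a (2 * n + 1))\<^sup>2"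
        by (intro mult_right_mono) auto
      thus ?thesis by (simp add: power4_eq_xxxx power2_eq_square mult_ac)
    qed
    also have "\<dots> = c (2 * n) / c (2 * n + 2)"
    proof -
      have "(a k)\<^sup>2 = c k / c (Suc k)" for k using c[of k] c[of "Suc k"] by (simp add: a_def)
      thus ?thesis using c[of "2 * n + 1"] by simp
    qed
    finally have "((a (2 * n + 1)) ^ 4) powr (1 / 4) \<le> (c (2 * n) / c (2 * n + 2)) powr (1 / 4)"
      by (intro powr_mono2) auto
    moreover have "((a (2 * n + 1)) ^ 4) powr (1 / 4) = a (2 * n + 1)"
    proof -
      have "(a (2 * n + 1)) ^ 4 = a (2 * n + 1) powr 4" using a[of "2 * n + 1"] by simp
      hence "((a (2 * n + 1)) ^ 4) powr (1 / 4) = a (2 * n + 1) powr (4 * (1 / 4))"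
        by (simp only: powr_powr)
      thus ?thesis using a[of "2 * n + 1"] by simp
    qed
    ultimately show ?thesis by simp
  qed
  have "summable a"
  proof (rule summableI_nonneg_bounded)
    let ?b = "\<lambda>n. (c (2 * n) / c (2 * n + 2)) powr (1 / 4)"
    fix m
    have split: "(\<Sum>n<2 * m + 1. a n) \<le> a 0 + 2 * (\<Sum>n<m. a (2 * n + 1))" for m
    proof (induction m)
      case (Suc m)
      have "(\<Sum>n<2 * Suc m + 1. a n) = (\<Sum>n<2 * m + 1. a n) + a (2 * m + 1) + a (Suc (2 * m + 1))" by simp
      thus ?case using Suc.IH dec[of "2 * m + 1"] by simp
    qed simp
    have "(\<Sum>n<m. a n) \<le> (\<Sum>n<2 * m + 1. a n)"
      by (intro sum_mono2) (auto intro: less_imp_le a)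
    also have "\<dots> \<le> a 0 + 2 * (\<Sum>n<m. a (2 * n + 1))" by (rule split)
    also have "\<dots> \<le> a 0 + 2 * (\<Sum>n<m. ?b n)" by (intro add_left_mono mult_left_mono sum_mono odd) auto
    also have "\<dots> \<le> a 0 + 2 * suminf ?b"
      using sum_le_suminf[OF sm, of "{..<m}"] by simp
    finally show "(\<Sum>n<m. a n) \<le> a 0 + 2 * suminf ?b" .
  qed (use a less_imp_le in blast)
  from carleman_inequality[OF less_imp_le[OF a] this]
  have s: "summable (\<lambda>n. (\<Prod>k\<le>n. a k) powr (1 / real (Suc n)))" .
  have tele: "(\<Prod>k\<le>n. a k) = sqrt (c 0 / c (Suc n))" for n
  proof (induction n)
    case (Suc n)
    thus ?case using c[of "Suc n"] by (simp add: a_def real_sqrt_mult[symmetric])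
  qed (simp add: a_def)
  \<comment> \<open>the geometric means differ from the Carleman terms by the factor \<open>c 0 ^ (1 / (2n + 2))\<close>, which is at least \<open>b\<close>\<close>
  define b where "b = min 1 (c 0)"
  have b: "b > 0" "b \<le> 1" "b \<le> c 0" using c[of 0] by (auto simp: b_def)
  have le: "b * (1 / c (Suc n) powr (1 / real (2 * Suc n))) \<le> (\<Prod>k\<le>n. a k) powr (1 / real (Suc n))" for n
  proof -
    have "b = b powr 1" using b by simp
    also have "\<dots> \<le> b powr (1 / real (2 * Suc n))" using b by (intro powr_mono') (auto simp: field_simps)
    also have "\<dots> \<le> c 0 powr (1 / real (2 * Suc n))" using b by (intro powr_mono2) auto
    finally have "b * (1 / c (Suc n) powr (1 / real (2 * Suc n)))
        \<le> c 0 powr (1 / real (2 * Suc n)) * (1 / c (Suc n) powr (1 / real (2 * Suc n)))"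
      by (intro mult_right_mono) auto
    also have "\<dots> = (c 0 / c (Suc n)) powr (1 / real (2 * Suc n))"
      using c[of 0] c[of "Suc n"] by (simp add: powr_divide)
    also have "\<dots> = ((c 0 / c (Suc n)) powr (1 / 2)) powr (1 / real (Suc n))"
      by (simp add: powr_powr)
    also have "(c 0 / c (Suc n)) powr (1 / 2) = sqrt (c 0 / c (Suc n))"
      using c[of 0] c[of "Suc n"] by (intro powr_half_sqrt) auto
    finally show ?thesis by (simp add: tele)
  qed
  have "summable (\<lambda>n. b * (1 / c (Suc n) powr (1 / real (2 * Suc n))))"
    by (rule summable_comparison_test'[OF s, of 0]) (use le b in \<open>auto simp: abs_mult\<close>)
  hence "summable (\<lambda>n. 1 / c (Suc n) powr (1 / real (2 * Suc n)))"
    using b by (subst (asm) summable_cmult_iff) auto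
  with div show False by contradiction
qed

lemma cos_taylor_remainder:
  "\<bar>cos (x + h) - (\<Sum>j<m. cos (x + real j * (pi / 2)) / fact j * h ^ j)\<bar> \<le> \<bar>h\<bar> ^ m / fact m"
proof -
  define diff where "diff j u = cos (u + x + real j * (pi / 2))" for j u
  have "\<exists>u. \<bar>u\<bar> \<le> \<bar>h\<bar> \<and> cos (h + x) = (\<Sum>j<m. (diff j 0 / fact j) * h ^ j) + (diff m u / fact m) * h ^ m"
  proof (rule Maclaurin_all_le)
    show "diff 0 = (\<lambda>u. cos (u + x))" by (simp add: diff_def fun_eq_iff)
    have sh: "cos (u + x + real (Suc j) * (pi / 2)) = - sin (u + x + real j * (pi / 2))" for u j
    proof -
      have "u + x + real (Suc j) * (pi / 2) = (u + x + real j * (pi / 2)) + pi / 2"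
        by (simp add: algebra_simps)
      thus ?thesis by (simp only: cos_add) simp
    qed
    show "\<forall>j u. DERIV (diff j) u :> diff (Suc j) u"
      unfolding diff_def[abs_def] sh by (auto intro!: derivative_eq_intros)
  qed
  then obtain u where "cos (h + x) = (\<Sum>j<m. (diff j 0 / fact j) * h ^ j) + (diff m u / fact m) * h ^ m"
    by blast
  hence "cos (x + h) - (\<Sum>j<m. cos (x + real j * (pi / 2)) / fact j * h ^ j) = diff m u / fact m * h ^ m"
    by (simp add: diff_def add.commute)
  moreover have "\<bar>diff m u / fact m * h ^ m\<bar> \<le> 1 / fact m * \<bar>h\<bar> ^ m"
    unfolding abs_mult power_abs abs_divide
    by (intro mult_mono divide_mono) (auto simp: diff_def)
  ultimately show ?thesis by simp
qed

lemma cos_power_gaussian: "(\<lambda>k. cos (x / sqrt (real (Suc k))) ^ Suc k) \<longlonglongrightarrow> exp (- x\<^sup>2 / 2)"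
proof -
  have "(\<lambda>k. cos (x / sqrt (real k)) ^ k) \<longlonglongrightarrow> exp (- x\<^sup>2 / 2)"
    by (rule tendsto_eq_rhs, real_asymp) (simp add: power2_eq_square)
  thus ?thesis by (rule LIMSEQ_Suc)
qed

section \<open>Polynomial approximation in weighted square mean\<close>

lemma integral_Cauchy_Schwarz:
  fixes f g :: "'a \<Rightarrow> real"
  assumes "integrable M (\<lambda>x. (f x)\<^sup>2)" "integrable M (\<lambda>x. (g x)\<^sup>2)" "integrable M (\<lambda>x. f x * g x)"
  shows "(\<integral>x. f x * g x \<partial>M)\<^sup>2 \<le> (\<integral>x. (f x)\<^sup>2 \<partial>M) * (\<integral>x. (g x)\<^sup>2 \<partial>M)"
proof -
  let ?A = "\<integral>x. (f x)\<^sup>2 \<partial>M" and ?B = "\<integral>x. f x * g x \<partial>M" and ?C = "\<integral>x. (g x)\<^sup>2 \<partial>M"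
  have q: "0 \<le> ?A + 2 * t * ?B + t\<^sup>2 * ?C" for t
  proof -
    have "0 \<le> (\<integral>x. (f x + t * g x)\<^sup>2 \<partial>M)" by (rule Bochner_Integration.integral_nonneg) simp
    also have "(\<lambda>x. (f x + t * g x)\<^sup>2) = (\<lambda>x. (f x)\<^sup>2 + 2 * t * (f x * g x) + t\<^sup>2 * (g x)\<^sup>2)"
      by (auto simp: fun_eq_iff power2_eq_square algebra_simps)
    finally show ?thesis using assms by simp
  qed
  have C: "?C \<ge> 0" by (rule Bochner_Integration.integral_nonneg) simp
  show ?thesis
  proof (cases "?C = 0")
    case True
    have "?B = 0"
    proof (rule ccontr)
      assume "?B \<noteq> 0"
      with q[of "- (?A + 1) / (2 * ?B)"] True show False by (simp add: field_simps)
    qed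
    thus ?thesis using True by simp
  next
    case False
    hence pos: "?C > 0" using C by linarith
    have "0 \<le> ?C * (?A + 2 * (- ?B / ?C) * ?B + (- ?B / ?C)\<^sup>2 * ?C)"
      by (rule mult_nonneg_nonneg[OF C q])
    also have "\<dots> = ?A * ?C - ?B\<^sup>2" using pos by (simp add: field_simps power2_eq_square)
    finally show ?thesis by simp
  qed
qed

abbreviation pev :: "'m::finite rpoly \<Rightarrow> real ^ 'm \<Rightarrow> real" where
  "pev h y \<equiv> poly_eval h (($) y)"

lemma continuous_on_pev: "continuous_on S (pev h)"
  by (intro continuous_on_poly_eval continuous_intros)

lemma borel_measurable_pev [measurable]: "pev h \<in> borel_measurable borel"
  by (intro borel_measurable_continuous_onI continuous_on_pev)

text \<open>
  A class of functions that is closed under products and on which all integrals exist.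
\<close>

definition tame :: "(real ^ 'm::finite \<Rightarrow> real) \<Rightarrow> bool" where
  "tame f \<longleftrightarrow> f \<in> borel_measurable borel \<and> (\<exists>h. \<forall>y. \<bar>f y\<bar> \<le> pev h y)"

lemma tame_pev: "tame (pev h)"
  unfolding tame_def
proof (intro conjI borel_measurable_pev exI allI)
  fix y :: "real ^ 'a"
  have "0 \<le> (\<bar>pev h y\<bar> - 1)\<^sup>2" "0 \<le> \<bar>pev h y\<bar>" by simp_all
  hence "\<bar>pev h y\<bar> \<le> 1 + \<bar>pev h y\<bar>\<^sup>2" by (auto simp: power2_eq_square algebra_simps)
  thus "\<bar>pev h y\<bar> \<le> pev (1 + h\<^sup>2) y" by (simp add: poly_eval_hom)
qed

lemma tame_add: "tame f \<Longrightarrow> tame g \<Longrightarrow> tame (\<lambda>y. f y + g y)"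
  unfolding tame_def
proof (elim conjE exE, intro conjI borel_measurable_add exI allI)
  fix p q y assume "\<forall>y. \<bar>f y\<bar> \<le> pev p y" "\<forall>y. \<bar>g y\<bar> \<le> pev q y"
  thus "\<bar>f y + g y\<bar> \<le> pev (p + q) y"
    by (simp add: poly_eval_hom) (meson abs_triangle_ineq add_mono order_trans)
qed

lemma tame_mult: "tame f \<Longrightarrow> tame g \<Longrightarrow> tame (\<lambda>y. f y * g y)"
  unfolding tame_def
proof (elim conjE exE, intro conjI borel_measurable_times exI allI)
  fix p q y assume "\<forall>y. \<bar>f y\<bar> \<le> pev p y" "\<forall>y. \<bar>g y\<bar> \<le> pev q y"
  hence "\<bar>f y\<bar> * \<bar>g y\<bar> \<le> pev p y * pev q y"
    by (intro mult_mono) (auto intro: order_trans[OF abs_ge_zero])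
  thus "\<bar>f y * g y\<bar> \<le> pev (p * q) y" by (simp add: poly_eval_hom abs_mult)
qed

lemma tame_bounded: "f \<in> borel_measurable borel \<Longrightarrow> (\<And>y. \<bar>f y\<bar> \<le> B) \<Longrightarrow> tame f"
  unfolding tame_def by (auto intro!: exI[of _ "Const B"])

lemma tame_const: "tame (\<lambda>_. c)"
  by (rule tame_bounded[of _ "\<bar>c\<bar>"]) auto

lemma tame_cmult: "tame f \<Longrightarrow> tame (\<lambda>y. c * f y)"
  by (intro tame_mult tame_const)

lemma tame_diff: "tame f \<Longrightarrow> tame g \<Longrightarrow> tame (\<lambda>y. f y - g y)"
  using tame_add[of f "\<lambda>y. -1 * g y"] tame_cmult[of g "-1"] by simp

lemma tame_power: "tame f \<Longrightarrow> tame (\<lambda>y. f y ^ n)"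
  by (induction n) (auto intro: tame_const tame_mult)

lemma tame_sum: "(\<And>i. i \<in> I \<Longrightarrow> tame (f i)) \<Longrightarrow> tame (\<lambda>y. \<Sum>i\<in>I. f i y)"
  by (induction I rule: infinite_finite_induct) (auto intro: tame_const tame_add)

lemma tame_coord: "tame (\<lambda>y. y $ j)"
  using tame_pev[of "Var j"] by simp

lemma tame_abs: "tame f \<Longrightarrow> tame (\<lambda>y. \<bar>f y\<bar>)"
  unfolding tame_def by auto

lemma borel_measurable_cos_coord: "(\<lambda>y :: real ^ 'm::finite. cos (t * y $ j + s)) \<in> borel_measurable borel"
  by (intro borel_measurable_continuous_onI continuous_intros)

lemma tame_cos: "tame (\<lambda>y. cos (t * y $ j + s))"
  by (rule tame_bounded[OF borel_measurable_cos_coord, of _ _ _ 1]) simp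

lemmas tame_intros = tame_pev tame_add tame_mult tame_const tame_diff tame_power tame_sum tame_coord
  tame_abs tame_cos

text \<open>
  Approximation takes place in the square mean with respect to \<open>W \<mu>\<close>. The weight is a parameter because
  in the end \<open>\<integral> f\<^sup>2 h d\<mu>\<close> has to depend continuously on \<open>f\<close>, which holds for \<open>W = 1 + h\<^sup>2\<close>.
\<close>

locale weighted_moments =
  fixes \<mu> :: "(real ^ 'm::finite) measure" and W :: "'m rpoly"
  assumes sets_mu: "sets \<mu> = sets borel"
    and integrable_pev: "\<And>h :: 'm rpoly. integrable \<mu> (pev h)"
    and W_nonneg: "\<And>y. pev W y \<ge> 0"
begin

lemma tame_integrable: assumes "tame f" shows "integrable \<mu> f"
proof -
  obtain h where h: "\<And>y. \<bar>f y\<bar> \<le> pev h y" and m: "f \<in> borel_measurable borel"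
    using assms unfolding tame_def by blast
  have "f \<in> borel_measurable \<mu>" using m by (simp add: measurable_cong_sets[OF sets_mu refl])
  thus ?thesis
    by (rule Bochner_Integration.integrable_bound[OF integrable_pev[of h]])
       (auto intro!: always_eventually order_trans[OF h abs_ge_self])
qed

definition nrm :: "(real ^ 'm \<Rightarrow> real) \<Rightarrow> real" where
  "nrm f = sqrt (\<integral>y. (f y)\<^sup>2 * pev W y \<partial>\<mu>)"

lemma nrm_sq: "(nrm f)\<^sup>2 = (\<integral>y. (f y)\<^sup>2 * pev W y \<partial>\<mu>)"
  unfolding nrm_def by (simp add: W_nonneg)

lemma nrm_nonneg: "nrm f \<ge> 0"
  unfolding nrm_def by (simp add: W_nonneg)

lemma weighted_Cauchy_Schwarz:
  assumes "tame f" "tame g"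
  shows "\<bar>\<integral>y. f y * g y * pev W y \<partial>\<mu>\<bar> \<le> nrm f * nrm g"
proof -
  have s: "(u * sqrt (pev W y))\<^sup>2 = u\<^sup>2 * pev W y"
    "(u * sqrt (pev W y)) * (v * sqrt (pev W y)) = u * v * pev W y" for u v y
    using W_nonneg[of y] by (simp_all add: power_mult_distrib mult_ac)
  have "(\<integral>y. (f y * sqrt (pev W y)) * (g y * sqrt (pev W y)) \<partial>\<mu>)\<^sup>2
      \<le> (\<integral>y. (f y * sqrt (pev W y))\<^sup>2 \<partial>\<mu>) * (\<integral>y. (g y * sqrt (pev W y))\<^sup>2 \<partial>\<mu>)"
    unfolding s by (intro integral_Cauchy_Schwarz[where f = "\<lambda>y. f y * sqrt (pev W y)" and
          g = "\<lambda>y. g y * sqrt (pev W y)", unfolded s] tame_integrable tame_intros assms)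
  hence "(\<integral>y. f y * g y * pev W y \<partial>\<mu>)\<^sup>2 \<le> (nrm f * nrm g)\<^sup>2"
    unfolding s by (simp add: power_mult_distrib nrm_sq)
  hence "\<bar>\<integral>y. f y * g y * pev W y \<partial>\<mu>\<bar> \<le> \<bar>nrm f * nrm g\<bar>" by (simp only: abs_le_square_iff)
  thus ?thesis by (simp add: abs_mult nrm_nonneg)
qed

lemma nrm_triangle:
  assumes "tame f" "tame g"
  shows "nrm (\<lambda>y. f y + g y) \<le> nrm f + nrm g"
proof -
  have "(nrm (\<lambda>y. f y + g y))\<^sup>2
      = (\<integral>y. (f y)\<^sup>2 * pev W y + 2 * (f y * g y * pev W y) + (g y)\<^sup>2 * pev W y \<partial>\<mu>)"
    unfolding nrm_sq by (intro Bochner_Integration.integral_cong) (auto simp: power2_eq_square algebra_simps)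
  also have "\<dots> = (nrm f)\<^sup>2 + 2 * (\<integral>y. f y * g y * pev W y \<partial>\<mu>) + (nrm g)\<^sup>2"
  proof -
    have "integrable \<mu> (\<lambda>y. (f y)\<^sup>2 * pev W y)" "integrable \<mu> (\<lambda>y. f y * g y * pev W y)"
      "integrable \<mu> (\<lambda>y. (g y)\<^sup>2 * pev W y)"
      by (intro tame_integrable tame_intros assms)+
    thus ?thesis by (simp add: nrm_sq)
  qed
  also have "\<dots> \<le> (nrm f)\<^sup>2 + 2 * (nrm f * nrm g) + (nrm g)\<^sup>2"
    using weighted_Cauchy_Schwarz[OF assms] by simp
  also have "\<dots> = (nrm f + nrm g)\<^sup>2" by (simp add: power2_eq_square algebra_simps)
  finally show ?thesis by (rule power2_le_imp_le) (simp add: nrm_nonneg)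
qed

lemma nrm_cmult: "nrm (\<lambda>y. c * f y) = \<bar>c\<bar> * nrm f"
proof -
  have "(\<integral>y. (c * f y)\<^sup>2 * pev W y \<partial>\<mu>) = c\<^sup>2 * (\<integral>y. (f y)\<^sup>2 * pev W y \<partial>\<mu>)"
    by (simp add: power_mult_distrib mult.assoc)
  thus ?thesis by (simp add: nrm_def real_sqrt_mult)
qed

lemma nrm_mono:
  assumes "tame f" "tame g" "\<And>y. \<bar>f y\<bar> \<le> \<bar>g y\<bar>"
  shows "nrm f \<le> nrm g"
  unfolding nrm_def
proof (intro real_sqrt_le_mono integral_mono mult_right_mono W_nonneg)
  show "(f y)\<^sup>2 \<le> (g y)\<^sup>2" for y using assms(3)[of y] by (simp only: abs_le_square_iff)
qed (intro tame_integrable tame_intros assms)+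

definition pdist :: "(real ^ 'm \<Rightarrow> real) \<Rightarrow> real" where
  "pdist f = (INF p. nrm (\<lambda>y. f y - pev p y))"

lemma pdist_le: "pdist f \<le> nrm (\<lambda>y. f y - pev p y)"
  unfolding pdist_def by (rule cINF_lower) (auto intro!: bdd_belowI2[of _ 0] nrm_nonneg)

lemma pdist_nonneg: "pdist f \<ge> 0"
  unfolding pdist_def by (rule cINF_greatest) (auto intro: nrm_nonneg)

lemma pdist_le_nrm: "pdist f \<le> nrm f"
  using pdist_le[of f 0] by simp

lemma pdist_approx: "pdist f < e \<Longrightarrow> \<exists>p. nrm (\<lambda>y. f y - pev p y) < e"
  unfolding pdist_def
  by (subst (asm) cINF_less_iff) (auto intro!: bdd_belowI2[of _ 0] nrm_nonneg)

lemma pdist_pev: "pdist (pev p) = 0"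
  using pdist_le[of "pev p" p] pdist_nonneg[of "pev p"] by (simp add: nrm_def)

lemma pdist_add:
  assumes "tame f" "tame g"
  shows "pdist (\<lambda>y. f y + g y) \<le> pdist f + pdist g"
proof (rule field_le_epsilon)
  fix e :: real assume e: "e > 0"
  obtain p where p: "nrm (\<lambda>y. f y - pev p y) < pdist f + e / 2" using pdist_approx[of f "pdist f + e / 2"] e by auto
  obtain q where q: "nrm (\<lambda>y. g y - pev q y) < pdist g + e / 2" using pdist_approx[of g "pdist g + e / 2"] e by auto
  have "pdist (\<lambda>y. f y + g y) \<le> nrm (\<lambda>y. f y + g y - pev (p + q) y)" by (rule pdist_le)
  also have "\<dots> = nrm (\<lambda>y. (f y - pev p y) + (g y - pev q y))" by (simp add: poly_eval_hom algebra_simps)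
  also have "\<dots> \<le> nrm (\<lambda>y. f y - pev p y) + nrm (\<lambda>y. g y - pev q y)"
    by (intro nrm_triangle tame_intros assms)
  finally show "pdist (\<lambda>y. f y + g y) \<le> pdist f + pdist g + e" using p q by simp
qed

lemma pdist_cmult: "pdist (\<lambda>y. c * f y) \<le> \<bar>c\<bar> * pdist f"
proof (cases "c = 0")
  case True
  thus ?thesis using pdist_pev[of 0] by simp
next
  case False
  have "pdist (\<lambda>y. c * f y) / \<bar>c\<bar> \<le> pdist f"
    unfolding pdist_def[of f]
  proof (rule cINF_greatest)
    fix p
    have "pdist (\<lambda>y. c * f y) \<le> nrm (\<lambda>y. c * f y - pev (Const c * p) y)" by (rule pdist_le)
    also have "\<dots> = \<bar>c\<bar> * nrm (\<lambda>y. f y - pev p y)"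
      by (simp add: poly_eval_hom flip: nrm_cmult right_diff_distrib)
    finally show "pdist (\<lambda>y. c * f y) / \<bar>c\<bar> \<le> nrm (\<lambda>y. f y - pev p y)"
      using False by (simp add: field_simps)
  qed simp
  thus ?thesis using False by (simp add: field_simps)
qed

lemma pdist_sum:
  assumes "\<And>i. i \<in> I \<Longrightarrow> tame (f i)"
  shows "pdist (\<lambda>y. \<Sum>i\<in>I. f i y) \<le> (\<Sum>i\<in>I. pdist (f i))"
  using assms
proof (induction I rule: infinite_finite_induct)
  case (insert i I)
  have "pdist (\<lambda>y. f i y + (\<Sum>i\<in>I. f i y)) \<le> pdist (f i) + pdist (\<lambda>y. \<Sum>i\<in>I. f i y)"
    using insert.prems by (intro pdist_add tame_intros) auto
  thus ?case using insert by simp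
qed (use pdist_pev[of 0] in simp_all)

definition moment :: "'m \<Rightarrow> nat \<Rightarrow> real" where
  "moment j n = (\<integral>y. (y $ j) ^ (2 * n) \<partial>\<mu>)"

lemma moment_nonneg: "moment j n \<ge> 0"
  unfolding moment_def by (intro Bochner_Integration.integral_nonneg) (rule zero_le_even_power, simp)

lemma coord_power_Cauchy_Schwarz:
  "(\<integral>y. (y $ j) ^ (a + b) \<partial>\<mu>)\<^sup>2 \<le> (\<integral>y. (y $ j) ^ (a * 2) \<partial>\<mu>) * (\<integral>y. (y $ j) ^ (b * 2) \<partial>\<mu>)"
  unfolding power_add power_mult by (intro integral_Cauchy_Schwarz tame_integrable tame_intros)

lemma moment_Cauchy_Schwarz: "(moment j (n + k))\<^sup>2 \<le> moment j (2 * n) * moment j (2 * k)"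
proof -
  have "2 * n + 2 * k = 2 * (n + k)" "2 * n * 2 = 2 * (2 * n)" "2 * k * 2 = 2 * (2 * k)" by simp_all
  with coord_power_Cauchy_Schwarz[of j "2 * n" "2 * k"] show ?thesis unfolding moment_def by metis
qed

lemma moment_log_convex: "(moment j (Suc n))\<^sup>2 \<le> moment j n * moment j (Suc (Suc n))"
proof -
  have "n + (n + 2) = 2 * Suc n" "n * 2 = 2 * n" "(n + 2) * 2 = 2 * Suc (Suc n)" by simp_all
  with coord_power_Cauchy_Schwarz[of j n "n + 2"] show ?thesis unfolding moment_def by metis
qed

text \<open>
  Such functions can be approximated even after multiplication by an arbitrary polynomial, which is
  the form of the statement that passes from one cosine factor to the next.
\<close>

definition multiplier :: "(real ^ 'm \<Rightarrow> real) \<Rightarrow> bool" where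
  "multiplier w \<longleftrightarrow> tame w \<and> (\<forall>p. pdist (\<lambda>y. pev p y * w y) \<le> 0)"

text \<open>
  By the Cauchy--Schwarz inequality the square of the left-hand side is bounded by the square root of
  \<open>\<integral> (w\<^sup>2 W)\<^sup>2\<close> times that of the moment of order \<open>4n\<close>. So the Carleman condition is required for
  \<open>\<mu>\<close> only, not for the weighted measure.
\<close>

lemma nrm_moment_bound:
  assumes "tame w"
  shows "\<exists>K>0. \<forall>n. nrm (\<lambda>y. w y * (y $ j) ^ n) \<le> K * moment j (2 * n) powr (1 / 4)"
proof -
  define A where "A = (\<integral>y. ((w y)\<^sup>2 * pev W y)\<^sup>2 \<partial>\<mu>)"
  have A: "A \<ge> 0" unfolding A_def by (rule Bochner_Integration.integral_nonneg) simp
  have "nrm (\<lambda>y. w y * (y $ j) ^ n) \<le> (A powr (1 / 4) + 1) * moment j (2 * n) powr (1 / 4)" for n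
  proof -
    let ?m = "moment j (2 * n)"
    have pw: "((y $ j) ^ k)\<^sup>2 = (y $ j) ^ (2 * k)" for y :: "real ^ 'm" and k
      unfolding power_mult[symmetric] by (rule arg_cong[where f = "power _"]) simp
    have "((nrm (\<lambda>y. w y * (y $ j) ^ n))\<^sup>2)\<^sup>2 = (\<integral>y. ((w y)\<^sup>2 * pev W y) * (y $ j) ^ (2 * n) \<partial>\<mu>)\<^sup>2"
      unfolding nrm_sq by (simp add: power_mult_distrib pw mult_ac)
    also have "\<dots> \<le> A * (\<integral>y. ((y $ j) ^ (2 * n))\<^sup>2 \<partial>\<mu>)"
      unfolding A_def by (intro integral_Cauchy_Schwarz tame_integrable tame_intros assms)
    also have "(\<integral>y. ((y $ j) ^ (2 * n))\<^sup>2 \<partial>\<mu>) = ?m" unfolding pw moment_def by simp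
    finally have "(nrm (\<lambda>y. w y * (y $ j) ^ n)) ^ 4 \<le> A * ?m" by (simp add: power_mult[symmetric])
    also have "\<dots> = (A powr (1 / 4) * ?m powr (1 / 4)) ^ 4"
    proof -
      have "(x powr (1 / 4)) ^ 4 = x" if "x \<ge> 0" for x :: real
        using that by (cases "x = 0") (auto simp: powr_powr simp flip: powr_numeral)
      thus ?thesis using A moment_nonneg[of j "2 * n"] by (simp add: power_mult_distrib)
    qed
    finally have "nrm (\<lambda>y. w y * (y $ j) ^ n) \<le> A powr (1 / 4) * ?m powr (1 / 4)"
      by (subst (asm) power_mono_iff) (auto simp: nrm_nonneg)
    also have "\<dots> \<le> (A powr (1 / 4) + 1) * ?m powr (1 / 4)" by (intro mult_right_mono) auto
    finally show ?thesis .
  qed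
  moreover have "A powr (1 / 4) + 1 > 0" by (simp add: add_nonneg_pos)
  ultimately show ?thesis by blast
qed

text \<open>
  Taylor's formula is applied pointwise to the cosine, and the triangle inequality for the distance
  to the polynomials turns it into the estimate required by \<open>bang_vanishing\<close>.
\<close>

lemma pdist_taylor:
  fixes j :: 'm
  assumes w: "tame w"
  defines "N \<equiv> \<lambda>k s t. pdist (\<lambda>y. w y * (y $ j) ^ k * cos (t * y $ j + s))"
  shows "N k s (t + h) \<le> (\<Sum>i<m. \<bar>h\<bar> ^ i / fact i * N (k + i) (s + real i * (pi / 2)) t)
    + \<bar>h\<bar> ^ m / fact m * nrm (\<lambda>y. w y * (y $ j) ^ (k + m))"
proof -
  define f where "f i y = w y * (y $ j) ^ (k + i) * cos (t * y $ j + (s + real i * (pi / 2)))" for i y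
  define g where "g y = (\<Sum>i<m. (h ^ i / fact i) * f i y)" for y
  \<comment> \<open>the remainder; the Taylor polynomial \<open>g\<close> is taken in the variable \<open>t\<close> for fixed \<open>y\<close>\<close>
  define R where "R y = w y * (y $ j) ^ k * cos ((t + h) * y $ j + s) - g y" for y
  have tf: "tame (f i)" for i unfolding f_def by (intro tame_intros w)
  have tg: "tame g" unfolding g_def by (intro tame_intros tf)
  have tR: "tame R" unfolding R_def by (intro tame_intros w tg)
  have R: "\<bar>R y\<bar> \<le> \<bar>\<bar>h\<bar> ^ m / fact m * (w y * (y $ j) ^ (k + m))\<bar>" for y
  proof -
    let ?x = "t * y $ j + s" and ?h = "h * y $ j"
    have "g y = w y * (y $ j) ^ k * (\<Sum>i<m. cos (?x + real i * (pi / 2)) / fact i * ?h ^ i)"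
      unfolding g_def f_def sum_distrib_left
      by (intro sum.cong refl) (simp add: power_add power_mult_distrib add.assoc)
    moreover have "(t + h) * y $ j + s = ?x + ?h" by (simp add: algebra_simps)
    ultimately have "R y = w y * (y $ j) ^ k * (cos (?x + ?h) - (\<Sum>i<m. cos (?x + real i * (pi / 2)) / fact i * ?h ^ i))"
      by (simp only: R_def right_diff_distrib)
    hence "\<bar>R y\<bar> \<le> \<bar>w y * (y $ j) ^ k\<bar> * (\<bar>?h\<bar> ^ m / fact m)"
      by (simp only: abs_mult[of "w y * (y $ j) ^ k"]) (intro mult_left_mono cos_taylor_remainder abs_ge_zero)
    thus ?thesis by (simp add: abs_mult power_abs power_add power_mult_distrib mult_ac)
  qed
  have "N k s (t + h) = pdist (\<lambda>y. g y + R y)" by (simp add: N_def R_def)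
  also have "\<dots> \<le> pdist g + pdist R" by (intro pdist_add tg tR)
  also have "pdist g \<le> (\<Sum>i<m. pdist (\<lambda>y. (h ^ i / fact i) * f i y))"
    unfolding g_def[abs_def] by (intro pdist_sum tame_cmult tf)
  also have "\<dots> \<le> (\<Sum>i<m. \<bar>h ^ i / fact i\<bar> * pdist (f i))" by (intro sum_mono pdist_cmult)
  also have "\<dots> = (\<Sum>i<m. \<bar>h\<bar> ^ i / fact i * N (k + i) (s + real i * (pi / 2)) t)"
    by (simp add: N_def f_def[abs_def] power_abs)
  also have "pdist R \<le> nrm R" by (rule pdist_le_nrm)
  also have "\<dots> \<le> nrm (\<lambda>y. \<bar>h\<bar> ^ m / fact m * (w y * (y $ j) ^ (k + m)))"
    by (intro nrm_mono tR R tame_intros w)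
  also have "\<dots> = \<bar>h\<bar> ^ m / fact m * nrm (\<lambda>y. w y * (y $ j) ^ (k + m))"
    by (subst nrm_cmult) simp
  finally show ?thesis by simp
qed

text \<open>
  The functions \<open>w y\<^sub>j\<^sup>k cos s\<close> being approximable by polynomials is flatness at \<open>t = 0\<close> in
  \<open>bang_vanishing\<close>. If some moment vanishes, so do the bounds of large order, and a single Taylor
  expansion at \<open>0\<close> suffices.
\<close>

lemma pdist_cos_step:
  assumes w: "tame w" and poly: "\<And>n. pdist (\<lambda>y. w y * (y $ j) ^ n) \<le> 0"
    and carl: "(\<And>n. moment j n > 0) \<Longrightarrow> \<not> summable (\<lambda>n. 1 / moment j (Suc n) powr (1 / real (2 * Suc n)))"
  shows "pdist (\<lambda>y. w y * cos (t * y $ j + s)) \<le> 0"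
proof -
  define N where "N k s t = pdist (\<lambda>y. w y * (y $ j) ^ k * cos (t * y $ j + s))" for k s t
  obtain K where K: "K > 0" "\<And>n. nrm (\<lambda>y. w y * (y $ j) ^ n) \<le> K * moment j (2 * n) powr (1 / 4)"
    using nrm_moment_bound[OF w, of j] by blast
  define M where "M n = K * moment j (2 * n) powr (1 / 4)" for n
  have taylor: "N k s (t + h) \<le> (\<Sum>i<m. \<bar>h\<bar> ^ i / fact i * N (k + i) (s + real i * (pi / 2)) t)
      + \<bar>h\<bar> ^ m / fact m * M (k + m)" for k m s t h
  proof -
    have "\<bar>h\<bar> ^ m / fact m * nrm (\<lambda>y. w y * (y $ j) ^ (k + m)) \<le> \<bar>h\<bar> ^ m / fact m * M (k + m)"
      unfolding M_def by (intro mult_left_mono K) auto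
    with pdist_taylor[OF w, where j = j and k = k and s = s and t = t and h = h and m = m] show ?thesis unfolding N_def by linarith
  qed
  have zero: "N k s 0 \<le> 0" for k s
  proof -
    have "N k s 0 = pdist (\<lambda>y. cos s * (w y * (y $ j) ^ k))" by (simp add: N_def mult_ac)
    also have "\<dots> \<le> \<bar>cos s\<bar> * pdist (\<lambda>y. w y * (y $ j) ^ k)" by (rule pdist_cmult)
    also have "\<dots> \<le> \<bar>cos s\<bar> * 0" by (intro mult_left_mono poly) auto
    finally show ?thesis by simp
  qed
  have "N 0 s t \<le> 0"
  proof (cases "\<exists>n. moment j (2 * n) = 0")
    case True
    then obtain n where n: "moment j (2 * n) = 0" by blast
    have "N 0 s (0 + t) \<le> (\<Sum>i<n. \<bar>t\<bar> ^ i / fact i * N (0 + i) (s + real i * (pi / 2)) 0)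
        + \<bar>t\<bar> ^ n / fact n * M (0 + n)" by (rule taylor)
    also have "\<dots> \<le> (\<Sum>i<n. \<bar>t\<bar> ^ i / fact i * 0) + 0"
      using n by (intro add_mono sum_mono mult_left_mono zero) (auto simp: M_def)
    finally show ?thesis by simp
  next
    case False
    have pos: "moment j n > 0" for n
    proof -
      have "moment j (2 * n) > 0" for n using False moment_nonneg[of j "2 * n"] by (metis less_eq_real_def)
      moreover have "(moment j (n + 1))\<^sup>2 \<le> moment j n * moment j (n + 2)" for n
        using moment_log_convex[of j n] by simp
      moreover have "moment j n \<noteq> 0"
      proof
        assume z: "moment j n = 0"
        have "moment j (n + k) = 0" for k
        proof (induction k)
          case (Suc k)
          with moment_log_convex[of j "n + k"] show ?case by simp
        qed (simp add: z)
        from this[of n] False show False by (metis mult_2)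
      qed
      ultimately show ?thesis using moment_nonneg[of j n] by simp
    qed
    show ?thesis
    proof (rule bang_vanishing[where N = N and M = M, OF _ _ _ taylor zero])
      show Mpos: "M n > 0" for n using pos[of "2 * n"] K by (simp add: M_def)
      show "N k s t \<le> M k" for k s t
      proof -
        have "N k s t \<le> nrm (\<lambda>y. w y * (y $ j) ^ k * cos (t * y $ j + s))"
          unfolding N_def by (rule pdist_le_nrm)
        also have "\<dots> \<le> nrm (\<lambda>y. w y * (y $ j) ^ k)"
          by (intro nrm_mono tame_intros w) (simp add: abs_mult mult_left_le)
        also have "\<dots> \<le> M k" unfolding M_def by (rule K)
        finally show ?thesis .
      qed
      have q: "M n / M (Suc n) = (moment j (2 * n) / moment j (2 * n + 2)) powr (1 / 4)" for n
        using K pos[of "2 * n"] pos[of "2 * n + 2"] by (simp add: M_def powr_divide)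
      show "M (Suc n) / M n \<le> M (Suc (Suc n)) / M (Suc n)" for n
      proof -
        have "(moment j (2 * n + 2))\<^sup>2 \<le> moment j (2 * n) * moment j (2 * n + 4)"
        proof -
          have "n + (n + 2) = 2 * n + 2" "2 * (n + 2) = 2 * n + 4" by simp_all
          with moment_Cauchy_Schwarz[of j n "n + 2"] show ?thesis by metis
        qed
        hence "moment j (2 * Suc n) / moment j (2 * Suc n + 2) \<le> moment j (2 * n) / moment j (2 * n + 2)"
          using pos[of "2 * n + 2"] pos[of "2 * n + 4"]
          by (simp add: divide_simps power2_eq_square mult_ac numeral_eq_Suc)
        hence "M (Suc n) / M (Suc (Suc n)) \<le> M n / M (Suc n)"
          unfolding q using pos[of "2 * Suc n"] pos[of "2 * Suc n + 2"] by (intro powr_mono2) (auto intro: less_imp_le divide_nonneg_pos)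
        thus ?thesis using Mpos[of n] Mpos[of "Suc n"] Mpos[of "Suc (Suc n)"] by (simp add: field_simps)
      qed
      show "\<not> summable (\<lambda>n. M n / M (Suc n))"
        unfolding q by (rule carleman_ratio_divergence[OF pos moment_log_convex carl[OF pos]])
    qed
  qed
  thus ?thesis by (simp add: N_def)
qed

end

text \<open>
  The divergence is only stipulated when all even moments in direction \<open>j\<close> are positive, so that
  the reciprocals are meaningful real numbers.
\<close>

locale carleman_moments = weighted_moments \<mu> W
  for \<mu> :: "(real ^ 'm::finite) measure" and W :: "'m rpoly" +
  assumes carleman: "\<And>j. (\<And>n. moment j n > 0) \<Longrightarrow>
    \<not> summable (\<lambda>n. 1 / moment j (Suc n) powr (1 / real (2 * Suc n)))"
begin

lemma multiplier_one: "multiplier (\<lambda>_. 1)"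
  unfolding multiplier_def by (simp add: tame_const pdist_pev)

lemma multiplier_cos:
  assumes "multiplier w"
  shows "multiplier (\<lambda>y. w y * cos (t * y $ j + s))"
  unfolding multiplier_def
proof (intro conjI allI)
  have w: "tame w" using assms by (simp add: multiplier_def)
  thus "tame (\<lambda>y. w y * cos (t * y $ j + s))" by (intro tame_intros)
  fix p
  have "pdist (\<lambda>y. (pev p y * w y) * cos (t * y $ j + s)) \<le> 0"
  proof (rule pdist_cos_step)
    show "tame (\<lambda>y. pev p y * w y)" by (intro tame_intros w)
    fix n
    have "pdist (\<lambda>y. pev (p * Var j ^ n) y * w y) \<le> 0" using assms by (simp add: multiplier_def)
    thus "pdist (\<lambda>y. pev p y * w y * (y $ j) ^ n) \<le> 0" by (simp add: poly_eval_hom mult_ac)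
  qed (rule carleman)
  thus "pdist (\<lambda>y. pev p y * (w y * cos (t * y $ j + s))) \<le> 0" by (simp add: mult.assoc)
qed

lemma multiplier_cos_power:
  assumes "multiplier w"
  shows "multiplier (\<lambda>y. w y * cos (t * y $ j + s) ^ k)"
proof (induction k)
  case (Suc k)
  from multiplier_cos[OF this, of t j s] show ?case by (simp add: mult_ac)
qed (simp add: assms)

lemma multiplier_cos_prod:
  "finite J \<Longrightarrow> multiplier (\<lambda>y. \<Prod>j\<in>J. cos (t * y $ j + s j) ^ k)"
proof (induction J rule: finite_induct)
  case (insert j J)
  from multiplier_cos_power[OF insert.IH, of t j "s j" k] insert.hyps show ?case by (simp add: mult_ac)
qed (simp add: multiplier_one)

text \<open>
  A Gaussian is the pointwise limit of the bounded products of \<open>cos(u\<^sub>j / \<surd>k)\<^sup>k\<close> with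
  \<open>u = r (y - z)\<close>, and the convergence is dominated.
\<close>

lemma pdist_gaussian:
  fixes z :: "real ^ 'm"
  shows "pdist (\<lambda>y. \<Prod>j\<in>UNIV. exp (- (r * (y $ j - z $ j))\<^sup>2 / 2)) = 0"
proof -
  define g where "g y = (\<Prod>j\<in>UNIV. exp (- (r * (y $ j - z $ j))\<^sup>2 / 2))" for y :: "real ^ 'm"
  define \<psi> where "\<psi> k y = (\<Prod>j\<in>UNIV. cos (r * (y $ j - z $ j) / sqrt (real (Suc k))) ^ Suc k)"
    for k and y :: "real ^ 'm"
  have g1: "\<bar>g y\<bar> \<le> 1" for y
  proof -
    have "\<bar>g y\<bar> \<le> (\<Prod>j\<in>(UNIV :: 'm set). 1)"
      unfolding g_def abs_prod by (intro prod_mono) auto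
    thus ?thesis by simp
  qed
  have psi1: "\<bar>\<psi> k y\<bar> \<le> 1" for k y
  proof -
    have "\<bar>\<psi> k y\<bar> \<le> (\<Prod>j\<in>(UNIV :: 'm set). 1)"
      unfolding \<psi>_def abs_prod power_abs by (intro prod_mono) (auto intro!: power_le_one mult_le_one)
    thus ?thesis by simp
  qed
  have tg: "tame g"
    by (rule tame_bounded[OF _ g1]) (unfold g_def, intro borel_measurable_continuous_onI continuous_intros, simp)
  have mult: "multiplier (\<psi> k)" for k
  proof -
    have "r * (y $ j - z $ j) / sqrt (real (Suc k)) = (r / sqrt (real (Suc k))) * y $ j + (- r * z $ j / sqrt (real (Suc k)))"
      for y :: "real ^ 'm" and j by (simp add: algebra_simps diff_divide_distrib)
    note eq = this
    have "finite (UNIV :: 'm set)" by simp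
    from multiplier_cos_prod[OF this, of "r / sqrt (real (Suc k))" "\<lambda>j. - r * z $ j / sqrt (real (Suc k))" "Suc k"]
    show ?thesis by (simp only: \<psi>_def[abs_def] eq)
  qed
  have tpsi: "tame (\<psi> k)" and psi0: "pdist (\<psi> k) \<le> 0" for k
    using mult[of k] unfolding multiplier_def by (auto dest: spec[of _ 1])
  have lim: "(\<lambda>k. \<psi> k y) \<longlonglongrightarrow> g y" for y
    unfolding \<psi>_def g_def by (intro tendsto_prod cos_power_gaussian)
  have "(\<lambda>k. \<integral>y. (g y - \<psi> k y)\<^sup>2 * pev W y \<partial>\<mu>) \<longlonglongrightarrow> (\<integral>y. 0 \<partial>\<mu>)"
  proof (rule integral_dominated_convergence[where w = "\<lambda>y. 4 * pev W y"])
    have meas: "f \<in> borel_measurable \<mu>" if "tame f" for f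
      using tame_integrable[OF that] by (rule borel_measurable_integrable)
    show "(\<lambda>y. (g y - \<psi> k y)\<^sup>2 * pev W y) \<in> borel_measurable \<mu>" for k
      by (intro meas tame_intros tg tpsi)
    show "integrable \<mu> (\<lambda>y. 4 * pev W y)" by (intro tame_integrable tame_intros)
    show "AE y in \<mu>. (\<lambda>k. (g y - \<psi> k y)\<^sup>2 * pev W y) \<longlonglongrightarrow> 0"
    proof (rule AE_I2)
      fix y
      have "(\<lambda>k. (g y - \<psi> k y)\<^sup>2 * pev W y) \<longlonglongrightarrow> (g y - g y)\<^sup>2 * pev W y" by (intro tendsto_intros lim)
      thus "(\<lambda>k. (g y - \<psi> k y)\<^sup>2 * pev W y) \<longlonglongrightarrow> 0" by simp
    qed
    show "AE y in \<mu>. norm ((g y - \<psi> k y)\<^sup>2 * pev W y) \<le> 4 * pev W y" for k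
    proof (rule AE_I2)
      fix y
      have "\<bar>g y - \<psi> k y\<bar> \<le> 2" using g1[of y] psi1[of k y] by linarith
      hence "\<bar>g y - \<psi> k y\<bar>\<^sup>2 \<le> 2\<^sup>2" by (intro power_mono) auto
      hence "(g y - \<psi> k y)\<^sup>2 * pev W y \<le> 4 * pev W y" using W_nonneg by (intro mult_right_mono) auto
      thus "norm ((g y - \<psi> k y)\<^sup>2 * pev W y) \<le> 4 * pev W y" using W_nonneg[of y] by simp
    qed
  qed simp
  hence "(\<lambda>k. nrm (\<lambda>y. g y - \<psi> k y)) \<longlonglongrightarrow> sqrt 0"
    unfolding nrm_def by (intro tendsto_real_sqrt) simp
  moreover have "pdist g \<le> nrm (\<lambda>y. g y - \<psi> k y)" for k
  proof -
    have "pdist (\<lambda>y. (g y - \<psi> k y) + \<psi> k y) \<le> pdist (\<lambda>y. g y - \<psi> k y) + pdist (\<psi> k)"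
      by (intro pdist_add tame_intros tg tpsi)
    thus ?thesis using psi0[of k] pdist_le_nrm[of "\<lambda>y. g y - \<psi> k y"] by simp
  qed
  ultimately have "pdist g \<le> 0" by (intro LIMSEQ_le_const) auto
  thus ?thesis using pdist_nonneg[of g] unfolding g_def by simp
qed

end

section \<open>Nonnegativity on the support from nonnegativity against squares\<close>

text \<open>
  If \<open>h(z) < 0\<close>, the integral of \<open>h\<close> against the square of a Gaussian centred at \<open>z\<close> is negative once the
  Gaussian is narrow enough, as \<open>\<mu>\<close> charges every neighbourhood of \<open>z\<close>. Replacing the Gaussian by a
  polynomial that is close to it in the mean with weight \<open>1 + h\<^sup>2 \<ge> |h|\<close> preserves the sign.
\<close>

lemma exists_square_negative:
  fixes \<mu> :: "(real ^ 'm::finite) measure" and h :: "'m rpoly"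
  assumes sets: "sets \<mu> = sets borel" and int: "\<And>p :: 'm rpoly. integrable \<mu> (pev p)"
    and carl: "\<And>j. (\<And>n. (\<integral>y. (y $ j) ^ (2 * n) \<partial>\<mu>) > 0) \<Longrightarrow>
      \<not> summable (\<lambda>n. 1 / (\<integral>y. (y $ j) ^ (2 * Suc n) \<partial>\<mu>) powr (1 / real (2 * Suc n)))"
    and supp: "\<And>U. open U \<Longrightarrow> z \<in> U \<Longrightarrow> emeasure \<mu> U > 0"
    and neg: "pev h z < 0"
  shows "\<exists>p. (\<integral>y. (pev p y)\<^sup>2 * pev h y \<partial>\<mu>) < 0"
proof -
  define W where "W = 1 + h\<^sup>2"
  have Wh: "pev W y = 1 + (pev h y)\<^sup>2" for y by (simp add: W_def poly_eval_hom)
  interpret weighted_moments \<mu> W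
    by unfold_locales (auto simp: sets int Wh)
  interpret carleman_moments \<mu> W
    by unfold_locales (use carl in \<open>simp add: moment_def\<close>)
  have hW: "\<bar>pev h y\<bar> \<le> pev W y" for y
  proof -
    have "0 \<le> (\<bar>pev h y\<bar> - 1)\<^sup>2" "0 \<le> \<bar>pev h y\<bar>" by simp_all
    thus ?thesis by (auto simp: Wh power2_eq_square algebra_simps)
  qed
  define g where "g r y = (\<Prod>j\<in>UNIV. exp (- (r * (y $ j - z $ j))\<^sup>2 / 2))" for r and y :: "real ^ 'm"
  have g_sq: "(g r y)\<^sup>2 = exp (- (r\<^sup>2 * (dist y z)\<^sup>2))" for r y
  proof -
    have "g r y = exp (\<Sum>j\<in>UNIV. - (r * (y $ j - z $ j))\<^sup>2 / 2)" by (simp add: g_def exp_sum)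
    also have "(\<Sum>j\<in>UNIV. - (r * (y $ j - z $ j))\<^sup>2 / 2) = - (r\<^sup>2 * (dist y z)\<^sup>2) / 2"
    proof -
      have "(\<Sum>j\<in>UNIV. (r * (y $ j - z $ j))\<^sup>2) = r\<^sup>2 * (dist y z)\<^sup>2"
        unfolding dist_norm power2_norm_eq_inner inner_vec_def
        by (simp add: sum_distrib_left power2_eq_square mult_ac)
      thus ?thesis by (simp add: sum_negf flip: sum_divide_distrib)
    qed
    finally show ?thesis by (simp add: exp_double[symmetric])
  qed
  have tg: "tame (g r)" for r
  proof (rule tame_bounded[of _ 1])
    show "g r \<in> borel_measurable borel"
      unfolding g_def by (intro borel_measurable_continuous_onI continuous_intros) simp
    have "(g r y)\<^sup>2 \<le> 1\<^sup>2" for y by (simp add: g_sq)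
    thus "\<bar>g r y\<bar> \<le> 1" for y using abs_le_square_iff[of "g r y" 1] by simp
  qed
  obtain \<delta> r0 where \<delta>: "\<delta> > 0" and r0: "r0 > 0" and near: "\<And>y. y \<in> ball z r0 \<Longrightarrow> pev h y \<le> - \<delta>"
  proof -
    have "open {y. pev h y < pev h z / 2}"
      by (intro open_Collect_less continuous_on_pev continuous_intros)
    moreover have "z \<in> {y. pev h y < pev h z / 2}" using neg by simp
    ultimately obtain r0 where "r0 > 0" "ball z r0 \<subseteq> {y. pev h y < pev h z / 2}"
      by (meson open_contains_ball)
    thus thesis using that[of "- pev h z / 2" r0] neg by fastforce
  qed
  define b where "b = measure \<mu> (ball z (r0 / 2))"
  have fin: "finite_measure \<mu>"
  proof
    have "integrable \<mu> (\<lambda>_. 1 :: real)" using int[of 1] by simp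
    thus "emeasure \<mu> (space \<mu>) \<noteq> \<infinity>" by (simp add: integrable_iff_bounded)
  qed
  interpret finite_measure \<mu> by (rule fin)
  have b: "b > 0"
    using supp[of "ball z (r0 / 2)"] r0 by (simp add: b_def emeasure_eq_measure)
  define H where "H = (\<integral>y. \<bar>pev h y\<bar> \<partial>\<mu>)"
  have "\<exists>r. H * exp (- (r\<^sup>2 * r0\<^sup>2)) < \<delta> * b * exp (- (r\<^sup>2 * r0\<^sup>2 / 4))"
  proof -
    have "((\<lambda>r. H * exp (- (3 / 4 * (r\<^sup>2 * r0\<^sup>2)))) \<longlongrightarrow> 0) at_top" using r0 by real_asymp
    moreover have "\<delta> * b > 0" using \<delta> b by simp
    ultimately have "eventually (\<lambda>r. H * exp (- (3 / 4 * (r\<^sup>2 * r0\<^sup>2))) < \<delta> * b) at_top"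
      by (rule order_tendstoD)
    then obtain r where "H * exp (- (3 / 4 * (r\<^sup>2 * r0\<^sup>2))) < \<delta> * b"
      by (meson eventually_happens trivial_limit_at_top_linorder)
    hence "H * exp (- (3 / 4 * (r\<^sup>2 * r0\<^sup>2))) * exp (- (r\<^sup>2 * r0\<^sup>2 / 4)) < \<delta> * b * exp (- (r\<^sup>2 * r0\<^sup>2 / 4))"
      by (intro mult_strict_right_mono) auto
    also have "H * exp (- (3 / 4 * (r\<^sup>2 * r0\<^sup>2))) * exp (- (r\<^sup>2 * r0\<^sup>2 / 4)) = H * exp (- (r\<^sup>2 * r0\<^sup>2))"
      by (simp add: mult.assoc exp_add[symmetric])
    finally show ?thesis by blast
  qed
  then obtain r where r: "H * exp (- (r\<^sup>2 * r0\<^sup>2)) < \<delta> * b * exp (- (r\<^sup>2 * r0\<^sup>2 / 4))" by blast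
  define c1 where "c1 = exp (- (r\<^sup>2 * r0\<^sup>2 / 4))"
  define c2 where "c2 = exp (- (r\<^sup>2 * r0\<^sup>2))"
  \<comment> \<open>near \<open>z\<close> the Gaussian is at least \<open>c1\<close> and \<open>h\<close> is negative; away from \<open>z\<close> it is at most \<open>c2\<close>, which is small compared with \<open>c1\<close> by the choice of \<open>r\<close>\<close>
  have ptw: "(g r y)\<^sup>2 * pev h y \<le> - (\<delta> * c1) * indicat_real (ball z (r0 / 2)) y + c2 * \<bar>pev h y\<bar>" for y
  proof (cases "y \<in> ball z r0")
    case True
    hence h: "pev h y \<le> - \<delta>" by (rule near)
    hence h0: "pev h y \<le> 0" using \<delta> by simp
    have c2: "c2 * \<bar>pev h y\<bar> \<ge> 0" by (simp add: c2_def)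
    show ?thesis
    proof (cases "y \<in> ball z (r0 / 2)")
      case True
      hence "(dist y z)\<^sup>2 \<le> (r0 / 2)\<^sup>2" by (intro power_mono) (auto simp: dist_commute)
      hence "r\<^sup>2 * (dist y z)\<^sup>2 \<le> r\<^sup>2 * (r0 / 2)\<^sup>2" by (intro mult_left_mono) auto
      hence "c1 \<le> (g r y)\<^sup>2" by (simp add: g_sq c1_def power_divide)
      moreover have "c1 \<ge> 0" by (simp add: c1_def)
      ultimately have "\<delta> * c1 \<le> (- pev h y) * (g r y)\<^sup>2" using h \<delta> by (intro mult_mono) auto
      thus ?thesis using True c2 by (simp add: mult.commute)
    next
      case False
      have "(g r y)\<^sup>2 * pev h y \<le> 0" using h0 by (intro mult_nonneg_nonpos) auto
      thus ?thesis using False c2 by simp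
    qed
  next
    case False
    hence "r0\<^sup>2 \<le> (dist y z)\<^sup>2" using r0 by (intro power_mono) (auto simp: dist_commute)
    hence "r\<^sup>2 * r0\<^sup>2 \<le> r\<^sup>2 * (dist y z)\<^sup>2" by (intro mult_left_mono) auto
    hence "(g r y)\<^sup>2 \<le> c2" by (simp add: g_sq c2_def)
    have "(g r y)\<^sup>2 * pev h y \<le> (g r y)\<^sup>2 * \<bar>pev h y\<bar>" by (intro mult_left_mono) auto
    also have "\<dots> \<le> c2 * \<bar>pev h y\<bar>" using \<open>(g r y)\<^sup>2 \<le> c2\<close> by (intro mult_right_mono) auto
    finally show ?thesis using False r0 by (auto simp: indicator_def)
  qed
  have tind: "tame (indicat_real (ball z (r0 / 2)))"
  proof (rule tame_bounded[of _ 1])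
    show "indicat_real (ball z (r0 / 2)) \<in> borel_measurable borel"
      by (rule borel_measurable_indicator[OF borel_open[OF open_ball]])
  qed (simp add: indicator_def)
  have "(\<integral>y. (g r y)\<^sup>2 * pev h y \<partial>\<mu>)
      \<le> (\<integral>y. - (\<delta> * c1) * indicat_real (ball z (r0 / 2)) y + c2 * \<bar>pev h y\<bar> \<partial>\<mu>)"
  proof (intro integral_mono ptw)
    show "integrable \<mu> (\<lambda>y. - (\<delta> * c1) * indicat_real (ball z (r0 / 2)) y + c2 * \<bar>pev h y\<bar>)"
      by (intro tame_integrable tame_intros tind)
  qed (intro tame_integrable tame_intros tg)
  also have "\<dots> = - (\<delta> * c1) * b + c2 * H"
  proof -
    have "integrable \<mu> (indicat_real (ball z (r0 / 2)))" by (rule tame_integrable[OF tind])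
    moreover have "integrable \<mu> (\<lambda>y. \<bar>pev h y\<bar>)" by (intro tame_integrable tame_intros)
    moreover have "(\<integral>y. indicat_real (ball z (r0 / 2)) y \<partial>\<mu>) = b"
      using sets borel_open[OF open_ball[of z "r0 / 2"]] by (simp add: b_def)
    ultimately show ?thesis by (simp add: H_def)
  qed
  also have "\<dots> < 0" using r by (simp add: c1_def c2_def mult_ac)
  finally have gneg: "(\<integral>y. (g r y)\<^sup>2 * pev h y \<partial>\<mu>) < 0" .
  define I where "I = - (\<integral>y. (g r y)\<^sup>2 * pev h y \<partial>\<mu>)"
  have I: "I > 0" using gneg by (simp add: I_def)
  define G where "G = 2 * nrm (g r) + 1"
  have G: "G > 0" using nrm_nonneg[of "g r"] by (simp add: G_def)
  \<comment> \<open>an approximation error below \<open>e\<close> changes the integral by less than \<open>I / 2\<close>\<close>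
  define e where "e = min 1 (I / (2 * G))"
  have e: "e > 0" "e \<le> 1" "e * G \<le> I / 2" using I G by (auto simp: e_def min_def field_simps)
  have "pdist (g r) < e" using pdist_gaussian[of r z] e by (simp add: g_def[abs_def])
  then obtain p where p: "nrm (\<lambda>y. g r y - pev p y) < e" using pdist_approx by blast
  define d where "d y = g r y - pev p y" for y
  have td: "tame d" unfolding d_def[abs_def] by (intro tame_intros tg)
  have "(\<integral>y. (pev p y)\<^sup>2 * pev h y - (g r y)\<^sup>2 * pev h y \<partial>\<mu>)
      \<le> (\<integral>y. \<bar>d y\<bar> * \<bar>d y\<bar> * pev W y + 2 * (\<bar>d y\<bar> * \<bar>g r y\<bar> * pev W y) \<partial>\<mu>)"
  proof (intro integral_mono)
    fix y
    have "(pev p y)\<^sup>2 * pev h y - (g r y)\<^sup>2 * pev h y = (d y * d y - 2 * (d y * g r y)) * pev h y"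
      by (simp add: d_def power2_eq_square algebra_simps)
    also have "\<dots> \<le> \<bar>d y * d y - 2 * (d y * g r y)\<bar> * \<bar>pev h y\<bar>"
      by (simp only: abs_mult[symmetric] abs_ge_self)
    also have "\<dots> \<le> (\<bar>d y\<bar> * \<bar>d y\<bar> + 2 * (\<bar>d y\<bar> * \<bar>g r y\<bar>)) * pev W y"
    proof (intro mult_mono hW)
      have "\<bar>d y * d y - 2 * (d y * g r y)\<bar> \<le> \<bar>d y * d y\<bar> + \<bar>2 * (d y * g r y)\<bar>" by (rule abs_triangle_ineq4)
      thus "\<bar>d y * d y - 2 * (d y * g r y)\<bar> \<le> \<bar>d y\<bar> * \<bar>d y\<bar> + 2 * (\<bar>d y\<bar> * \<bar>g r y\<bar>)" by (simp add: abs_mult)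
    qed (auto intro!: add_nonneg_nonneg)
    finally show "(pev p y)\<^sup>2 * pev h y - (g r y)\<^sup>2 * pev h y
        \<le> \<bar>d y\<bar> * \<bar>d y\<bar> * pev W y + 2 * (\<bar>d y\<bar> * \<bar>g r y\<bar> * pev W y)" by (simp add: algebra_simps)
  qed (intro tame_integrable tame_intros tg td)+
  also have "\<dots> = (\<integral>y. \<bar>d y\<bar> * \<bar>d y\<bar> * pev W y \<partial>\<mu>) + 2 * (\<integral>y. \<bar>d y\<bar> * \<bar>g r y\<bar> * pev W y \<partial>\<mu>)"
  proof -
    have "integrable \<mu> (\<lambda>y. \<bar>d y\<bar> * \<bar>d y\<bar> * pev W y)" "integrable \<mu> (\<lambda>y. \<bar>d y\<bar> * \<bar>g r y\<bar> * pev W y)"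
      by (intro tame_integrable tame_intros tg td)+
    thus ?thesis by simp
  qed
  also have "\<dots> \<le> nrm (\<lambda>y. \<bar>d y\<bar>) * nrm (\<lambda>y. \<bar>d y\<bar>) + 2 * (nrm (\<lambda>y. \<bar>d y\<bar>) * nrm (\<lambda>y. \<bar>g r y\<bar>))"
    by (intro add_mono mult_left_mono order_trans[OF abs_ge_self weighted_Cauchy_Schwarz] tame_abs td tg)
       simp
  also have "\<dots> = nrm d * (nrm d + 2 * nrm (g r))" by (simp add: nrm_def algebra_simps)
  also have "\<dots> < e * G"
  proof -
    have "nrm d < e" using p by (simp add: d_def[abs_def])
    moreover from this have "nrm d + 2 * nrm (g r) \<le> G" using e by (simp add: G_def)
    ultimately have "nrm d * (nrm d + 2 * nrm (g r)) \<le> nrm d * G" "nrm d * G < e * G"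
      using G by (auto intro: mult_left_mono mult_strict_right_mono nrm_nonneg)
    thus ?thesis by (rule order_le_less_trans)
  qed
  also have "\<dots> \<le> I / 2" by (rule e)
  finally have "(\<integral>y. (pev p y)\<^sup>2 * pev h y - (g r y)\<^sup>2 * pev h y \<partial>\<mu>) < I / 2" .
  moreover have "integrable \<mu> (\<lambda>y. (pev p y)\<^sup>2 * pev h y)" "integrable \<mu> (\<lambda>y. (g r y)\<^sup>2 * pev h y)"
    by (intro tame_integrable tame_intros tg)+
  ultimately have "(\<integral>y. (pev p y)\<^sup>2 * pev h y \<partial>\<mu>) < I / 2 - I" by (simp add: I_def)
  thus ?thesis using I by (intro exI[of _ p]) simp
qed

text \<open>
  The complement is a union of open null sets, of which countably many suffice.
\<close>

lemma measure_support_null_complement: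
  fixes \<nu> :: "'a::second_countable_topology measure"
  assumes "sets \<nu> = sets borel"
  shows "- measure_support \<nu> \<in> null_sets \<nu>"
proof -
  define \<U> where "\<U> = {U. open U \<and> emeasure \<nu> U = 0}"
  have eq: "- measure_support \<nu> = \<Union>\<U>" by (auto simp: measure_support_def \<U>_def)
  have "\<And>U. U \<in> \<U> \<Longrightarrow> open U" by (simp add: \<U>_def)
  then obtain \<V> where V: "\<V> \<subseteq> \<U>" "countable \<V>" "\<Union>\<V> = \<Union>\<U>" using Lindelof[of \<U>] by metis
  have "(\<Union>U\<in>\<V>. U) \<in> null_sets \<nu>"
    using V(1) assms by (intro null_sets_UN' V(2)) (auto simp: \<U>_def null_sets_def)
  thus ?thesis by (simp add: eq V(3))
qed

text \<open>
  This is the only place where the Carleman condition and the support of \<open>\<nu>\<close> enter: it says that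
  a polynomial whose integrals against all squares are nonnegative is nonnegative on \<open>Y\<close>.
\<close>

lemma carleman_negative_square:
  fixes \<nu> :: "(real ^ 'm::finite) measure" and h :: "'m rpoly"
  assumes "closed Y" and sets: "sets \<nu> = sets borel" and supp: "measure_support \<nu> = Y"
    and int: "\<And>h :: 'm rpoly. set_integrable \<nu> Y (pev h)"
    and carl: "\<And>j. carleman \<nu> Y j"
    and z: "z \<in> Y" and neg: "pev h z < 0"
  shows "\<exists>p. (LINT y:Y|\<nu>. (pev p y)\<^sup>2 * pev h y) < 0"
proof -
  have Y: "Y \<in> sets \<nu>" using \<open>closed Y\<close> sets by simp
  define \<mu> where "\<mu> = density \<nu> (\<lambda>y. ennreal (indicat_real Y y))"
  have smu: "sets \<mu> = sets borel" by (simp add: \<mu>_def sets)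
  have meas: "pev p \<in> borel_measurable \<nu>" for p :: "'m rpoly"
    by (simp add: measurable_cong_sets[OF sets refl])
  have ind: "indicat_real Y \<in> borel_measurable \<nu>" using Y by simp
  have lint: "(LINT y:Y|\<nu>. f y) = (\<integral>y. f y \<partial>\<mu>)" if "f \<in> borel_measurable borel" for f :: "real ^ 'm \<Rightarrow> real"
    unfolding \<mu>_def set_lebesgue_integral_def
    by (rule integral_density[symmetric]) (use that ind in \<open>simp_all add: measurable_cong_sets[OF sets refl]\<close>)
  have imu: "integrable \<mu> (pev p)" for p :: "'m rpoly"
    unfolding \<mu>_def using int[of p] meas[of p] ind by (subst integrable_density) (simp_all add: set_integrable_def)
  have pos: "emeasure \<mu> U > 0" if U: "open U" "z \<in> U" for U
  proof -
    have Us: "U \<in> sets \<nu>" using U sets by simp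
    have "emeasure \<mu> U = (\<integral>\<^sup>+y. ennreal (indicat_real Y y) * indicator U y \<partial>\<nu>)"
      unfolding \<mu>_def using Us ind by (intro emeasure_density) auto
    also have "\<dots> = (\<integral>\<^sup>+y. indicator (U \<inter> Y) y \<partial>\<nu>)"
      by (intro nn_integral_cong) (auto simp: indicator_def)
    also have "\<dots> = emeasure \<nu> (U \<inter> Y)" using Us Y by simp
    also have "\<dots> = emeasure \<nu> (U - (- Y))" by (simp add: Diff_eq)
    also have "\<dots> = emeasure \<nu> U"
      using measure_support_null_complement[OF sets] Us by (intro emeasure_Diff_null_set) (simp_all add: supp)
    also have "\<dots> > 0" using z U unfolding supp[symmetric] measure_support_def by blast
    finally show ?thesis .
  qed
  have mom: "(LINT y:Y|\<nu>. (y $ j) ^ n) = (\<integral>y. (y $ j) ^ n \<partial>\<mu>)" for j n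
    by (rule lint) (intro borel_measurable_continuous_onI continuous_intros)
  have c: "\<not> summable (\<lambda>n. 1 / (\<integral>y. (y $ j) ^ (2 * Suc n) \<partial>\<mu>) powr (1 / real (2 * Suc n)))"
    if p: "\<And>n. (\<integral>y. (y $ j) ^ (2 * n) \<partial>\<mu>) > 0" for j
  proof
    let ?f = "\<lambda>n. 1 / (\<integral>y. (y $ j) ^ (2 * Suc n) \<partial>\<mu>) powr (1 / real (2 * Suc n))"
    assume s: "summable ?f"
    have eq: "inverse (ennreal ((\<integral>y. (y $ j) ^ (2 * Suc n) \<partial>\<mu>) powr (1 / real (2 * Suc n)))) = ennreal (?f n)" for n
      using p[of "Suc n"] by (subst inverse_ennreal) (simp_all add: inverse_eq_divide)
    have "suminf (\<lambda>n. ennreal (?f n)) = ennreal (suminf ?f)"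
      by (rule suminf_ennreal2[OF _ s]) (intro divide_nonneg_nonneg zero_le_one powr_ge_zero)
    moreover have "suminf (\<lambda>n. ennreal (?f n)) = \<infinity>"
      using carl[of j] unfolding carleman_def mom eq .
    ultimately have "ennreal (suminf ?f) = top" by (simp only: infinity_ennreal_def)
    thus False using ennreal_neq_top by blast
  qed
  obtain p where "(\<integral>y. (pev p y)\<^sup>2 * pev h y \<partial>\<mu>) < 0"
    using exists_square_negative[OF smu imu c pos neg] by blast
  thus ?thesis by (subst (asm) lint[symmetric]) auto
qed

section \<open>Scalar test polynomials obtained by integration\<close>

lemma block_inner_nth:
  fixes S :: "'a::comm_semiring_1 ^ ('p::finite \<times> 'q::finite) ^ ('p \<times> 'q)"
  shows "block_inner S G $ i $ j = (\<Sum>a\<in>UNIV. \<Sum>b\<in>UNIV. S $ (j, b) $ (i, a) * G $ b $ a)"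
proof -
  have pair: "(\<Sum>r\<in>UNIV. h r) = (\<Sum>k\<in>UNIV. \<Sum>b\<in>UNIV. h (k, b))" for h :: "'p \<times> 'q \<Rightarrow> 'a"
    by (simp add: UNIV_Times_UNIV[symmetric] sum.cartesian_product del: UNIV_Times_UNIV)
  have delta: "(\<Sum>k\<in>UNIV. \<Sum>b\<in>UNIV. S $ (k, b) $ (i, a) * ((if k = j then 1 else 0) * G $ b $ a))
      = (\<Sum>b\<in>UNIV. S $ (j, b) $ (i, a) * G $ b $ a)" for a
  proof -
    have "(\<Sum>k\<in>UNIV. \<Sum>b\<in>UNIV. S $ (k, b) $ (i, a) * ((if k = j then 1 else 0) * G $ b $ a))
        = (\<Sum>k\<in>UNIV. if k = j then \<Sum>b\<in>UNIV. S $ (j, b) $ (i, a) * G $ b $ a else 0)"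
      by (intro sum.cong refl) auto
    thus ?thesis by simp
  qed
  show ?thesis
    by (simp add: block_inner_def partial_trace_def trace_def matrix_matrix_mult_def transpose_def
        kronecker_def mat_def pair delta)
qed

text \<open>
  For \<open>0 \<le> a \<le> 1\<close> each of the \<open>2M + 1\<close> terms of the geometric sum of the powers of \<open>1 - a\<close> is at least
  \<open>(1 - a)^(2M)\<close>, and the sum multiplied by \<open>a\<close> is at most \<open>1\<close>.
\<close>

lemma damped_bound:
  fixes a :: real
  assumes "\<bar>a\<bar> \<le> 1"
  shows "a * (1 - a) ^ (2 * M) \<le> 1 / (2 * real M + 1)"
proof (cases "a \<ge> 0")
  case True
  have "real (Suc (2 * M)) * (1 - a) ^ (2 * M) = (\<Sum>i<Suc (2 * M). (1 - a) ^ (2 * M))" by simp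
  also have "\<dots> \<le> (\<Sum>i<Suc (2 * M). (1 - a) ^ i)"
    using True assms by (intro sum_mono power_decreasing) auto
  finally have "a * (real (Suc (2 * M)) * (1 - a) ^ (2 * M)) \<le> a * (\<Sum>i<Suc (2 * M). (1 - a) ^ i)"
    using True by (rule mult_left_mono)
  also have "\<dots> = 1 - (1 - a) ^ Suc (2 * M)"
    using one_diff_power_eq[of "1 - a" "Suc (2 * M)"] by simp
  also have "\<dots> \<le> 1" using assms by simp
  finally show ?thesis by (simp add: field_simps)
next
  case False
  hence "a * (1 - a) ^ (2 * M) \<le> 0" by (intro mult_nonpos_nonneg) auto
  also have "0 \<le> 1 / (2 * real M + 1)" by simp
  finally show ?thesis .
qed

lemma damped_negative:
  fixes a :: real
  assumes "\<delta> > 0" "a \<le> - \<delta>"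
  shows "a * (1 - a) ^ (2 * M) \<le> - (\<delta> * (1 + 2 * real M * \<delta>))"
proof -
  have "1 + real (2 * M) * \<delta> \<le> (1 + \<delta>) ^ (2 * M)" using assms by (intro Bernoulli_inequality) simp
  also have "\<dots> \<le> (1 - a) ^ (2 * M)" using assms by (intro power_mono) auto
  finally have "1 + real (2 * M) * \<delta> \<le> (1 - a) ^ (2 * M)" .
  hence "\<delta> * (1 + 2 * real M * \<delta>) \<le> (- a) * (1 - a) ^ (2 * M)"
    using assms by (intro mult_mono) auto
  thus ?thesis by simp
qed

lemma set_integral_sum_cmult:
  fixes f :: "'i \<Rightarrow> 'a \<Rightarrow> real"
  assumes "\<And>i. i \<in> I \<Longrightarrow> set_integrable M A (f i)"
  shows "(LINT x:A|M. \<Sum>i\<in>I. c i * f i x) = (\<Sum>i\<in>I. c i * (LINT x:A|M. f i x))"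
proof -
  have int: "integrable M (\<lambda>x. c i * (indicat_real A x *\<^sub>R f i x))" if "i \<in> I" for i
    using assms[OF that] by (simp add: set_integrable_def)
  have "(LINT x:A|M. \<Sum>i\<in>I. c i * f i x) = integral\<^sup>L M (\<lambda>x. \<Sum>i\<in>I. c i * (indicat_real A x *\<^sub>R f i x))"
    unfolding set_lebesgue_integral_def
    by (intro Bochner_Integration.integral_cong refl) (simp add: sum_distrib_left mult.left_commute)
  also have "\<dots> = (\<Sum>i\<in>I. integral\<^sup>L M (\<lambda>x. c i * (indicat_real A x *\<^sub>R f i x)))"
    by (intro Bochner_Integration.integral_sum int)
  finally show ?thesis unfolding set_lebesgue_integral_def by simp
qed

lemma set_integrable_pev:
  fixes \<nu> :: "(real ^ 'm::finite) measure" and h :: "'m rpoly"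
  assumes "closed Y" "sets \<nu> = sets borel"
    and fin: "(\<integral>\<^sup>+y\<in>Y. ennreal \<bar>pev h y\<bar> \<partial>\<nu>) < \<infinity>"
  shows "set_integrable \<nu> Y (pev h)"
  unfolding set_integrable_def
proof (rule integrableI_bounded)
  have "pev h \<in> borel_measurable \<nu>" by (simp add: measurable_cong_sets[OF assms(2) refl])
  moreover have "Y \<in> sets \<nu>" using assms(1,2) by simp
  ultimately show "(\<lambda>y. indicat_real Y y *\<^sub>R pev h y) \<in> borel_measurable \<nu>" by measurable
  have "(\<integral>\<^sup>+y. ennreal (norm (indicat_real Y y *\<^sub>R pev h y)) \<partial>\<nu>) = (\<integral>\<^sup>+y\<in>Y. ennreal \<bar>pev h y\<bar> \<partial>\<nu>)"
    by (intro nn_integral_cong) (auto simp: indicator_def)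
  thus "(\<integral>\<^sup>+y. ennreal (norm (indicat_real Y y *\<^sub>R pev h y)) \<partial>\<nu>) < \<infinity>" using fin by simp
qed

definition lift_x :: "'n::finite rpoly \<Rightarrow> ('n + 'm) rpoly" where
  "lift_x = poly_subst (\<lambda>i. Var (Inl i))"

definition lift_y :: "'m::finite rpoly \<Rightarrow> ('n + 'm) rpoly" where
  "lift_y = poly_subst (\<lambda>j. Var (Inr j))"

lemma poly_eval_lift:
  "poly_eval (lift_x P) (case_sum x y) = poly_eval P x"
  "poly_eval (lift_y Q) (case_sum x y) = poly_eval Q y"
  by (simp_all add: lift_x_def lift_y_def poly_eval_subst)

lemma deg_in_lift_x: "deg_in (range Inl) (lift_x P :: ('n::finite + 'm::finite) rpoly) \<le> deg_in UNIV P"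
proof -
  have "deg_in (range Inl) (Var (Inl i) :: ('n + 'm) rpoly) \<le> 1" for i
    using deg_in_Var[of "range Inl" "Inl i :: 'n + 'm"] by simp
  from deg_in_subst[of "range Inl" "\<lambda>i. Var (Inl i)" 1 P, OF this] show ?thesis
    by (simp add: lift_x_def)
qed

lemma deg_in_lift_y: "deg_in (range Inl) (lift_y P :: ('n::finite + 'm::finite) rpoly) = 0"
proof -
  have "deg_in (range Inl) (Var (Inr j) :: ('n + 'm) rpoly) \<le> 0" for j
    using deg_in_Var[of "range Inl" "Inr j :: 'n + 'm"] by (simp add: image_iff)
  from deg_in_subst[of "range Inl" "\<lambda>j. Var (Inr j)" 0 P, OF this] show ?thesis
    by (simp add: lift_y_def)
qed

definition quad_poly :: "'v rpoly ^ 'q::finite ^ 'q \<Rightarrow> real ^ 'q \<Rightarrow> 'v rpoly" where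
  "quad_poly G v = (\<Sum>a\<in>UNIV. \<Sum>b\<in>UNIV. Const (v $ a * v $ b) * G $ a $ b)"

lemma poly_eval_quad_poly: "poly_eval (quad_poly G v) a = quad_form (mat_eval G a) v"
  by (simp add: quad_poly_def poly_eval_hom quad_form_sum mat_eval_def map_matrix_def)

lemma deg_in_quad_poly:
  assumes "\<And>a b. deg_in V (G $ a $ b) \<le> d"
  shows "deg_in V (quad_poly G v) \<le> d"
  unfolding quad_poly_def
proof (intro deg_in_sum)
  show "deg_in V (Const (v $ a * v $ b) * G $ a $ b) \<le> d" for a b
    using deg_in_mult[of V "Const (v $ a * v $ b)" 0 "G $ a $ b" d, OF _ assms] by simp
qed

text \<open>
  The scalar polynomial \<open>g(x) = \<integral> p(y)\<^sup>2 v\<^sup>T G(x, y) v d\<nu>(y)\<close>. It is nonnegative on \<open>X\<close>, and by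
  \<open>test_poly_separates\<close> the set \<open>X\<close> is described by all these polynomials together.
\<close>

definition test_poly :: "(real ^ 'm::finite) measure \<Rightarrow> (real ^ 'm) set \<Rightarrow> ('n::finite + 'm) rpoly ^ 'q::finite ^ 'q
    \<Rightarrow> 'm rpoly \<Rightarrow> real ^ 'q \<Rightarrow> 'n rpoly" where
  "test_poly \<nu> Y G p v = y_integral \<nu> Y ((lift_y p)\<^sup>2 * quad_poly G v)"

lemma poly_eval_test_poly:
  fixes G :: "('n::finite + 'm::finite) rpoly ^ 'q::finite ^ 'q"
  assumes "\<And>h :: 'm rpoly. set_integrable \<nu> Y (pev h)"
  shows "poly_eval (test_poly \<nu> Y G p v) x
    = (LINT y:Y|\<nu>. (pev p y)\<^sup>2 * quad_form (mat_eval G (case_sum x (($) y))) v)"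
  unfolding test_poly_def poly_eval_y_integral[OF assms]
  by (simp add: poly_eval_hom poly_eval_lift poly_eval_quad_poly)

lemma deg_in_test_poly: "deg_in UNIV (test_poly \<nu> Y G p v) \<le> 2 * half_deg (range Inl) G"
proof -
  have "deg_in (range Inl) ((lift_y p)\<^sup>2 * quad_poly G v) \<le> 0 * 2 + 2 * half_deg (range Inl) G"
    by (rule deg_in_mult[OF deg_in_power deg_in_quad_poly])
       (simp_all add: deg_in_lift_y less_imp_le[OF deg_in_half_deg])
  from order_trans[OF deg_in_y_integral this] show ?thesis by (simp add: test_poly_def)
qed

lemma freeze_x:
  fixes P :: "('n::finite + 'm::finite) rpoly"
  shows "\<exists>h :: 'm rpoly. \<forall>y. poly_eval h y = poly_eval P (case_sum x y)"
proof (intro exI allI)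
  fix y :: "'m \<Rightarrow> real"
  have "(\<lambda>v. poly_eval (case_sum (\<lambda>i. Const (x i)) Var v) y) = case_sum x y"
    by (auto simp: fun_eq_iff split: sum.split)
  thus "poly_eval (poly_subst (case_sum (\<lambda>i. Const (x i)) Var) P) y = poly_eval P (case_sum x y)"
    by (simp add: poly_eval_subst)
qed

lemma quad_form_growth:
  fixes F :: "'n::finite rpoly ^ 'p::finite ^ 'p"
  assumes "\<And>i j. deg_in UNIV (F $ i $ j) \<le> d"
  shows "\<exists>C\<ge>0. \<forall>x v. \<bar>quad_form (mat_eval F x) v\<bar> \<le> C * sqrt (poly_eval theta x) ^ d * (v \<bullet> v)"
proof -
  have "\<forall>k. \<exists>C\<ge>0. \<forall>a. \<bar>poly_eval (F $ fst k $ snd k) a\<bar>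
      \<le> C * sqrt (poly_eval theta a) ^ deg_in UNIV (F $ fst k $ snd k)"
    using poly_growth by blast
  then obtain C where C: "\<And>k. C k \<ge> 0" "\<And>k a. \<bar>poly_eval (F $ fst k $ snd k) a\<bar>
      \<le> C k * sqrt (poly_eval theta a) ^ deg_in UNIV (F $ fst k $ snd k)"
    by metis
  show ?thesis
  proof (intro exI conjI allI)
    show "0 \<le> (\<Sum>i\<in>UNIV. \<Sum>j\<in>UNIV. C (i, j))" by (intro sum_nonneg C)
    fix x :: "'n \<Rightarrow> real" and v :: "real ^ 'p"
    let ?s = "sqrt (poly_eval theta x)"
    have s: "?s \<ge> 1" by (simp add: poly_eval_theta sum_nonneg)
    have e: "\<bar>poly_eval (F $ i $ j) x\<bar> \<le> C (i, j) * ?s ^ d" for i j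
    proof -
      have "\<bar>poly_eval (F $ i $ j) x\<bar> \<le> C (i, j) * ?s ^ deg_in UNIV (F $ i $ j)" using C(2)[of "(i, j)" x] by simp
      also have "\<dots> \<le> C (i, j) * ?s ^ d" by (intro mult_left_mono power_increasing assms s C)
      finally show ?thesis .
    qed
    have vv: "\<bar>v $ i\<bar> * \<bar>v $ j\<bar> \<le> v \<bullet> v" for i j
    proof -
      have "\<bar>v $ i\<bar> * \<bar>v $ j\<bar> \<le> norm v * norm v" by (intro mult_mono component_le_norm_cart) auto
      thus ?thesis by (simp add: power2_eq_square[symmetric] power2_norm_eq_inner)
    qed
    have "\<bar>quad_form (mat_eval F x) v\<bar> \<le> (\<Sum>i\<in>UNIV. \<Sum>j\<in>UNIV. \<bar>v $ i * v $ j * poly_eval (F $ i $ j) x\<bar>)"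
      unfolding quad_form_sum by (intro order_trans[OF sum_abs] sum_mono) (simp add: mat_eval_def map_matrix_def)
    also have "\<dots> \<le> (\<Sum>i\<in>UNIV. \<Sum>j\<in>UNIV. (v \<bullet> v) * (C (i, j) * ?s ^ d))"
      unfolding abs_mult by (intro sum_mono mult_mono vv e) auto
    also have "\<dots> = (\<Sum>i\<in>UNIV. \<Sum>j\<in>UNIV. C (i, j)) * ?s ^ d * (v \<bullet> v)"
      by (simp add: sum_distrib_left sum_distrib_right mult_ac)
    finally show "\<bar>quad_form (mat_eval F x) v\<bar> \<le> (\<Sum>i\<in>UNIV. \<Sum>j\<in>UNIV. C (i, j)) * ?s ^ d * (v \<bullet> v)" .
  qed
qed

text \<open>
  The value is negative for a suitable \<open>p\<close> and scales with the square of a constant factor of \<open>p\<close>, so it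
  can be made less than any prescribed number.
\<close>

lemma test_poly_separates:
  fixes G :: "('n::finite + 'm::finite) rpoly ^ 'q::finite ^ 'q" and x :: "real ^ 'n"
  assumes Y: "closed Y" and sets: "sets \<nu> = sets borel" and supp: "measure_support \<nu> = Y"
    and int: "\<And>h :: 'm rpoly. set_integrable \<nu> Y (pev h)"
    and carl: "\<And>j. carleman \<nu> Y j"
    and sym: "symmetric_mat G"
    and x: "\<not> (\<forall>y\<in>Y. psd (mat_eval G (joint_point x y)))"
  shows "\<exists>p v. poly_eval (test_poly \<nu> Y G p v) (($) x) < - B"
proof -
  obtain z where z: "z \<in> Y" "\<not> psd (mat_eval G (joint_point x z))" using x by blast
  have "symmetric_mat (mat_eval G (joint_point x z))"
    using sym by (simp add: symmetric_mat_iff mat_eval_def map_matrix_def)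
  with z(2) obtain v where v: "quad_form (mat_eval G (joint_point x z)) v < 0"
    unfolding psd_def quad_form_def by (auto simp: not_le)
  obtain h :: "'m rpoly" where h: "\<And>y. poly_eval h y = poly_eval (quad_poly G v) (case_sum (($) x) y)"
    using freeze_x[of "quad_poly G v" "($) x"] by blast
  have hq: "pev h y = quad_form (mat_eval G (joint_point x y)) v" for y
    by (simp add: h poly_eval_quad_poly)
  have "pev h z < 0" using v by (simp add: hq)
  from carleman_negative_square[OF Y sets supp int carl z(1) this]
  obtain p where p: "(LINT y:Y|\<nu>. (pev p y)\<^sup>2 * pev h y) < 0" by blast
  define s where "s = - (LINT y:Y|\<nu>. (pev p y)\<^sup>2 * pev h y)"
  have s: "s > 0" using p by (simp add: s_def)
  \<comment> \<open>the factor by which \<open>p\<close> is scaled\<close>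
  define c where "c = sqrt ((\<bar>B\<bar> + 1) / s)"
  have "c\<^sup>2 = (\<bar>B\<bar> + 1) / s" using s by (simp add: c_def)
  hence cs: "c\<^sup>2 * s = \<bar>B\<bar> + 1" using s by simp
  have "poly_eval (test_poly \<nu> Y G (Const c * p) v) (($) x) = (LINT y:Y|\<nu>. c\<^sup>2 * ((pev p y)\<^sup>2 * pev h y))"
    unfolding poly_eval_test_poly[OF int] hq by (simp add: poly_eval_hom power_mult_distrib mult.assoc)
  also have "\<dots> = - (c\<^sup>2 * s)" by (simp add: s_def)
  also have "\<dots> < - B" using cs by simp
  finally show ?thesis by blast
qed

text \<open>
  For unit vectors \<open>v\<close> with \<open>v\<^sup>T F(x) v \<le> - (\<epsilon>/2) \<theta>^d\<^sub>F\<close> the point \<open>x\<close> is not in \<open>X\<close>, and \<open>x\<close> is bounded because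
  \<open>deg F < 2 d\<^sub>F\<close>. The pairs \<open>(x, v)\<close> of this kind form a compact set \<open>K\<close>; the open sets where
  \<open>g d < - \<theta>\<^sup>e\<close> cover its projection, and finitely many of them suffice.
\<close>

lemma finite_test_family:
  fixes F :: "'n::finite rpoly ^ 'p::finite ^ 'p" and g :: "'i \<Rightarrow> 'n rpoly"
  assumes X: "\<And>x v. x \<in> X \<Longrightarrow> quad_form (mat_eval F (($) x)) v \<ge> 0"
    and g: "\<And>x B. x \<notin> X \<Longrightarrow> \<exists>d. poly_eval (g d) (($) x) < - B" and "\<epsilon> > 0"
  shows "\<exists>I. finite I \<and> (\<forall>x v. norm v = 1 \<longrightarrow>
    quad_form (mat_eval F (($) x)) v > - (\<epsilon> / 2) * poly_eval theta (($) x) ^ half_deg UNIV F \<or>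
    (\<exists>d\<in>I. poly_eval (g d) (($) x) < - (poly_eval theta (($) x) ^ e)))"
proof -
  let ?\<theta> = "\<lambda>x :: real ^ 'n. poly_eval theta (($) x)" and ?d = "half_deg UNIV F"
  have d: "?d > 0" using deg_in_half_deg[of UNIV F undefined undefined] by linarith
  have th1: "?\<theta> x \<ge> 1" for x by (simp add: poly_eval_theta sum_nonneg)
  have norm_th: "norm x \<le> sqrt (?\<theta> x)" for x
    unfolding norm_vec_def L2_set_def poly_eval_theta by simp
  have "deg_in UNIV (F $ i $ j) \<le> 2 * ?d - 1" for i j using deg_in_half_deg[of UNIV F i j] by linarith
  from quad_form_growth[OF this] obtain C where C: "C \<ge> 0"
    "\<And>x v. \<bar>quad_form (mat_eval F x) v\<bar> \<le> C * sqrt (poly_eval theta x) ^ (2 * ?d - 1) * (v \<bullet> v)" by blast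
  define R where "R = 2 * C / \<epsilon>"
  define K where "K = (cball 0 R \<times> sphere 0 1) \<inter>
    {p :: (real ^ 'n) \<times> (real ^ 'p). quad_form (mat_eval F (($) (fst p))) (snd p) \<le> - (\<epsilon> / 2) * ?\<theta> (fst p) ^ ?d}"
  have "compact K"
    unfolding K_def
  proof (intro compact_Int_closed compact_Times compact_cball compact_sphere closed_Collect_le)
    have "continuous_on UNIV (\<lambda>p :: (real ^ 'n) \<times> (real ^ 'p). poly_eval P (($) (fst p)))" for P
      by (intro continuous_on_poly_eval continuous_intros)
    thus "continuous_on UNIV (\<lambda>p :: (real ^ 'n) \<times> (real ^ 'p). quad_form (mat_eval F (($) (fst p))) (snd p))"
      "continuous_on UNIV (\<lambda>p :: (real ^ 'n) \<times> (real ^ 'p). - (\<epsilon> / 2) * ?\<theta> (fst p) ^ ?d)"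
      unfolding quad_form_sum mat_eval_def map_matrix_def vec_lambda_beta by (intro continuous_intros; assumption)+
  qed
  hence cB: "compact (fst ` K)" by (intro compact_continuous_image continuous_intros)
  define U where "U d = {x. poly_eval (g d) (($) x) < - (?\<theta> x ^ e)}" for d
  have op: "open (U d)" for d
    unfolding U_def by (intro open_Collect_less continuous_on_poly_eval continuous_intros)
  have cov: "fst ` K \<subseteq> (\<Union>d\<in>UNIV. U d)"
  proof
    fix x assume "x \<in> fst ` K"
    then obtain v where "quad_form (mat_eval F (($) x)) v \<le> - (\<epsilon> / 2) * ?\<theta> x ^ ?d" by (auto simp: K_def)
    moreover have "- (\<epsilon> / 2) * ?\<theta> x ^ ?d < 0" using \<open>\<epsilon> > 0\<close> th1[of x] by (simp add: mult_neg_pos)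
    ultimately have "x \<notin> X" using X[of x v] by auto
    from g[OF this, of "?\<theta> x ^ e"] show "x \<in> (\<Union>d\<in>UNIV. U d)" by (auto simp: U_def)
  qed
  from cB op cov obtain I where I: "finite I" "fst ` K \<subseteq> (\<Union>d\<in>I. U d)"
    by (rule compactE_image)
  have "(\<exists>d\<in>I. poly_eval (g d) (($) x) < - (?\<theta> x ^ e))"
    if v: "norm v = 1" and neg: "\<not> quad_form (mat_eval F (($) x)) v > - (\<epsilon> / 2) * ?\<theta> x ^ ?d" for x and v :: "real ^ 'p"
  proof -
    let ?s = "sqrt (?\<theta> x)"
    have s: "?s \<ge> 1" using th1[of x] by simp
    have "?s ^ 2 = ?\<theta> x" using th1[of x] by simp
    moreover have "2 * ?d = Suc (2 * ?d - 1)" using d by simp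
    ultimately have th: "?\<theta> x ^ ?d = ?s * ?s ^ (2 * ?d - 1)"
      by (metis power_Suc power_mult)
    have "v \<bullet> v = 1" using v by (simp add: norm_eq_1)
    hence "(\<epsilon> / 2) * ?\<theta> x ^ ?d \<le> C * ?s ^ (2 * ?d - 1)"
      using neg C(2)[of "($) x" v] by simp
    hence "(\<epsilon> / 2 * ?s) * ?s ^ (2 * ?d - 1) \<le> C * ?s ^ (2 * ?d - 1)" by (simp add: th mult.assoc)
    hence "\<epsilon> / 2 * ?s \<le> C" using s by (subst (asm) mult_le_cancel_right) auto
    hence "?s \<le> R" using \<open>\<epsilon> > 0\<close> by (simp add: R_def field_simps)
    hence "(x, v) \<in> K" using v neg norm_th[of x] by (simp add: K_def)
    hence "x \<in> fst ` K" by force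
    thus ?thesis using I(2) by (auto simp: U_def)
  qed
  thus ?thesis using I(1) by blast
qed

text \<open>
  With \<open>a = g / (c \<theta>\<^sup>e)\<close> and \<open>c\<close> so large that \<open>|a| \<le> 1\<close>, every summand \<open>a (1 - a)^(2M)\<close> is at most
  \<open>1/(2M + 1)\<close> and does no harm where \<open>F\<close> is not too negative. Elsewhere one of the \<open>a\<close> is below
  \<open>- 1/c\<close>, and its summand tends to minus infinity with \<open>M\<close> and compensates the bounded
  negative part of \<open>F\<close>.
\<close>

lemma damped_perturbation:
  fixes F :: "'n::finite rpoly ^ 'p::finite ^ 'p" and g :: "'i \<Rightarrow> 'n rpoly"
  assumes "finite I" and deg: "\<And>d. d \<in> I \<Longrightarrow> deg_in UNIV (g d) \<le> 2 * e" and "\<epsilon> > 0"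
    and cover: "\<And>x v. norm v = 1 \<Longrightarrow>
      quad_form (mat_eval F x) v > - (\<epsilon> / 2) * poly_eval theta x ^ half_deg UNIV F \<or>
      (\<exists>d\<in>I. poly_eval (g d) x < - (poly_eval theta x ^ e))"
  shows "\<exists>c>0. eventually (\<lambda>M. \<forall>x v. norm v = 1 \<longrightarrow>
    \<epsilon> / 4 \<le> quad_form (mat_eval F x) v / poly_eval theta x ^ half_deg UNIV F + \<epsilon>
      - (\<Sum>d\<in>I. (poly_eval (g d) x / (c * poly_eval theta x ^ e))
          * (1 - poly_eval (g d) x / (c * poly_eval theta x ^ e)) ^ (2 * M))) sequentially"
proof -
  let ?d = "half_deg UNIV F"
  have th1: "poly_eval theta x \<ge> 1" for x :: "'n \<Rightarrow> real" by (simp add: poly_eval_theta sum_nonneg)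
  have sq: "sqrt (poly_eval theta x) ^ (2 * k) = poly_eval theta x ^ k" for x :: "'n \<Rightarrow> real" and k
    using th1[of x] by (simp add: power_mult)
  have "deg_in UNIV (F $ i $ j) \<le> 2 * ?d" for i j using deg_in_half_deg[of UNIV F i j] by linarith
  from quad_form_growth[OF this] obtain C where C: "C \<ge> 0"
    "\<And>x v. \<bar>quad_form (mat_eval F x) v\<bar> \<le> C * poly_eval theta x ^ ?d * (v \<bullet> v)" unfolding sq by blast
  have "\<forall>d. \<exists>c\<ge>0. \<forall>a. \<bar>poly_eval (g d) a\<bar> \<le> c * sqrt (poly_eval theta a) ^ deg_in UNIV (g d)"
    using poly_growth by blast
  then obtain c' where c': "\<And>d. c' d \<ge> 0"
    "\<And>d a. \<bar>poly_eval (g d) a\<bar> \<le> c' d * sqrt (poly_eval theta a) ^ deg_in UNIV (g d)" by metis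
  define c where "c = 1 + (\<Sum>d\<in>I. c' d)"
  have c: "c > 0" unfolding c_def by (intro add_pos_nonneg sum_nonneg c') auto
  define a where "a d x = poly_eval (g d) x / (c * poly_eval theta x ^ e)" for d and x :: "'n \<Rightarrow> real"
  have cth: "c * poly_eval theta x ^ e > 0" for x :: "'n \<Rightarrow> real" using c th1[of x] by (simp add: zero_less_power)
  have a1: "\<bar>a d x\<bar> \<le> 1" if "d \<in> I" for d x
  proof -
    have "\<bar>poly_eval (g d) x\<bar> \<le> c' d * sqrt (poly_eval theta x) ^ deg_in UNIV (g d)" by (rule c')
    also have "\<dots> \<le> c * sqrt (poly_eval theta x) ^ (2 * e)"
    proof (intro mult_mono power_increasing deg that)
      have "c' d \<le> (\<Sum>d\<in>I. c' d)" using that \<open>finite I\<close> by (intro member_le_sum c') auto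
      thus "c' d \<le> c" by (simp add: c_def)
    qed (use c c' th1[of x] in auto)
    finally show ?thesis using cth[of x] by (simp add: a_def sq abs_divide divide_le_eq abs_of_pos)
  qed
  define \<delta> where "\<delta> = 1 / c"
  have \<delta>: "\<delta> > 0" using c by (simp add: \<delta>_def)
  have neg: "a d x \<le> - \<delta>" if "poly_eval (g d) x < - (poly_eval theta x ^ e)" for d x
    using that cth[of x] c th1[of x] by (simp add: a_def \<delta>_def field_simps)
  define r where "r = real (card I)"
  define E where "E M = r * (1 / (2 * real M + 1))" for M
  have "(\<lambda>M. r * (1 / (2 * real M + 1))) \<longlonglongrightarrow> 0" by real_asymp
  hence "eventually (\<lambda>M. E M < \<epsilon> / 4) sequentially"
    unfolding E_def by (rule order_tendstoD) (use \<open>\<epsilon> > 0\<close> in simp)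
  moreover have "filterlim (\<lambda>M. \<delta> * (1 + 2 * real M * \<delta>)) at_top sequentially" using \<delta> by real_asymp
  hence "eventually (\<lambda>M. C + \<epsilon> \<le> \<delta> * (1 + 2 * real M * \<delta>)) sequentially"
    unfolding filterlim_at_top by blast
  ultimately have "eventually (\<lambda>M. \<forall>x v. norm v = 1 \<longrightarrow>
    \<epsilon> / 4 \<le> quad_form (mat_eval F x) v / poly_eval theta x ^ ?d + \<epsilon>
      - (\<Sum>d\<in>I. a d x * (1 - a d x) ^ (2 * M))) sequentially"
  proof eventually_elim
    case (elim M)
    show ?case
    proof (intro allI impI)
      fix x :: "'n \<Rightarrow> real" and v :: "real ^ 'p"
      assume v: "norm v = 1"
      let ?\<theta> = "poly_eval theta x" and ?q = "quad_form (mat_eval F x) v"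
      let ?t = "\<lambda>d. a d x * (1 - a d x) ^ (2 * M)"
      have \<theta>: "?\<theta> ^ ?d > 0" using th1[of x] by simp
      have E: "(\<Sum>d\<in>J. ?t d) \<le> E M" if "J \<subseteq> I" for J
      proof -
        have "(\<Sum>d\<in>J. ?t d) \<le> (\<Sum>d\<in>J. 1 / (2 * real M + 1))"
          using that by (intro sum_mono damped_bound a1) auto
        also have "\<dots> = real (card J) * (1 / (2 * real M + 1))" by simp
        also have "\<dots> \<le> E M"
          unfolding E_def r_def using that \<open>finite I\<close> by (intro mult_right_mono of_nat_mono card_mono) auto
        finally show ?thesis .
      qed
      show "\<epsilon> / 4 \<le> ?q / ?\<theta> ^ ?d + \<epsilon> - (\<Sum>d\<in>I. ?t d)"
      proof (cases "?q > - (\<epsilon> / 2) * ?\<theta> ^ ?d")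
        case True
        hence "?q / ?\<theta> ^ ?d > - (\<epsilon> / 2)" using \<theta> by (simp add: pos_less_divide_eq)
        with E[OF subset_refl] elim(1) \<open>\<epsilon> > 0\<close> show ?thesis by linarith
      next
        case False
        with cover[OF v, of x] obtain d where d: "d \<in> I" "poly_eval (g d) x < - (?\<theta> ^ e)" by blast
        have "?t d \<le> - (C + \<epsilon>)" using damped_negative[OF \<delta> neg[OF d(2)], of M] elim(2) by linarith
        moreover have "(\<Sum>d\<in>I. ?t d) = ?t d + (\<Sum>d\<in>I - {d}. ?t d)"
          using d(1) \<open>finite I\<close> by (rule sum.remove[rotated])
        moreover have "(\<Sum>d\<in>I - {d}. ?t d) \<le> E M" by (rule E) auto
        moreover have "?q / ?\<theta> ^ ?d \<ge> - C"
        proof -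
          have "v \<bullet> v = 1" using v by (simp add: norm_eq_1)
          hence "- C * ?\<theta> ^ ?d \<le> ?q" using C(2)[of x v] by simp
          thus ?thesis using \<theta> by (simp add: pos_le_divide_eq)
        qed
        ultimately show ?thesis using elim(1) \<open>\<epsilon> > 0\<close> by linarith
      qed
    qed
  qed
  thus ?thesis unfolding a_def using c by blast
qed

section \<open>The Positivstellensatz\<close>

definition scaled_row :: "'a::comm_semiring_1 \<Rightarrow> 'a ^ 'q \<Rightarrow> 'p \<Rightarrow> 'a ^ ('p::finite \<times> 'q::finite)" where
  "scaled_row s w k = (\<chi> r. if fst r = k then s * w $ snd r else 0)"

text \<open>
  The sum over \<open>d\<close> of \<open>s\<^sub>d\<^sup>2 (I\<^sub>p \<otimes> v\<^sub>d v\<^sub>d\<^sup>T)\<close>, written with the rows \<open>s\<^sub>d (e\<^sub>k \<otimes> v\<^sub>d)\<close>. The inner product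
  with \<open>G\<close> is a multiple of the identity matrix.
\<close>

definition block_squares :: "'i set \<Rightarrow> ('i \<Rightarrow> 'v rpoly) \<Rightarrow> ('i \<Rightarrow> real ^ 'q)
    \<Rightarrow> 'v rpoly ^ ('p::finite \<times> 'q::finite) ^ ('p \<times> 'q)" where
  "block_squares I s v = (\<Sum>d\<in>I. \<Sum>k\<in>UNIV. \<chi> r c.
     scaled_row (s d) (\<chi> a. Const (v d $ a)) k $ r * scaled_row (s d) (\<chi> a. Const (v d $ a)) k $ c)"

lemma sos_block_squares: "sos_mat (block_squares I s v)"
  unfolding block_squares_def by (intro sos_mat_sum sos_mat_rank_one)

lemma block_squares_nth:
  fixes s :: "'i \<Rightarrow> 'v rpoly"
  shows "(block_squares I s v :: 'v rpoly ^ ('p::finite \<times> 'q::finite) ^ ('p \<times> 'q)) $ (j, b) $ (i, a)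
    = (if i = j then \<Sum>d\<in>I. (s d)\<^sup>2 * (Const (v d $ a) * Const (v d $ b)) else 0)"
proof -
  have "(block_squares I s v :: 'v rpoly ^ ('p \<times> 'q) ^ ('p \<times> 'q)) $ (j, b) $ (i, a)
    = (\<Sum>d\<in>I. \<Sum>k\<in>UNIV. (if j = k then s d * Const (v d $ b) else 0) * (if i = k then s d * Const (v d $ a) else 0))"
    by (simp add: block_squares_def scaled_row_def cong: if_cong)
  also have "\<dots> = (\<Sum>d\<in>I. \<Sum>k\<in>UNIV. if k = j then (if i = j then (s d)\<^sup>2 * (Const (v d $ a) * Const (v d $ b)) else 0) else 0)"
    by (intro sum.cong refl) (auto simp: power2_eq_square mult_ac)
  also have "\<dots> = (if i = j then \<Sum>d\<in>I. (s d)\<^sup>2 * (Const (v d $ a) * Const (v d $ b)) else 0)"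
    by simp
  finally show ?thesis .
qed

lemma deg_in_block_squares:
  fixes s :: "'i \<Rightarrow> 'v::finite rpoly"
  assumes "\<And>d. d \<in> I \<Longrightarrow> deg_in V (s d) \<le> e"
  shows "mat_deg_in V (block_squares I s v :: 'v rpoly ^ ('p::finite \<times> 'q::finite) ^ ('p \<times> 'q)) \<le> 2 * e"
  unfolding mat_deg_in_le_iff
proof (intro allI)
  fix r c :: "'p \<times> 'q"
  obtain j b i a where rc: "r = (j, b)" "c = (i, a)" by (cases r, cases c) auto
  have "deg_in V (\<Sum>d\<in>I. (s d)\<^sup>2 * (Const (v d $ a) * Const (v d $ b))) \<le> 2 * e"
  proof (rule deg_in_sum)
    fix d assume "d \<in> I"
    from deg_in_mult[OF deg_in_power[OF assms[OF this], of 2] deg_in_mult[of V "Const (v d $ a)" 0 "Const (v d $ b)" 0]]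
    show "deg_in V ((s d)\<^sup>2 * (Const (v d $ a) * Const (v d $ b))) \<le> 2 * e" by simp
  qed
  thus "deg_in V ((block_squares I s v :: 'v rpoly ^ ('p \<times> 'q) ^ ('p \<times> 'q)) $ r $ c) \<le> 2 * e"
    unfolding rc block_squares_nth by simp
qed

lemma block_inner_block_squares:
  fixes G :: "'v::finite rpoly ^ 'q::finite ^ 'q"
  shows "poly_eval (block_inner (block_squares I s v :: 'v rpoly ^ ('p::finite \<times> 'q) ^ ('p \<times> 'q)) G $ i $ j) x
    = (if i = j then \<Sum>d\<in>I. (poly_eval (s d) x)\<^sup>2 * quad_form (mat_eval G x) (v d) else 0)"
proof (cases "i = j")
  case True
  have "poly_eval (block_inner (block_squares I s v :: 'v rpoly ^ ('p \<times> 'q) ^ ('p \<times> 'q)) G $ i $ j) x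
    = (\<Sum>a\<in>UNIV. \<Sum>b\<in>UNIV. \<Sum>d\<in>I. (poly_eval (s d) x)\<^sup>2 * (v d $ b * v d $ a * poly_eval (G $ b $ a) x))"
    using True by (simp add: block_inner_nth block_squares_nth poly_eval_hom sum_distrib_left mult_ac)
  also have "\<dots> = (\<Sum>a\<in>UNIV. \<Sum>d\<in>I. \<Sum>b\<in>UNIV. (poly_eval (s d) x)\<^sup>2 * (v d $ b * v d $ a * poly_eval (G $ b $ a) x))"
    by (intro sum.cong refl sum.swap)
  also have "\<dots> = (\<Sum>d\<in>I. \<Sum>a\<in>UNIV. \<Sum>b\<in>UNIV. (poly_eval (s d) x)\<^sup>2 * (v d $ b * v d $ a * poly_eval (G $ b $ a) x))"
    by (rule sum.swap)
  also have "\<dots> = (\<Sum>d\<in>I. \<Sum>b\<in>UNIV. \<Sum>a\<in>UNIV. (poly_eval (s d) x)\<^sup>2 * (v d $ b * v d $ a * poly_eval (G $ b $ a) x))"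
    by (intro sum.cong refl sum.swap)
  also have "\<dots> = (\<Sum>d\<in>I. (poly_eval (s d) x)\<^sup>2 * quad_form (mat_eval G x) (v d))"
    by (simp add: quad_form_sum mat_eval_def map_matrix_def sum_distrib_left)
  finally show ?thesis using True by simp
qed (simp add: block_inner_nth block_squares_nth)

theorem corollary4p1:
  fixes Y :: "(real ^ 'm) set"
    and \<nu> :: "(real ^ 'm) measure"
    and G :: "('n::finite + 'm::finite) rpoly ^ 'q::finite ^ 'q"
    and X :: "(real ^ 'n) set"
    and F :: "'n rpoly ^ 'p::finite ^ 'p"
    and \<epsilon> :: real
  assumes "closed Y"
    and "sets \<nu> = sets borel"
    and "measure_support \<nu> = Y"
    and "\<And>h :: 'm rpoly. (\<integral>\<^sup>+y\<in>Y. ennreal \<bar>poly_eval h (($) y)\<bar> \<partial>\<nu>) < \<infinity>"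
    and "\<And>j. carleman \<nu> Y j"
    and "symmetric_mat G"
    and "X = {x. \<forall>y\<in>Y. psd (mat_eval G (joint_point x y))}"
    and "symmetric_mat F"
    and "\<And>x. x \<in> X \<Longrightarrow> psd (mat_eval F (($) x))"
    and "\<epsilon> > 0"
  shows "\<exists>(N::nat) (S\<^sub>0 :: 'n rpoly ^ 'p ^ 'p) (S :: ('n + 'm) rpoly ^ ('p \<times> 'q) ^ ('p \<times> 'q)).
           sos_mat S\<^sub>0 \<and> sos_mat S \<and>
           mat_deg_in UNIV S\<^sub>0 \<le> 2 * (N + half_deg UNIV F) \<and>
           int (mat_deg_in (range Inl) S)
             \<le> 2 * (int N + int (half_deg UNIV F) - int (half_deg (range Inl) G)) \<and>
           map_matrix (\<lambda>P. theta ^ N * P) (F + mat (Const \<epsilon> * theta ^ half_deg UNIV F))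
             = S\<^sub>0 + mat_y_integral \<nu> Y (block_inner S G)"
proof -
  define dF where "dF = half_deg UNIV F"
  define dG where "dG = half_deg (range Inl) G"
  have dG: "dG > 0" using deg_in_half_deg[of "range Inl" G undefined undefined] unfolding dG_def by linarith
  have th1: "poly_eval theta x \<ge> 1" for x :: "'n \<Rightarrow> real" by (simp add: poly_eval_theta sum_nonneg)
  have int: "set_integrable \<nu> Y (pev h)" for h :: "'m rpoly"
    using set_integrable_pev[OF assms(1,2,4)] .
  define g where "g d = test_poly \<nu> Y G (fst d) (snd d)" for d :: "'m rpoly \<times> (real ^ 'q)"
  have geval: "poly_eval (g d) x = (LINT y:Y|\<nu>. (pev (fst d) y)\<^sup>2 * quad_form (mat_eval G (case_sum x (($) y))) (snd d))"
    for d x unfolding g_def by (rule poly_eval_test_poly[OF int])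
  have gdeg: "deg_in UNIV (g d) \<le> 2 * dG" for d
    unfolding g_def dG_def by (rule deg_in_test_poly)
  have "\<exists>I. finite I \<and> (\<forall>x v. norm v = 1 \<longrightarrow>
    quad_form (mat_eval F (($) x)) v > - (\<epsilon> / 2) * poly_eval theta (($) x) ^ half_deg UNIV F \<or>
    (\<exists>d\<in>I. poly_eval (g d) (($) x) < - (poly_eval theta (($) x) ^ dG)))"
  proof (rule finite_test_family[of X])
    show "quad_form (mat_eval F (($) x)) v \<ge> 0" if "x \<in> X" for x v
      using assms(9)[OF that] by (simp add: psd_def quad_form_def)
    show "\<exists>d. poly_eval (g d) (($) x) < - B" if "x \<notin> X" for x B
    proof -
      have "\<not> (\<forall>y\<in>Y. psd (mat_eval G (joint_point x y)))" using that assms(7) by simp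
      from test_poly_separates[OF assms(1-3) int assms(5,6) this, of B]
      show ?thesis unfolding g_def by force
    qed
  qed (rule assms(10))
  then obtain I where I: "finite I" and "\<forall>x v. norm v = 1 \<longrightarrow>
    quad_form (mat_eval F (($) x)) v > - (\<epsilon> / 2) * poly_eval theta (($) x) ^ half_deg UNIV F \<or>
    (\<exists>d\<in>I. poly_eval (g d) (($) x) < - (poly_eval theta (($) x) ^ dG))" by blast
  hence cover: "quad_form (mat_eval F x) v > - (\<epsilon> / 2) * poly_eval theta x ^ half_deg UNIV F \<or>
    (\<exists>d\<in>I. poly_eval (g d) x < - (poly_eval theta x ^ dG))" if "norm v = 1" for x v
  proof -
    have "($) (\<chi> i. x i) = x" by (simp add: fun_eq_iff)
    with \<open>\<forall>x v. _ x v\<close> that show ?thesis by metis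
  qed
  obtain c where c: "c > 0" and ev: "eventually (\<lambda>M. \<forall>x v. norm v = 1 \<longrightarrow>
    \<epsilon> / 4 \<le> quad_form (mat_eval F x) v / poly_eval theta x ^ dF + \<epsilon>
      - (\<Sum>d\<in>I. (poly_eval (g d) x / (c * poly_eval theta x ^ dG))
          * (1 - poly_eval (g d) x / (c * poly_eval theta x ^ dG)) ^ (2 * M))) sequentially"
    using damped_perturbation[OF I gdeg assms(10) cover] unfolding dF_def by blast
  from eventually_conj[OF ev eventually_ge_at_top[of "dF + 4"]]
  obtain M where M: "M \<ge> dF + 4" and lower: "\<And>x v. norm v = 1 \<Longrightarrow>
    \<epsilon> / 4 \<le> quad_form (mat_eval F x) v / poly_eval theta x ^ dF + \<epsilon>
      - (\<Sum>d\<in>I. (poly_eval (g d) x / (c * poly_eval theta x ^ dG))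
          * (1 - poly_eval (g d) x / (c * poly_eval theta x ^ dG)) ^ (2 * M))"
    by (auto simp: eventually_sequentially)
  \<comment> \<open>\<open>\<theta>\<^sup>D\<close> is the common denominator of the damped test functions, and \<open>D\<close> is large enough for a multiple of \<open>F\<close> and for \<open>matrix_reznick\<close>\<close>
  define D where "D = (2 * M + 1) * dG"
  have "1 * (2 * M + 1) \<le> D" unfolding D_def using dG by (subst mult.commute) (intro mult_le_mono, auto)
  hence D: "D \<ge> 4" "D \<ge> dF" using M by auto
  define N1 where "N1 = D - dF"
  have N1: "N1 + dF = D" using D by (simp add: N1_def)
  define u where "u d = Const (1 / c) * g d" for d
  have udeg: "deg_in UNIV (u d) \<le> 2 * dG" for d
    using deg_in_mult[of UNIV "Const (1 / c)" 0, OF _ gdeg] by (simp add: u_def)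
  \<comment> \<open>\<open>u / \<theta>^d\<^sub>G\<close> takes the role of \<open>a\<close>, so \<open>damp\<close> is \<open>1 - a\<close> without denominator\<close>
  define damp where "damp d = theta ^ dG - u d" for d
  have dampdeg: "deg_in UNIV (damp d) \<le> 2 * dG" for d
    unfolding damp_def by (intro deg_in_diff udeg deg_in_power deg_in_theta)
  define \<phi> where "\<phi> = (\<Sum>d\<in>I. u d * damp d ^ (2 * M))"
  have \<phi>deg: "deg_in UNIV \<phi> \<le> 2 * D"
    unfolding \<phi>_def
  proof (rule deg_in_sum)
    fix d
    have "deg_in UNIV (u d * damp d ^ (2 * M)) \<le> 2 * dG + 2 * dG * (2 * M)"
      by (intro deg_in_mult deg_in_power udeg dampdeg)
    also have "\<dots> = 2 * D" by (simp add: D_def algebra_simps)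
    finally show "deg_in UNIV (u d * damp d ^ (2 * M)) \<le> 2 * D" .
  qed
  define P where "P = map_matrix (\<lambda>Q. theta ^ N1 * Q) (F + mat (Const \<epsilon> * theta ^ dF)) - mat \<phi>"
  have Pnth: "P $ i $ j = theta ^ N1 * (F $ i $ j + (if i = j then Const \<epsilon> * theta ^ dF else 0))
      - (if i = j then \<phi> else 0)" for i j
    by (simp add: P_def map_matrix_def mat_def)
  have Pdeg: "deg_in UNIV (P $ i $ j) \<le> 2 * D" for i j
  proof -
    have "deg_in UNIV (F $ i $ j) \<le> 2 * dF" using deg_in_half_deg[of UNIV F i j] by (simp add: dF_def)
    moreover have "deg_in UNIV (Const \<epsilon> * theta ^ dF) \<le> 2 * dF"
      using deg_in_mult[of UNIV "Const \<epsilon>" 0, OF _ deg_in_power[OF deg_in_theta, of dF]] by simp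
    ultimately have "deg_in UNIV (theta ^ N1 * (F $ i $ j + (if i = j then Const \<epsilon> * theta ^ dF else 0)))
        \<le> 2 * N1 + 2 * dF"
      by (intro deg_in_mult deg_in_power deg_in_theta deg_in_add) auto
    moreover have "2 * N1 + 2 * dF = 2 * D" using N1 by simp
    ultimately show ?thesis unfolding Pnth using \<phi>deg by (intro deg_in_diff) auto
  qed
  have "eventually (\<lambda>N. sos_mat (map_matrix (\<lambda>Q. theta ^ N * Q) P)) sequentially"
  proof (rule matrix_reznick[OF _ _ D(1)])
    show "symmetric_mat P"
      using assms(8) by (simp add: symmetric_mat_iff Pnth)
    show "deg_in UNIV (P $ i $ j) \<le> 2 * D" for i j by (rule Pdeg)
    show "\<epsilon> / 4 > 0" using assms(10) by simp
    fix x :: "'n \<Rightarrow> real" and v :: "real ^ 'p"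
    let ?\<theta> = "poly_eval theta x"
    have \<theta>: "?\<theta> > 0" using th1[of x] by simp
    have "mat_eval P x = ?\<theta> ^ N1 *\<^sub>R (mat_eval F x + (\<epsilon> * ?\<theta> ^ dF) *\<^sub>R mat 1) + (- poly_eval \<phi> x) *\<^sub>R mat 1"
      by (simp add: vec_eq_iff mat_eval_def map_matrix_def Pnth poly_eval_hom mat_def)
    hence Pq: "quad_form (mat_eval P x) v
        = ?\<theta> ^ N1 * (quad_form (mat_eval F x) v + \<epsilon> * ?\<theta> ^ dF * (v \<bullet> v)) - poly_eval \<phi> x * (v \<bullet> v)" for v
      by (simp only: quad_form_linear quad_form_mat)
    have \<phi>x: "poly_eval \<phi> x = ?\<theta> ^ D * (\<Sum>d\<in>I. (poly_eval (g d) x / (c * ?\<theta> ^ dG))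
        * (1 - poly_eval (g d) x / (c * ?\<theta> ^ dG)) ^ (2 * M))"
      unfolding \<phi>_def poly_eval_hom sum_distrib_left
    proof (intro sum.cong refl)
      fix d
      define a where "a = poly_eval (g d) x / (c * ?\<theta> ^ dG)"
      have ua: "poly_eval (u d) x = ?\<theta> ^ dG * a" using \<theta> c by (simp add: u_def poly_eval_hom a_def)
      hence "poly_eval (damp d) x = ?\<theta> ^ dG * (1 - a)"
        by (simp add: damp_def poly_eval_hom algebra_simps)
      with ua have "poly_eval (u d) x * poly_eval (damp d) x ^ (2 * M)
          = (?\<theta> ^ dG * ?\<theta> ^ (dG * (2 * M))) * (a * (1 - a) ^ (2 * M))"
        by (simp add: power_mult_distrib power_mult)
      also have "?\<theta> ^ dG * ?\<theta> ^ (dG * (2 * M)) = ?\<theta> ^ D"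
        by (simp add: D_def power_add[symmetric] algebra_simps)
      finally show "poly_eval (u d) x * poly_eval (damp d) x ^ (2 * M) = ?\<theta> ^ D *
          (poly_eval (g d) x / (c * ?\<theta> ^ dG) * (1 - poly_eval (g d) x / (c * ?\<theta> ^ dG)) ^ (2 * M))"
        by (simp only: a_def)
    qed
    have unit: "\<epsilon> / 4 * ?\<theta> ^ D \<le> quad_form (mat_eval P x) w" if w: "norm w = 1" for w
    proof -
      have "w \<bullet> w = 1" using w by (simp add: norm_eq_1)
      moreover have "?\<theta> ^ N1 = ?\<theta> ^ D / ?\<theta> ^ dF" using \<theta> by (simp add: N1[symmetric] power_add)
      ultimately have "quad_form (mat_eval P x) w = ?\<theta> ^ D * (quad_form (mat_eval F x) w / ?\<theta> ^ dF + \<epsilon>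
          - (\<Sum>d\<in>I. (poly_eval (g d) x / (c * ?\<theta> ^ dG)) * (1 - poly_eval (g d) x / (c * ?\<theta> ^ dG)) ^ (2 * M)))"
        unfolding Pq \<phi>x using \<theta> by (simp add: distrib_left right_diff_distrib)
      also have "\<dots> \<ge> ?\<theta> ^ D * (\<epsilon> / 4)"
        using \<theta> by (intro mult_left_mono lower w) auto
      finally show ?thesis by (simp add: mult.commute)
    qed
    show "\<epsilon> / 4 * ?\<theta> ^ D * (v \<bullet> v) \<le> quad_form (mat_eval P x) v"
      by (rule quad_form_bound_from_unit) (rule unit)
  qed
  then obtain n where n: "\<And>N. N \<ge> n \<Longrightarrow> sos_mat (map_matrix (\<lambda>Q. theta ^ N * Q) P)"
    by (auto simp: eventually_sequentially)
  \<comment> \<open>an even power of \<open>\<theta>\<close>, so that its square root can be absorbed into the rows of \<open>S\<close>\<close>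
  define S0 where "S0 = map_matrix (\<lambda>Q. theta ^ (2 * n) * Q) P"
  define s where "s d = Const (sqrt (1 / c)) * lift_x (theta ^ n * damp d ^ M) * lift_y (fst d)" for d :: "'m rpoly \<times> (real ^ 'q)"
  define S :: "('n + 'm) rpoly ^ ('p \<times> 'q) ^ ('p \<times> 'q)" where "S = block_squares I s snd"
  define N where "N = N1 + 2 * n"
  have "mat_deg_in UNIV S0 \<le> 2 * (N + dF)"
    unfolding mat_deg_in_le_iff
  proof (intro allI)
    fix i j
    have "deg_in UNIV (theta ^ (2 * n) * P $ i $ j) \<le> 2 * (2 * n) + 2 * D"
      by (intro deg_in_mult deg_in_power deg_in_theta Pdeg)
    also have "\<dots> = 2 * (N + dF)" using N1 by (simp add: N_def)
    finally show "deg_in UNIV (S0 $ i $ j) \<le> 2 * (N + dF)" by (simp add: S0_def map_matrix_def)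
  qed
  moreover have "int (mat_deg_in (range Inl) S) \<le> 2 * (int N + int dF - int dG)"
  proof -
    define e where "e = 2 * n + 2 * dG * M"
    have "deg_in (range Inl) (s d) \<le> 0 + e + 0" for d
      unfolding s_def e_def
      by (intro deg_in_mult order_trans[OF deg_in_lift_x] deg_in_power deg_in_theta dampdeg)
         (simp_all add: deg_in_lift_y)
    hence "mat_deg_in (range Inl) S \<le> 2 * e"
      unfolding S_def by (intro deg_in_block_squares) simp
    hence "int (mat_deg_in (range Inl) S) \<le> 2 * int e" by presburger
    moreover have "N + dF = e + dG" using N1 by (simp add: N_def D_def e_def algebra_simps)
    hence "int N + int dF = int e + int dG" by presburger
    ultimately show ?thesis by simp
  qed
  moreover have "map_matrix (\<lambda>P. theta ^ N * P) (F + mat (Const \<epsilon> * theta ^ dF))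
      = S0 + mat_y_integral \<nu> Y (block_inner S G)"
  proof -
    have "poly_eval (y_integral \<nu> Y (block_inner S G $ i $ j)) x = (if i = j then poly_eval theta x ^ (2 * n) * poly_eval \<phi> x else 0)"
      for i j x
    proof (cases "i = j")
      case True
      define E where "E d = poly_eval theta x ^ n * poly_eval (damp d) x ^ M" for d
      define t where "t d y = (pev (fst d) y)\<^sup>2 * quad_form (mat_eval G (case_sum x (($) y))) (snd d)" for d y
      have tint: "set_integrable \<nu> Y (t d)" for d
      proof -
        obtain h :: "'m rpoly" where "\<And>y. poly_eval h y = poly_eval ((lift_y (fst d))\<^sup>2 * quad_poly G (snd d)) (case_sum x y)"
          using freeze_x[of "(lift_y (fst d))\<^sup>2 * quad_poly G (snd d)" x] by blast
        hence "t d = pev h" by (simp add: t_def fun_eq_iff poly_eval_hom poly_eval_lift poly_eval_quad_poly)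
        thus ?thesis using int by simp
      qed
      have "poly_eval (y_integral \<nu> Y (block_inner S G $ i $ j)) x
          = (LINT y:Y|\<nu>. poly_eval (block_inner S G $ i $ j) (case_sum x (($) y)))"
        by (rule poly_eval_y_integral[OF int])
      also have "\<dots> = (LINT y:Y|\<nu>. \<Sum>d\<in>I. ((E d)\<^sup>2 / c) * t d y)"
        unfolding S_def block_inner_block_squares s_def using True c
        by (simp add: poly_eval_hom poly_eval_lift E_def t_def power_mult_distrib mult_ac)
      also have "\<dots> = (\<Sum>d\<in>I. ((E d)\<^sup>2 / c) * (LINT y:Y|\<nu>. t d y))"
        by (rule set_integral_sum_cmult[OF tint])
      also have "\<dots> = (\<Sum>d\<in>I. (E d)\<^sup>2 * poly_eval (u d) x)"
        by (simp add: u_def poly_eval_hom geval t_def)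
      also have "\<dots> = poly_eval theta x ^ (2 * n) * poly_eval \<phi> x"
        by (simp add: \<phi>_def poly_eval_hom sum_distrib_left E_def power_mult_distrib power_mult[symmetric] mult_ac)
      finally show ?thesis using True by simp
    next
      case False
      thus ?thesis
        unfolding poly_eval_y_integral[OF int] S_def block_inner_block_squares by simp
    qed
    hence "poly_eval (theta ^ N * (F + mat (Const \<epsilon> * theta ^ dF)) $ i $ j) x
        = poly_eval (S0 $ i $ j + y_integral \<nu> Y (block_inner S G $ i $ j)) x" for i j x
      by (simp add: S0_def map_matrix_def Pnth poly_eval_hom N_def power_add mat_def algebra_simps)
    hence "theta ^ N * (F + mat (Const \<epsilon> * theta ^ dF)) $ i $ j
        = S0 $ i $ j + y_integral \<nu> Y (block_inner S G $ i $ j)" for i j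
      by (rule rpoly_eqI)
    thus ?thesis by (simp add: vec_eq_iff map_matrix_def mat_y_integral_def)
  qed
  moreover have "sos_mat S0" unfolding S0_def by (rule n) simp
  moreover have "sos_mat S" unfolding S_def by (rule sos_block_squares)
  ultimately show ?thesis unfolding dF_def dG_def by blast
qed

end
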